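(* Let $q$ be a prime power, $m\ge1$, and let $Y$ be a nonempty nondegenerate subset of $\mathscr Q(m,q)$ with inner distribution $(a_i)_{i\in I}$. Then the distance enumerator of the code $\mathcal C(Y)$ is $\sum_{i\in I}a_i\,\omega_i(z)$.
   Context: Let $V$ be an $m$-dimensional $\mathbb F_q$-vector space, $V^*=V\setminus\{0\}$, and $\mathscr Q(m,q)$ the set of quadratic forms on $V$. For $Q$ let $S_Q(x,y)=Q(x+y)-Q(x)-Q(y)$; the radical of $Q$ is $\{x:S_Q(x,y)=0\ \forall y,\ Q(x)=0\}$ and the rank of $Q$ is its codimension. Quadratic forms $Q,Q'$ are equivalent if $Q'(x)=aQ(Lx)$ with $a\in\mathbb F_q^*$, $L\in GL(V)$. Fix $\lambda\in\mathbb F_q$ of absolute trace $1$ ($q$ even) and a nonsquare $\eta\in\mathbb F_q^*$ ($q$ odd). A quadratic form of rank $2s\ge2$ has type $1$ if equivalent to the form given in coordinates of some basis by $\sum_{i=1}^sx_{2i-1}x_{2i}$ and type $-1$ if equivalent to $\sum_{i=1}^{s-1}x_{2i-1}x_{2i}+Q_0$, $Q_0=x_{2s-1}^2+x_{2s-1}x_{2s}+\lambda x_{2s}^2$ ($q$ even) or $x_{2s-1}^2-\eta x_{2s}^2$ ($q$ odd); each has exactly one type; the zero form has rank $0$ and type $1$. Let $I=\{2s+1:s\in\mathbb Z\}\cup\{(2s,\tau):s\in\mathbb Z,\tau=\pm1\}$, $\mathscr Q_{2s+1}$ the forms of rank $2s+1$, $\mathscr Q_{2s,\tau}$ those of rank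 $2s$ and type $\tau$. The inner distribution of $Y$ is $a_i=\lvert\{(Q,Q')\in Y\times Y:Q-Q'\in\mathscr Q_i\}\rvert/\lvert Y\rvert$ ($i\in I$). Codes: a function $f:V\to\mathbb F_q$ with $f(0)=0$ is identified with the vector $(f(x))_{x\in V^*}\in\mathbb F_q^{V^*}$; the Hamming weight $\mathrm{wt}$ counts nonzero entries. $R_q(1,m)^*$ is the set of vectors $(g(x))_{x\in V^*}$ for all affine functions $g=\ell+c$ ($\ell:V\to\mathbb F_q$ linear, $c\in\mathbb F_q$). $Y\subseteq\mathscr Q(m,q)$ is nondegenerate if $q>2$, or $q=2$ and $Y$ contains no form of rank $1$. Then $\mathcal C(Y)=\bigcup_{Q\in Y}\big((Q(x))_{x\in V^*}+R_q(1,m)^*\big)$. The distance enumerator of a code $\mathcal C$ is $\frac{1}{\lvert\mathcal C\rvert}\sum_{b,c\in\mathcal C}z^{\mathrm{wt}(c-b)}$. Polynomials: for $i\in I$, $\omega_i(z)=\sum_{l=1}^6 n_lz^{w_l}$, where for $i=2s+1$: $w_1=q^{m-1}(q-1)-q^{m-s-1}-1$, $n_1=\frac12(q^{2s}(q-1)-q^s)(q-1)$; $w_2=q^{m-1}(q-1)-q^{m-s-1}$, $n_2=\frac12(q^{2s}+q^s)(q-1)$; $w_3=q^{m-1}(q-1)-1$, $n_3=(q^m-q^{2s}(q-1))(q-1)$; $w_4=q^{m-1}(q-1)$, $n_4=q^m-q^{2s}(q-1)$; $w_5=q^{m-1}(q-1)+q^{m-s-1}-1$, $n_5=\frac12(q^{2s}(q-1)+q^s)(q-1)$;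 $w_6=q^{m-1}(q-1)+q^{m-s-1}$, $n_6=\frac12(q^{2s}-q^s)(q-1)$; and for $i=(2s,\tau)$: $w_1=(q^{m-1}-\tau q^{m-s-1})(q-1)-1$, $n_1=(q^{2s-1}-\tau q^{s-1})(q-1)$; $w_2=(q^{m-1}-\tau q^{m-s-1})(q-1)$, $n_2=q^{2s-1}+\tau q^{s-1}(q-1)$; $w_3=q^{m-1}(q-1)-1$, $n_3=(q^m-q^{2s})(q-1)$; $w_4=q^{m-1}(q-1)$, $n_4=q^m-q^{2s}$; $w_5=q^{m-1}(q-1)+\tau q^{m-s-1}-1$, $n_5=(q^{2s-1}(q-1)+\tau q^{s-1})(q-1)$; $w_6=q^{m-1}(q-1)+\tau q^{m-s-1}$, $n_6=(q^{2s-1}-\tau q^{s-1})(q-1)$.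
   Formalization: Added, exactly where the claim fails because words Q+l+c coincide on V*: for q=2 no two members of Y differ by a form of rank 1 (fails for Y={x1x2, x1x2+x1^2}); (q,m) is not (2,1); and |Y|=1 when (q,m) is (2,2) or (3,1). *)

theory Defs
  imports
    "HOL-Computational_Algebra.Computational_Algebra"
    "HOL-Library.FuncSet"
    "HOL-Library.Cardinality"
begin

text \<open>The trace of a finite field over its prime field, as an element of the field itself.\<close>

definition absolute_trace :: "'q::{field,finite} \<Rightarrow> 'q" where
  "absolute_trace x = (\<Sum>i<(THE e. CARD('q) = CHAR('q) ^ e). x ^ (CHAR('q) ^ i))"

definition nonsquare :: "'q::field \<Rightarrow> bool" where
  "nonsquare x \<longleftrightarrow> x \<noteq> 0 \<and> (\<nexists>y. x = y ^ 2)"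

text \<open>\<open>OddRank s\<close> stands for the index \<open>2s+1\<close> and \<open>EvenRank s \<tau>\<close> for the index \<open>(2s,\<tau>)\<close>.\<close>

datatype form_index = OddRank int | EvenRank int int

definition form_indices :: "form_index set" where
  "form_indices = range OddRank \<union> {EvenRank s \<tau> | s \<tau>. \<tau> = 1 \<or> \<tau> = -1}"

text \<open>The vector space is the whole type \<open>'b\<close>, over the field \<open>'a\<close>; its dimension
  is \<open>dim UNIV\<close>. The parameters \<open>lam\<close> and \<open>eta\<close> are the fixed element of absolute trace one
  (even characteristic) and the fixed nonsquare (odd characteristic).\<close>

locale finite_field_space = vector_space scale
  for scale :: "'a::{field,finite} \<Rightarrow> 'b::ab_group_add \<Rightarrow> 'b"
begin

definition polar :: "('b \<Rightarrow> 'a) \<Rightarrow> 'b \<Rightarrow> 'b \<Rightarrow> 'a" where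
  "polar Q x y = Q (x + y) - Q x - Q y"

definition quadratic_form :: "('b \<Rightarrow> 'a) \<Rightarrow> bool" where
  "quadratic_form Q \<longleftrightarrow>
     (\<forall>a x. Q (scale a x) = a ^ 2 * Q x) \<and>
     (\<forall>x. Vector_Spaces.linear scale (*) (\<lambda>y. polar Q x y)) \<and>
     (\<forall>y. Vector_Spaces.linear scale (*) (\<lambda>x. polar Q x y))"

definition form_radical :: "('b \<Rightarrow> 'a) \<Rightarrow> 'b set" where
  "form_radical Q = {x. (\<forall>y. polar Q x y = 0) \<and> Q x = 0}"

definition form_rank :: "('b \<Rightarrow> 'a) \<Rightarrow> nat" where
  "form_rank Q = dim UNIV - dim (form_radical Q)"

definition form_equivalent :: "('b \<Rightarrow> 'a) \<Rightarrow> ('b \<Rightarrow> 'a) \<Rightarrow> bool" where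
  "form_equivalent Q Q' \<longleftrightarrow>
     (\<exists>a L. a \<noteq> 0 \<and> Vector_Spaces.linear scale scale L \<and> bij L \<and> (\<forall>x. Q' x = a * Q (L x)))"

definition ordered_basis :: "(nat \<Rightarrow> 'b) \<Rightarrow> bool" where
  "ordered_basis v \<longleftrightarrow> inj_on v {1..dim UNIV} \<and>
     independent (v ` {1..dim UNIV}) \<and> span (v ` {1..dim UNIV}) = UNIV"

definition coordinate :: "(nat \<Rightarrow> 'b) \<Rightarrow> 'b \<Rightarrow> nat \<Rightarrow> 'a" where
  "coordinate v x i = representation (v ` {1..dim UNIV}) x (v i)"

definition hyperbolic_form :: "(nat \<Rightarrow> 'b) \<Rightarrow> nat \<Rightarrow> 'b \<Rightarrow> 'a" where
  "hyperbolic_form v s x = (\<Sum>i=1..s. coordinate v x (2*i-1) * coordinate v x (2*i))"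

definition elliptic_form :: "'a \<Rightarrow> 'a \<Rightarrow> (nat \<Rightarrow> 'b) \<Rightarrow> nat \<Rightarrow> 'b \<Rightarrow> 'a" where
  "elliptic_form lam eta v s x =
     (let y = coordinate v x (2*s-1); z = coordinate v x (2*s) in
      hyperbolic_form v (s-1) x +
      (if even CARD('a) then y ^ 2 + y * z + lam * z ^ 2 else y ^ 2 - eta * z ^ 2))"

definition has_type :: "'a \<Rightarrow> 'a \<Rightarrow> ('b \<Rightarrow> 'a) \<Rightarrow> int \<Rightarrow> bool" where
  "has_type lam eta Q \<tau> \<longleftrightarrow> even (form_rank Q) \<and>
     (if form_rank Q = 0 then \<tau> = 1
      else (\<tau> = 1 \<and> (\<exists>v. ordered_basis v \<and>
               form_equivalent Q (hyperbolic_form v (form_rank Q div 2)))) \<or>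
           (\<tau> = -1 \<and> (\<exists>v. ordered_basis v \<and>
               form_equivalent Q (elliptic_form lam eta v (form_rank Q div 2)))))"

fun form_class :: "'a \<Rightarrow> 'a \<Rightarrow> form_index \<Rightarrow> ('b \<Rightarrow> 'a) set" where
  "form_class lam eta (OddRank s) = {Q. quadratic_form Q \<and> int (form_rank Q) = 2 * s + 1}"
| "form_class lam eta (EvenRank s \<tau>) =
     {Q. quadratic_form Q \<and> int (form_rank Q) = 2 * s \<and> has_type lam eta Q \<tau>}"

definition inner_distribution :: "'a \<Rightarrow> 'a \<Rightarrow> ('b \<Rightarrow> 'a) set \<Rightarrow> form_index \<Rightarrow> real" where
  "inner_distribution lam eta Y i =
     real (card {(Q, Q') \<in> Y \<times> Y. (\<lambda>x. Q x - Q' x) \<in> form_class lam eta i}) / real (card Y)"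

definition nondegenerate :: "('b \<Rightarrow> 'a) set \<Rightarrow> bool" where
  "nondegenerate Y \<longleftrightarrow> CARD('a) > 2 \<or> (CARD('a) = 2 \<and> (\<forall>Q\<in>Y. form_rank Q \<noteq> 1))"

text \<open>A vector indexed by the nonzero elements of the space is an extensional function on
  \<open>nonzero\<close>, so that two codewords are equal iff their entries agree.\<close>

abbreviation nonzero :: "'b set" where
  "nonzero \<equiv> UNIV - {0}"

definition affine_code :: "('b \<Rightarrow> 'a) set" where
  "affine_code = {restrict (\<lambda>x. l x + c) nonzero | l c. Vector_Spaces.linear scale (*) l}"

definition code_of_forms :: "('b \<Rightarrow> 'a) set \<Rightarrow> ('b \<Rightarrow> 'a) set" where
  "code_of_forms Y = (\<Union>Q\<in>Y. {restrict (\<lambda>x. Q x + r x) nonzero | r. r \<in> affine_code})"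

definition hamming_weight :: "('b \<Rightarrow> 'a) \<Rightarrow> nat" where
  "hamming_weight c = card {x \<in> nonzero. c x \<noteq> 0}"

definition distance_enumerator :: "('b \<Rightarrow> 'a) set \<Rightarrow> real poly" where
  "distance_enumerator C =
     smult (1 / real (card C)) (\<Sum>b\<in>C. \<Sum>c\<in>C. monom 1 (hamming_weight (\<lambda>x. c x - b x)))"

end

text \<open>The coefficients are computed in the reals, with integer exponents, since \<open>q\<close> may occur to
  the power \<open>-1\<close> and there are factors one half. The exponents of \<open>z\<close> are computed in the
  integers and truncated to natural numbers. For an index that occurs for a quadratic form
  (\<open>0 \<le> 2s+1 \<le> m\<close>, or \<open>0 \<le> 2s \<le> m\<close> with \<open>\<tau> = 1\<close> if \<open>s = 0\<close>; \<open>m \<ge> 1\<close>) all powers of \<open>q\<close> in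
  them have nonnegative exponents, and a negative \<open>w\<close> (only \<open>w = -1\<close>) has coefficient zero.\<close>

definition term_poly :: "real \<Rightarrow> int \<Rightarrow> real poly" where
  "term_poly n w = monom n (nat w)"

fun omega :: "nat \<Rightarrow> nat \<Rightarrow> form_index \<Rightarrow> real poly" where
  "omega q m (OddRank s) =
     (let A = int q ^ (m - 1) * (int q - 1);
          B = int q ^ nat (int m - s - 1);
          u = real q powi (2 * s);
          v = real q powi s;
          p = real q - 1
      in term_poly (1/2 * (u * p - v) * p) (A - B - 1)
       + term_poly (1/2 * (u + v) * p) (A - B)
       + term_poly ((real q ^ m - u * p) * p) (A - 1)
       + term_poly (real q ^ m - u * p) A
       + term_poly (1/2 * (u * p + v) * p) (A + B - 1)
       + term_poly (1/2 * (u - v) * p) (A + B))"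
| "omega q m (EvenRank s \<tau>) =
     (let A = int q ^ (m - 1);
          B = int q ^ nat (int m - s - 1);
          t = real_of_int \<tau>;
          u = real q powi (2 * s - 1);
          v = real q powi (s - 1);
          p = real q - 1
      in term_poly ((u - t * v) * p) ((A - \<tau> * B) * (int q - 1) - 1)
       + term_poly (u + t * v * p) ((A - \<tau> * B) * (int q - 1))
       + term_poly ((real q ^ m - real q powi (2 * s)) * p) (A * (int q - 1) - 1)
       + term_poly (real q ^ m - real q powi (2 * s)) (A * (int q - 1))
       + term_poly ((u * p + t * v) * p) (A * (int q - 1) + \<tau> * B - 1)
       + term_poly ((u - t * v) * p) (A * (int q - 1) + \<tau> * B))"

text \<open>The inner distribution has finite support, so the sum over all indices is the sum over
  those with a nonzero entry.\<close>

definition index_sum :: "(form_index \<Rightarrow> real) \<Rightarrow> (form_index \<Rightarrow> real poly) \<Rightarrow> real poly" where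
  "index_sum a w = (\<Sum>i | i \<in> form_indices \<and> a i \<noteq> 0. smult (a i) (w i))"

end

theory Submission
  imports Defs
begin

text \<open>The differences of codewords reduce the claim to the weight enumerator of a single coset
  \<open>Q + R\<^sub>q(1,m)\<^sup>*\<close>. By Witt decomposition \<open>Q\<close> is, in suitable coordinates, a sum of hyperbolic
  planes and an anisotropic form in at most two variables. Value distributions of sums in
  separate variables are convolutions, which shows that the number of zeros of \<open>Q + l + c\<close>
  (\<open>l\<close> linear, \<open>c\<close> constant) deviates from \<open>q\<^bsup>m-1\<^esup>\<close> by one of only three values. How often each value
  occurs then follows from the first two moments of the deviation, taken over all \<open>l\<close> for
  \<open>c = 0\<close> and over all pairs \<open>(l, c)\<close>; these are double counts that hardly depend on \<open>Q\<close>.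
  The number of zeros of \<open>Q\<close> itself separates the two types.\<close>

section \<open>Finite fields\<close>

text \<open>Dividing by the size of the code calls for an injective map from triples
  \<open>(Q, l, c)\<close> to words, and here small fields interfere. Two forms yield the same coset
  exactly if their difference agrees with an affine function on the nonzero vectors. Over two
  elements a form of rank 1 is the square of a functional, hence a functional. The form
  \<open>x^2 + xy + y^2\<close> for \<open>q = 2\<close>, \<open>m = 2\<close> and the form
  \<open>x^2\<close> for \<open>q = 3\<close>, \<open>m = 1\<close> are constantly 1 on nonzero
  vectors, and for \<open>q = 2\<close>, \<open>m = 1\<close> the affine functions themselves
  collapse. Hence the theorem asks about differences of members of \<open>Y\<close> and restricts
  these dimensions. The six terms of \<open>omega\<close> are three deviations, each for
  \<open>c = 0\<close> and for nonzero \<open>c\<close>: the zero vector is not a coordinate, so a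
  nonzero \<open>c\<close> lowers the weight by one. Counts for nonzero \<open>c\<close> come by
  subtraction, all pairs minus those with \<open>c = 0\<close>, as the moments over all pairs are
  free of \<open>Q\<close>.\<close>

lemma even_card_involution:
  assumes "finite A" "\<And>x. x \<in> A \<Longrightarrow> f x \<in> A" "\<And>x. x \<in> A \<Longrightarrow> f (f x) = x" "\<And>x. x \<in> A \<Longrightarrow> f x \<noteq> x"
  shows "even (card A)"
  using assms
proof (induction "card A" arbitrary: A rule: less_induct)
  case less
  show ?case
  proof (cases "A = {}")
    case False
    then obtain x where x: "x \<in> A" by auto
    let ?B = "A - {x, f x}"
    have sub: "{x, f x} \<subseteq> A" and c2: "card {x, f x} = 2"
      using x less.prems(2,4) less.prems(4)[THEN not_sym] by (auto simp: card_insert_if)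
    then have eq: "card A = card ?B + 2"
      using less.prems(1) by (metis card_Diff_subset card_mono finite_subset le_add_diff_inverse2)
    have "even (card ?B)"
    proof (rule less.hyps)
      show "card ?B < card A" using eq by simp
      show "f y \<in> ?B" if "y \<in> ?B" for y
        using that less.prems(2,3) x by (metis Diff_iff insert_iff empty_iff)
    qed (use less.prems in auto)
    then show ?thesis using eq by simp
  qed auto
qed

text \<open>Adding 1 pairs off the field when \<open>2 = 0\<close>; negation pairs off the nonzero
  elements when it is not. The parity test of \<open>elliptic_form\<close> thus becomes an equation
  that the algebra can use.\<close>

lemma even_card_iff_two_eq_0:
  "even CARD('q::{field,finite}) \<longleftrightarrow> (2::'q) = 0"
proof
  assume two: "(2::'q) = 0"
  show "even CARD('q)"
  proof (rule even_card_involution[where f = "\<lambda>x. x + 1"])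
    show "x + 1 + 1 = x" for x :: 'q using two by (simp add: add.assoc one_add_one)
  qed auto
next
  assume ev: "even CARD('q)"
  show "(2::'q) = 0"
  proof (rule ccontr)
    assume two: "(2::'q) \<noteq> 0"
    have "even (card (UNIV - {0::'q}))"
    proof (rule even_card_involution[where f = uminus])
      fix x :: 'q assume "x \<in> UNIV - {0}"
      then have "2 * x \<noteq> 0" using two by simp
      then show "- x \<noteq> x" by (metis add.right_inverse mult_2)
    qed auto
    moreover have "CARD('q) = Suc (card (UNIV - {0::'q}))"
      by (simp add: card_Suc_Diff1)
    ultimately show False using ev by (metis even_Suc)
  qed
qed

lemma card_field_ge_2: "CARD('q::{field,finite}) \<ge> 2"
proof -
  have "card {0, 1::'q} \<le> CARD('q)" by (rule card_mono) auto
  then show ?thesis by simp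
qed

section \<open>Characteristic two: squaring, the trace and the map \<open>t^2 + t\<close>\<close>

context
  assumes two: "(2::'q::{field,finite}) = 0"
begin

lemma char2_add_self: "x + x = (0::'q)"
  using two by (metis mult_2 mult_zero_left)

lemma char2_uminus: "- x = (x::'q)"
  using char2_add_self[of x] by (metis add_eq_0_iff)

lemma char2_square_add: "(x + y) ^ 2 = x ^ 2 + (y::'q) ^ 2"
  by (simp add: power2_sum two)

lemma char2_inj_square: "inj (\<lambda>x::'q. x ^ 2)"
proof (rule injI)
  fix x y :: 'q assume "x ^ 2 = y ^ 2"
  then have "(x + y) ^ 2 = 0" by (simp add: char2_square_add char2_add_self)
  then have "x + y = 0" by simp
  then show "x = y" by (metis add_eq_0_iff char2_uminus)
qed

lemma char2_bij_square: "bij (\<lambda>x::'q. x ^ 2)"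
  by (simp add: bij_def char2_inj_square finite_UNIV_inj_surj)

lemma char2_power_add: "(x + y) ^ 2 ^ i = x ^ 2 ^ i + (y::'q) ^ 2 ^ i"
  by (induction i arbitrary: x y) (simp_all add: power_mult char2_square_add)

text \<open>Take a largest additive subgroup whose order is a power of two (closure under addition
  suffices, as \<open>- x = x\<close>). A missing element would add a disjoint coset and double it.
  The exponent is the one that \<open>absolute_trace\<close> selects by \<open>THE\<close>.\<close>

lemma char2_card_power: "\<exists>e. CARD('q) = 2 ^ e"
proof -
  define P where "P k \<longleftrightarrow> (\<exists>H::'q set. 0 \<in> H \<and> (\<forall>x\<in>H. \<forall>y\<in>H. x + y \<in> H) \<and> card H = 2 ^ k)" for k
  have P0: "P 0" unfolding P_def by (rule exI[of _ "{0}"]) auto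
  have bound: "k \<le> CARD('q)" if "P k" for k
  proof -
    from that obtain H :: "'q set" where "card H = 2 ^ k" unfolding P_def by auto
    moreover have "card H \<le> CARD('q)" by (rule card_mono) auto
    moreover have "k < 2 ^ k" by (rule less_exp)
    ultimately show ?thesis by linarith
  qed
  obtain k where k: "P k" "\<forall>j. P j \<longrightarrow> j \<le> k"
    using Nat.ex_has_greatest_nat[of P 0 "CARD('q)"] P0 bound by blast
  obtain H :: "'q set" where H: "0 \<in> H" "\<forall>x\<in>H. \<forall>y\<in>H. x + y \<in> H" "card H = 2 ^ k"
    using k(1) unfolding P_def by auto
  have "H = UNIV"
  proof (rule ccontr)
    assume "H \<noteq> UNIV"
    then obtain x where x: "x \<notin> H" by auto
    let ?K = "H \<union> (+) x ` H"
    have disj: "H \<inter> (+) x ` H = {}"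
    proof (rule ccontr)
      assume "H \<inter> (+) x ` H \<noteq> {}"
      then obtain h where h: "h \<in> H" "x + h \<in> H" by auto
      then have "x + h + h \<in> H" using H(2) by blast
      then show False using x by (simp add: add.assoc char2_add_self)
    qed
    have "card ?K = 2 ^ Suc k"
      using H(3) by (subst card_Un_disjoint[OF _ _ disj]) (auto simp: card_image)
    moreover have "\<forall>a\<in>?K. \<forall>b\<in>?K. a + b \<in> ?K"
    proof (intro ballI)
      fix a b assume "a \<in> ?K" "b \<in> ?K"
      then obtain h h' where h: "h \<in> H" "h' \<in> H" "a = h \<or> a = x + h" "b = h' \<or> b = x + h'" by auto
      then have "h + h' \<in> H" using H(2) by blast
      moreover have "x + h + (x + h') = h + h'"
        by (metis add.assoc add.left_commute add_0 char2_add_self)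
      ultimately show "a + b \<in> ?K" using h(3,4)
        by (auto simp: ac_simps intro: rev_image_eqI[of "h + h'"])
    qed
    moreover have "0 \<in> ?K" using H(1) by simp
    ultimately have "P (Suc k)" unfolding P_def by (intro exI[of _ ?K] conjI)
    then show False using k(2) by fastforce
  qed
  then show ?thesis using H(3) by auto
qed

end

text \<open>Multiplication by a nonzero \<open>x\<close> permutes the nonzero elements, so it fixes
  their product.\<close>

lemma field_power_card: "x ^ CARD('q) = (x::'q::{field,finite})"
proof (cases "x = 0")
  case False
  let ?A = "UNIV - {0::'q}"
  let ?P = "\<Prod>?A"
  have "bij_betw ((*) x) ?A ?A"
    by (rule bij_betw_byWitness[where f' = "(*) (inverse x)"]) (use False in auto)
  then have "?P = (\<Prod>y\<in>?A. x * y)"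
    by (subst prod.reindex_bij_betw[symmetric, where h = "(*) x" and S = ?A and T = ?A]) auto
  then have "?P = x ^ card ?A * ?P" by (simp add: prod.distrib)
  moreover have "?P \<noteq> 0" by (simp add: prod_zero_iff)
  ultimately have "x ^ card ?A = 1" by simp
  moreover have "CARD('q) = Suc (card ?A)" by (simp add: card_Suc_Diff1)
  ultimately show ?thesis by (metis power_Suc mult.right_neutral)
qed (simp add: power_0_left)

text \<open>Frobenius is additive, so the trace telescopes to \<open>t^q - t\<close>. Hence an
  element of trace 1 is not of the form \<open>t^2 + t\<close>, the shape in which the condition on
  \<open>lam\<close> is used from here on.\<close>

lemma trace_artin_schreier:
  fixes t :: "'q::{field,finite}"
  assumes two: "(2::'q) = 0"
  shows "absolute_trace (t ^ 2 + t) = 0"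
proof -
  have "prime CHAR('q)"
    by (rule prime_CHAR_semidom, rule finite_imp_CHAR_pos, simp)
  moreover have "CHAR('q) dvd 2"
    using two by (metis of_nat_eq_0_iff_char_dvd of_nat_numeral)
  ultimately have char: "CHAR('q) = 2" by (simp add: primes_dvd_imp_eq)
  obtain e where e: "CARD('q) = 2 ^ e" using char2_card_power[OF two] by blast
  have the: "(THE e. CARD('q) = CHAR('q) ^ e) = e"
    unfolding char e by (rule the_equality) auto
  have "absolute_trace (t ^ 2 + t) = (\<Sum>i<e. t ^ 2 ^ Suc i - t ^ 2 ^ i)"
    unfolding absolute_trace_def the unfolding char
    by (rule sum.cong)
      (simp_all only: char2_power_add[OF two] power_mult power_Suc char2_uminus[OF two]
        diff_conv_add_uminus)
  also have "\<dots> = t ^ 2 ^ e - t ^ 2 ^ 0" by (rule sum_lessThan_telescope)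
  also have "\<dots> = 0" using field_power_card[of t] e by simp
  finally show ?thesis .
qed

text \<open>The image of \<open>t \<mapsto> t\<^sup>2 + t\<close> has index two in the additive group.\<close>

lemma artin_schreier_coset:
  fixes c d :: "'q::{field,finite}"
  assumes two: "(2::'q) = 0" and c: "\<nexists>t. t ^ 2 + t = c" and d: "\<nexists>t. t ^ 2 + t = d"
  shows "\<exists>t. t ^ 2 + t = c + d"
proof -
  let ?f = "\<lambda>t::'q. t ^ 2 + t"
  let ?I = "range ?f"
  have add: "?f (x + y) = ?f x + ?f y" for x y by (simp add: char2_square_add[OF two] algebra_simps)
  have fib: "card {t. ?f t = y} \<le> 2" if "y \<in> ?I" for y
  proof -
    from that obtain t where t: "y = ?f t" by auto
    have "{s. ?f s = y} \<subseteq> {t, t + 1}"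
    proof
      fix s assume "s \<in> {s. ?f s = y}"
      then have "(s + t) * (s + t + 1) = 0"
        using add[of s t] t by (simp add: char2_add_self[OF two] power2_eq_square algebra_simps)
      then have "s + t = 0 \<or> s + (t + 1) = 0" by (auto simp: add.assoc)
      then show "s \<in> {t, t + 1}" by (metis add_eq_0_iff char2_uminus[OF two] insertCI)
    qed
    then have "card {s. ?f s = y} \<le> card {t, t + 1}" by (intro card_mono) auto
    also have "\<dots> \<le> 2" by (simp add: card_insert_if)
    finally show ?thesis .
  qed
  have "CARD('q) = card (\<Union>y\<in>?I. {t. ?f t = y})" by (rule arg_cong[where f = card]) auto
  also have "\<dots> \<le> (\<Sum>y\<in>?I. card {t. ?f t = y})" by (rule card_UN_le) auto
  also have "\<dots> \<le> (\<Sum>y\<in>?I. 2)" by (rule sum_mono) (rule fib)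
  finally have half: "CARD('q) \<le> 2 * card ?I" by simp
  \<comment> \<open>The image has at least half of all elements and so has its translate by
    \<open>d\<close>; being disjoint they exhaust the field, and \<open>c\<close> must lie in the
    translate.\<close>
  have disj: "?I \<inter> (+) d ` ?I = {}"
  proof (rule ccontr)
    assume "?I \<inter> (+) d ` ?I \<noteq> {}"
    then obtain x y where "?f x = d + ?f y" by auto
    then have "?f (x + y) = d" using add[of x y] by (simp add: add.assoc char2_add_self[OF two])
    then show False using d by blast
  qed
  have "card (?I \<union> (+) d ` ?I) = 2 * card ?I"
    by (subst card_Un_disjoint[OF _ _ disj]) (auto simp: card_image)
  then have "?I \<union> (+) d ` ?I = UNIV"
    using half by (intro card_seteq) auto
  then have "c \<in> ?I \<union> (+) d ` ?I" by simp
  then have "c \<in> (+) d ` ?I" using c by blast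
  then obtain t where "c = d + ?f t" by auto
  then have "?f t = c + d" by (metis add.commute add.left_commute add_0 char2_add_self[OF two])
  then show ?thesis by blast
qed

section \<open>Counting squares and nonsquares\<close>

lemma card_square_roots_le: "card {t. t ^ 2 = (y::'q::{field,finite})} \<le> 2"
proof (cases "\<exists>t. y = t ^ 2")
  case True
  then obtain t where "y = t ^ 2" by auto
  then have "{s. s ^ 2 = y} \<subseteq> {t, - t}" by (auto simp: power2_eq_iff)
  then have "card {s. s ^ 2 = y} \<le> card {t, - t}" by (intro card_mono) auto
  also have "\<dots> \<le> 2" by (simp add: card_insert_if)
  finally show ?thesis .
next
  case False
  then have "{t. t ^ 2 = y} = {}" by auto
  then show ?thesis by (metis card.empty zero_le)
qed

text \<open>Fibres of squaring have at most two elements, and the one over 0 has a single element.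
  That saving is the \<open>+ 1\<close> which makes the next pigeonhole argument strict.\<close>

lemma card_squares_ge: "CARD('q::{field,finite}) + 1 \<le> 2 * card (range (\<lambda>x::'q. x ^ 2))"
proof -
  let ?S = "range (\<lambda>x::'q. x ^ 2)"
  have "CARD('q) = card (\<Union>y\<in>?S. {t. t ^ 2 = y})" by (rule arg_cong[where f = card]) auto
  also have "\<dots> \<le> (\<Sum>y\<in>?S. card {t. t ^ 2 = y})" by (rule card_UN_le) auto
  also have "\<dots> = card {t::'q. t ^ 2 = 0} + (\<Sum>y\<in>?S - {0}. card {t. t ^ 2 = y})"
    by (rule sum.remove) (auto intro: rev_image_eqI[of 0])
  also have "\<dots> \<le> 1 + (\<Sum>y\<in>?S - {0}. 2)"
    by (intro add_mono sum_mono card_square_roots_le) auto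
  also have "\<dots> = 1 + 2 * (card ?S - 1)"
    by (subst sum_constant, subst card_Diff_singleton) (auto intro: rev_image_eqI[of 0])
  finally show ?thesis using card_gt_0_iff[of ?S] by (auto)
qed

text \<open>Pigeonhole: \<open>a^2 * A\<close> and \<open>- (b^2 * B) - C\<close> each take more
  than half of all values, so they share one.\<close>

lemma ternary_diagonal_isotropic:
  fixes A B C :: "'q::{field,finite}"
  assumes "A \<noteq> 0" "B \<noteq> 0"
  shows "\<exists>a b. a ^ 2 * A + b ^ 2 * B + C = 0"
proof -
  let ?S = "range (\<lambda>x::'q. x ^ 2)"
  let ?X = "(\<lambda>s. s * A) ` ?S" and ?Y = "(\<lambda>s. - (s * B) - C) ` ?S"
  have "card ?X = card ?S" by (rule card_image) (use assms in \<open>auto intro: inj_onI\<close>)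
  moreover have "card ?Y = card ?S" by (rule card_image) (use assms in \<open>auto intro: inj_onI\<close>)
  ultimately have "CARD('q) < card ?X + card ?Y" using card_squares_ge[where 'q = 'q] by simp
  then have "?X \<inter> ?Y \<noteq> {}"
    using card_Un_disjoint[of ?X ?Y] card_mono[of UNIV "?X \<union> ?Y"] by fastforce
  then obtain a b where "a ^ 2 * A = - (b ^ 2 * B) - C" by auto
  then have "a ^ 2 * A + b ^ 2 * B + C = 0" by simp
  then show ?thesis by blast
qed

text \<open>The squares and \<open>y\<close> times the nonzero squares are disjoint and too many to
  leave anything out, so every nonsquare lies in the second set.\<close>

lemma nonsquare_ratio:
  fixes x y :: "'q::{field,finite}"
  assumes "nonsquare x" "nonsquare y"
  shows "\<exists>t. t \<noteq> 0 \<and> x = y * t ^ 2"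
proof -
  let ?S = "range (\<lambda>x::'q. x ^ 2)"
  let ?N = "(\<lambda>s. y * s) ` (?S - {0})"
  have y0: "y \<noteq> 0" and x0: "x \<noteq> 0" using assms by (auto simp: nonsquare_def)
  have disj: "?S \<inter> ?N = {}"
  proof (rule ccontr)
    assume "?S \<inter> ?N \<noteq> {}"
    then obtain a b where "a ^ 2 = y * b ^ 2" "b ^ 2 \<noteq> 0" by blast
    then have "y = (a / b) ^ 2" by (simp add: power_divide)
    then show False using assms(2) by (auto simp: nonsquare_def)
  qed
  have "card ?N = card (?S - {0})" by (rule card_image) (use y0 in \<open>auto intro: inj_onI\<close>)
  also have "\<dots> = card ?S - 1" by (rule card_Diff_singleton) (auto intro: rev_image_eqI[of 0])
  finally have "CARD('q) \<le> card (?S \<union> ?N)"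
    using card_squares_ge[where 'q = 'q] by (subst card_Un_disjoint[OF _ _ disj]) auto
  then have "?S \<union> ?N = UNIV" by (intro card_seteq) auto
  then have "x \<in> ?N" using assms(1) by (fastforce simp: nonsquare_def)
  then obtain t where "x = y * t ^ 2" by auto
  then show ?thesis using x0 by auto
qed

text \<open>For nonzero \<open>a\<close> exactly one of \<open>a\<close> and \<open>a / eta\<close>
  is a square, and it has two roots; for \<open>a = 0\<close> both equations have only the root
  0.\<close>

lemma card_square_roots_nonsquare_multiple:
  fixes eta a :: "'q::{field,finite}"
  assumes eta: "nonsquare eta" and two: "(2::'q) \<noteq> 0"
  shows "card {t. t ^ 2 = a} + card {t. eta * t ^ 2 = a} = 2"
proof -
  have eta0: "eta \<noteq> 0" using eta by (simp add: nonsquare_def)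
  consider "a = 0" | r where "a \<noteq> 0" "a = r ^ 2" | "nonsquare a" unfolding nonsquare_def by metis
  then show ?thesis
  proof cases
    case 1
    then have "{t. t ^ 2 = a} = {0}" "{t. eta * t ^ 2 = a} = {0}" using eta0 by auto
    then show ?thesis by simp
  next
    case 2
    then have "r \<noteq> 0" by auto
    then have "r \<noteq> - r" using two by (metis add.right_inverse mult_2 mult_eq_0_iff)
    moreover have "{t. t ^ 2 = a} = {r, - r}" using 2 by (auto simp: power2_eq_iff)
    moreover have "{t. eta * t ^ 2 = a} = {}"
    proof (rule ccontr)
      assume "{t. eta * t ^ 2 = a} \<noteq> {}"
      then obtain t where t: "eta * t ^ 2 = r ^ 2" using 2 by auto
      then have "t \<noteq> 0" using \<open>r \<noteq> 0\<close> by auto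
      then have "eta = (r / t) ^ 2" using t by (simp add: power_divide field_simps)
      then show False using eta by (auto simp: nonsquare_def)
    qed
    ultimately show ?thesis by simp
  next
    case 3
    then obtain t where t: "t \<noteq> 0" "a = eta * t ^ 2" using nonsquare_ratio[OF 3 eta] by auto
    have "t \<noteq> - t" using two t(1) by (metis add.right_inverse mult_2 mult_eq_0_iff)
    moreover have "{s. eta * s ^ 2 = a} = {t, - t}" using t eta0 by (auto simp: power2_eq_iff)
    moreover have "{t. t ^ 2 = a} = {}" using 3 by (auto simp: nonsquare_def)
    ultimately show ?thesis by simp
  qed
qed

section \<open>Value distributions\<close>

definition deviation :: "'x set \<Rightarrow> ('x \<Rightarrow> 'q::{field,finite}) \<Rightarrow> 'q \<Rightarrow> real" where
  "deviation X g d = real (card {x \<in> X. g x = d}) - real (card X) / real CARD('q)"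

text \<open>The point mass at 0, scaled by \<open>q\<close> and centred to sum zero. On functions of
  sum zero, such as deviations, convolution with it is multiplication by \<open>q\<close>.\<close>

definition spike :: "'q::{field,finite} \<Rightarrow> real" where
  "spike d = (if d = 0 then real CARD('q) - 1 else - 1)"

lemma deviation_bij:
  assumes "bij_betw h X Y" "\<And>x. x \<in> X \<Longrightarrow> g x = g' (h x)"
  shows "deviation X g d = deviation Y g' d"
proof -
  have "bij_betw h {x \<in> X. g x = d} {y \<in> Y. g' y = d}"
    using assms unfolding bij_betw_def by (auto intro: inj_on_subset)
  then show ?thesis
    using bij_betw_same_card[OF assms(1)] by (simp add: deviation_def bij_betw_same_card)
qed

lemma card_eq_sum_fibres:
  assumes "finite X" "finite Y"
  shows "card {p \<in> X \<times> Y. P (fst p) (snd p)} = (\<Sum>x\<in>X. card {y \<in> Y. P x y})"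
proof -
  have "{p \<in> X \<times> Y. P (fst p) (snd p)} = (SIGMA x:X. {y \<in> Y. P x y})" by auto
  then show ?thesis using assms by simp
qed

text \<open>The deviation of a sum with separate variables is the convolution of the deviations, and
  convolution with a multiple of \<^const>\<open>spike\<close> is multiplication by a scalar.\<close>

lemma deviation_product:
  fixes g :: "'x \<Rightarrow> 'q::{field,finite}"
  assumes fin: "finite X" "finite Y" and h: "\<And>d. deviation Y h d = \<beta> * spike (d - k)"
  shows "deviation (X \<times> Y) (\<lambda>p. g (fst p) + h (snd p)) d
    = real CARD('q) * \<beta> * deviation X g (d - k)"
proof -
  have q: "real CARD('q) \<noteq> 0" by simp
  have cnt: "real (card {y \<in> Y. h y = e}) = card Y / CARD('q) + \<beta> * spike (e - k)" for e
    using h[of e] by (simp add: deviation_def)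
  have "real (card {p \<in> X \<times> Y. g (fst p) + h (snd p) = d})
      = (\<Sum>x\<in>X. real (card {y \<in> Y. h y = d - g x}))"
    by (subst card_eq_sum_fibres[OF fin, of "\<lambda>x y. g x + h y = d"])
      (simp add: eq_diff_eq add.commute)
  also have "\<dots> = card X * card Y / CARD('q) + \<beta> * (\<Sum>x\<in>X. spike (d - g x - k))"
    by (simp add: cnt sum.distrib sum_distrib_left)
  also have "(\<Sum>x\<in>X. spike (d - g x - k)) = (\<Sum>x\<in>X. (if g x = d - k then real CARD('q) else 0) - 1)"
    by (rule sum.cong) (auto simp: spike_def algebra_simps)
  also have "\<dots> = CARD('q) * real (card {x \<in> X. g x = d - k}) - card X"
    using fin by (simp add: sum_subtractf sum.If_cases Int_def)
  finally show ?thesis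
    using q by (simp add: deviation_def card_cartesian_product field_simps)
qed

abbreviation tuples :: "'i set \<Rightarrow> ('i \<Rightarrow> 'q) set" where
  "tuples I \<equiv> I \<rightarrow>\<^sub>E UNIV"

lemma finite_tuples: "finite I \<Longrightarrow> finite (tuples I :: ('i \<Rightarrow> 'q::finite) set)"
  by (simp add: finite_PiE)

text \<open>The equations with \<open>restrict\<close> express that \<open>g\<close> reads only the
  coordinates in \<open>I\<close> and \<open>h\<close> only those in \<open>J\<close>. Only
  \<open>h\<close> has to be concentrated at one value; \<open>g\<close> is arbitrary, which the
  parabolic case exploits.\<close>

lemma deviation_tuples_Un:
  fixes g :: "('i \<Rightarrow> 'q) \<Rightarrow> 'q::{field,finite}"
  assumes fin: "finite I" "finite J" and disj: "I \<inter> J = {}"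
    and g: "\<And>x. g (restrict x I) = g x" and h: "\<And>x. h (restrict x J) = h x"
    and dev: "\<And>d. deviation (tuples J) h d = \<beta> * spike (d - k)"
  shows "deviation (tuples (I \<union> J)) (\<lambda>x. g x + h x) d
    = real CARD('q) * \<beta> * deviation (tuples I) g (d - k)"
proof -
  let ?r = "\<lambda>x. (restrict x I, restrict x J)"
  have "bij_betw ?r (tuples (I \<union> J) :: ('i \<Rightarrow> 'q) set) (tuples I \<times> tuples J)"
    by (rule bij_betw_byWitness[where f' = "\<lambda>p i. if i \<in> I then fst p i else snd p i"])
      (use disj in \<open>auto simp: fun_eq_iff PiE_def extensional_def restrict_def\<close>)
  then have "deviation (tuples (I \<union> J)) (\<lambda>x. g x + h x) d
      = deviation (tuples I \<times> tuples J) (\<lambda>p. g (fst p) + h (snd p)) d"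
    by (rule deviation_bij) (simp add: g h)
  then show ?thesis
    using deviation_product[OF finite_tuples[OF fin(1)] finite_tuples[OF fin(2)] dev, of g d] by simp
qed

text \<open>All values but \<open>k\<close> are taken equally often. For \<open>beta = 0\<close> the
  distribution is uniform and \<open>k\<close> is arbitrary. Sums in separate variables stay in this
  class: exceptional values add and biases multiply up to a factor \<open>q\<close>.\<close>

definition biased :: "'i set \<Rightarrow> (('i \<Rightarrow> 'q) \<Rightarrow> 'q::{field,finite}) \<Rightarrow> real \<Rightarrow> 'q \<Rightarrow> bool" where
  "biased I g \<beta> k \<longleftrightarrow> (\<forall>d. deviation (tuples I) g d = \<beta> * spike (d - k))"

lemma biased_Un:
  fixes g :: "('i \<Rightarrow> 'q) \<Rightarrow> 'q::{field,finite}"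
  assumes "finite I" "finite J" "I \<inter> J = {}"
    and "\<And>x. g (restrict x I) = g x" "\<And>x. h (restrict x J) = h x"
    and "biased I g \<beta> k" "biased J h \<gamma> l"
  shows "biased (I \<union> J) (\<lambda>x. g x + h x) (real CARD('q) * \<beta> * \<gamma>) (k + l)"
  using assms(6,7) deviation_tuples_Un[of I J g h \<gamma> l, OF assms(1-5)]
  by (simp add: biased_def diff_diff_eq ac_simps)

text \<open>The neutral element for \<open>biased_Un\<close>, since \<open>q * beta = 1\<close>;
  inductions on the number of variables start here.\<close>

lemma biased_empty: "biased {} (\<lambda>x. 0 :: 'q::{field,finite}) (1 / real CARD('q)) 0"
  by (simp add: biased_def deviation_def spike_def field_simps)

section \<open>Distributions in one and two variables\<close>

lemma deviation_single:
  "deviation (tuples {i}) (\<lambda>x. h (x i)) d = deviation UNIV (h :: 'q::{field,finite} \<Rightarrow> 'q) d"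
proof (rule deviation_bij)
  show "bij_betw (\<lambda>x. x i) (tuples {i}) (UNIV :: 'q set)"
    by (rule bij_betw_byWitness[where f' = "\<lambda>t. (\<lambda>j. if j = i then t else undefined)"])
      (auto simp: fun_eq_iff PiE_def extensional_def)
qed simp

lemma deviation_pair:
  fixes f :: "'q \<Rightarrow> 'q \<Rightarrow> 'q::{field,finite}"
  assumes "i \<noteq> j"
  shows "deviation (tuples {i, j}) (\<lambda>x. f (x i) (x j)) d
    = deviation (UNIV \<times> UNIV) (\<lambda>p. f (fst p) (snd p)) d"
proof (rule deviation_bij)
  show "bij_betw (\<lambda>x. (x i, x j)) (tuples {i, j}) (UNIV \<times> UNIV :: ('q \<times> 'q) set)"
    by (rule bij_betw_byWitness[where
          f' = "\<lambda>t. (\<lambda>l. if l = i then fst t else if l = j then snd t else undefined)"])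
      (use assms in \<open>auto simp: fun_eq_iff PiE_def extensional_def\<close>)
qed simp

lemma deviation_linear:
  "deviation UNIV (\<lambda>t. b * t :: 'q::{field,finite}) d = (if b = 0 then 1 else 0) * spike d"
proof (cases "b = 0")
  case True
  then show ?thesis by (cases "d = 0") (simp_all add: deviation_def spike_def)
next
  case False
  then have "{t. b * t = d} = {d / b}" by (auto simp: field_simps)
  then show ?thesis using False by (simp add: deviation_def)
qed

text \<open>The function is \<open>(x + b) * (y + a) - a * b\<close>, a shifted hyperbolic plane.
  The line \<open>x = - b\<close> is hit entirely or not at all, every other line exactly
  once.\<close>

lemma deviation_plane:
  "deviation (UNIV \<times> UNIV) (\<lambda>p. fst p * snd p + a * fst p + b * snd p :: 'q::{field,finite}) d
    = spike (d + a * b)"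
proof -
  have fib: "card {y. x * y + a * x + b * y = d}
      = (if x = - b then (if d + a * b = 0 then CARD('q) else 0) else 1)" for x
  proof (cases "x = - b")
    case True
    then have "x * y + a * x + b * y = d \<longleftrightarrow> d + a * b = 0" for y
      by (auto simp: add_eq_0_iff2 mult.commute)
    then show ?thesis using True by simp
  next
    case False
    then have "x + b \<noteq> 0" by (simp add: eq_neg_iff_add_eq_0)
    moreover have "x * y + a * x + b * y = d \<longleftrightarrow> (x + b) * y = d - a * x" for y
      by (simp add: algebra_simps eq_diff_eq)
    ultimately have "x * y + a * x + b * y = d \<longleftrightarrow> y = (d - a * x) / (x + b)" for y
      by (metis nonzero_eq_divide_eq mult.commute)
    then show ?thesis using False by simp
  qed
  have "card {p \<in> UNIV \<times> UNIV. fst p * snd p + a * fst p + b * snd p = d}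
      = (\<Sum>x\<in>UNIV. if x = - b then (if d + a * b = 0 then CARD('q) else 0) else 1)"
    by (subst card_eq_sum_fibres[of UNIV UNIV "\<lambda>x y. x * y + a * x + b * y = d"])
      (simp_all add: fib)
  also have "\<dots> = (if d + a * b = 0 then CARD('q) else 0) + (CARD('q) - 1)"
    by (subst sum.remove[of _ "- b"]) (auto simp: card_Diff_singleton)
  finally show ?thesis
    using card_field_ge_2[where 'q = 'q]
    by (simp add: deviation_def spike_def card_cartesian_product of_nat_diff)
qed

text \<open>For admissible \<open>lam\<close> and \<open>eta\<close> this is the norm form of the
  quadratic extension of the field, which is anisotropic.\<close>

definition elliptic_plane :: "'q::{field,finite} \<Rightarrow> 'q \<Rightarrow> 'q \<Rightarrow> 'q \<Rightarrow> 'q" where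
  "elliptic_plane lam eta y z =
    (if even CARD('q) then y ^ 2 + y * z + lam * z ^ 2 else y ^ 2 - eta * z ^ 2)"

text \<open>For even \<open>q\<close> substitute \<open>y = z t\<close> and use that squaring is bijective. For odd \<open>q\<close>, \<open>t\<^sup>2 = a\<close> and
  \<open>\<eta> t\<^sup>2 = a\<close> together have two solutions \<open>t\<close>, so the counts for \<open>y\<^sup>2 - z\<^sup>2 = d\<close> and \<open>y\<^sup>2 - \<eta> z\<^sup>2 = d\<close> add up
  to \<open>2 q\<close>.\<close>

lemma deviation_elliptic_plane:
  fixes lam eta :: "'q::{field,finite}"
  assumes lam: "even CARD('q) \<Longrightarrow> \<nexists>t. t ^ 2 + t = lam"
    and eta: "odd CARD('q) \<Longrightarrow> nonsquare eta"
  shows "deviation (UNIV \<times> UNIV) (\<lambda>p. elliptic_plane lam eta (fst p) (snd p)) d = - spike d"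
proof -
  have "real (card {p \<in> UNIV \<times> UNIV. elliptic_plane lam eta (fst p) (snd p) = d})
      = CARD('q) - spike d"
  proof (cases "even CARD('q)")
    case True
    then have two: "(2::'q) = 0" by (simp add: even_card_iff_two_eq_0)
    have one: "card {t. t ^ 2 = (x::'q)} = 1" for x
    proof -
      have "\<exists>!t. t ^ 2 = x" using char2_bij_square[OF two] by (auto simp: bij_iff)
      then obtain r where "\<And>t. t ^ 2 = x \<longleftrightarrow> t = r" by blast
      then show ?thesis by simp
    qed
    have nz: "t ^ 2 + t + lam \<noteq> 0" for t
      using lam[OF True] by (metis add_eq_0_iff2 char2_uminus[OF two])
    let ?N = "\<lambda>y z. y ^ 2 + y * z + lam * z ^ 2"
    have "bij_betw (\<lambda>p. (fst p, fst p * snd p)) {p \<in> (UNIV - {0}) \<times> UNIV. (snd p ^ 2 + snd p + lam) * fst p ^ 2 = d}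
       {p \<in> (UNIV - {0}) \<times> UNIV. ?N (snd p) (fst p) = d}"
    proof (rule bij_betw_byWitness[where f' = "\<lambda>p. (fst p, snd p / fst p)"])
      have eq: "?N (z * t) z = (t ^ 2 + t + lam) * z ^ 2" for z t
        by (simp add: power2_eq_square algebra_simps)
      then show "(\<lambda>p. (fst p, fst p * snd p)) ` {p \<in> (UNIV - {0}) \<times> UNIV. (snd p ^ 2 + snd p + lam) * fst p ^ 2 = d}
          \<subseteq> {p \<in> (UNIV - {0}) \<times> UNIV. ?N (snd p) (fst p) = d}" by auto
      have "((y / z) ^ 2 + y / z + lam) * z ^ 2 = ?N y z" if "z \<noteq> 0" for y z
        using eq[of z "y / z"] that by simp
      then show "(\<lambda>p. (fst p, snd p / fst p)) ` {p \<in> (UNIV - {0}) \<times> UNIV. ?N (snd p) (fst p) = d}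
        \<subseteq> {p \<in> (UNIV - {0}) \<times> UNIV. (snd p ^ 2 + snd p + lam) * fst p ^ 2 = d}" by auto
    qed auto
    then have "card {p \<in> (UNIV - {0}) \<times> UNIV. ?N (snd p) (fst p) = d}
        = card {p \<in> (UNIV - {0}) \<times> UNIV. (snd p ^ 2 + snd p + lam) * fst p ^ 2 = d}"
      by (rule bij_betw_same_card[symmetric])
    also have "\<dots> = card {p \<in> UNIV \<times> (UNIV - {0}). (fst p ^ 2 + fst p + lam) * snd p ^ 2 = d}"
      by (rule bij_betw_same_card[of prod.swap], rule bij_betw_byWitness[where f' = prod.swap]) auto
    also have "\<dots> = (\<Sum>t\<in>UNIV. card {z \<in> UNIV - {0}. (t ^ 2 + t + lam) * z ^ 2 = d})"
      by (rule card_eq_sum_fibres[where P = "\<lambda>t z. (t ^ 2 + t + lam) * z ^ 2 = d"]) auto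
    also have "\<dots> = (\<Sum>t\<in>(UNIV::'q set). if d = 0 then 0 else 1)"
    proof (rule sum.cong)
      fix t :: 'q
      have "{z \<in> UNIV - {0}. (t ^ 2 + t + lam) * z ^ 2 = d}
          = (if d = 0 then {} else {z. z ^ 2 = d / (t ^ 2 + t + lam)})"
        using nz[of t] by (auto simp: nonzero_eq_divide_eq mult.commute)
      then show "card {z \<in> UNIV - {0}. (t ^ 2 + t + lam) * z ^ 2 = d} = (if d = 0 then 0 else 1)"
        using one by simp
    qed simp
    finally have A: "card {p \<in> (UNIV - {0}) \<times> UNIV. ?N (snd p) (fst p) = d}
        = (if d = 0 then 0 else CARD('q))" by simp
    have "card {p \<in> UNIV \<times> UNIV. ?N (fst p) (snd p) = d} = card {p \<in> UNIV \<times> UNIV. ?N (snd p) (fst p) = d}"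
      by (rule bij_betw_same_card[of prod.swap], rule bij_betw_byWitness[where f' = prod.swap]) auto
    \<comment> \<open>The points with \<open>z = 0\<close>, which the substitution misses,
      contribute the one square root of \<open>d\<close>.\<close>
    also have "\<dots> = card ({p \<in> (UNIV - {0}) \<times> UNIV. ?N (snd p) (fst p) = d}
        \<union> {p \<in> {0} \<times> UNIV. ?N (snd p) (fst p) = d})"
      by (rule arg_cong[where f = card]) auto
    also have "\<dots> = card {p \<in> (UNIV - {0}) \<times> UNIV. ?N (snd p) (fst p) = d}
        + card {p \<in> {0} \<times> UNIV. ?N (snd p) (fst p) = d}"
      by (rule card_Un_disjoint) auto
    also have "card {p \<in> {0} \<times> UNIV. ?N (snd p) (fst p) = d} = 1"
      by (subst card_eq_sum_fibres[where P = "\<lambda>z y. ?N y z = d"]) (simp_all add: one)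
    finally show ?thesis using A True by (simp add: elliptic_plane_def spike_def)
  next
    case False
    then have two: "(2::'q) \<noteq> 0" by (simp add: even_card_iff_two_eq_0)
    have four: "(4::'q) \<noteq> 0" using two mult_eq_0_iff[of "2::'q" 2] by auto
    have sum2: "card {t. t ^ 2 = a} + card {t. eta * t ^ 2 = a} = 2" for a
      by (rule card_square_roots_nonsquare_multiple[OF eta[OF False] two])
    \<comment> \<open>The coordinates \<open>y + z\<close> and \<open>y - z\<close> turn this into
      the hyperbolic plane, whose distribution is known.\<close>
    have "card {p \<in> UNIV \<times> UNIV. fst p ^ 2 - snd p ^ 2 = d}
        = card {p \<in> UNIV \<times> UNIV. fst p * snd p + 0 * fst p + 0 * snd p = d}"
      by (rule bij_betw_same_card[of "\<lambda>p. (fst p + snd p, fst p - snd p)"],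
          rule bij_betw_byWitness[where f' = "\<lambda>p. ((fst p + snd p) / 2, (fst p - snd p) / 2)"])
        (use two four in \<open>auto simp: field_simps power2_eq_square\<close>)
    then have hyp: "real (card {p \<in> UNIV \<times> UNIV. fst p ^ 2 - snd p ^ 2 = d}) = CARD('q) + spike d"
      using deviation_plane[of 0 0 d] by (simp add: deviation_def card_cartesian_product)
    have "card {p \<in> UNIV \<times> UNIV. fst p ^ 2 - snd p ^ 2 = d}
        + card {p \<in> UNIV \<times> UNIV. fst p ^ 2 - eta * snd p ^ 2 = d}
      = (\<Sum>y\<in>UNIV. card {z. y ^ 2 - z ^ 2 = d} + card {z. y ^ 2 - eta * z ^ 2 = d})"
      using card_eq_sum_fibres[of UNIV UNIV "\<lambda>y z. y ^ 2 - z ^ 2 = d"]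
        card_eq_sum_fibres[of UNIV UNIV "\<lambda>y z. y ^ 2 - eta * z ^ 2 = d"]
      by (simp add: sum.distrib)
    also have "\<dots> = (\<Sum>y\<in>(UNIV::'q set). 2)"
    proof (rule sum.cong)
      fix y :: 'q
      have "{z. y ^ 2 - z ^ 2 = d} = {z. z ^ 2 = y ^ 2 - d}"
        "{z. y ^ 2 - eta * z ^ 2 = d} = {z. eta * z ^ 2 = y ^ 2 - d}"
        by (auto simp: algebra_simps)
      then show "card {z. y ^ 2 - z ^ 2 = d} + card {z. y ^ 2 - eta * z ^ 2 = d} = 2"
        using sum2[of "y ^ 2 - d"] by simp
    qed simp
    also have "\<dots> = 2 * CARD('q)" by simp
    finally have "real (card {p \<in> UNIV \<times> UNIV. fst p ^ 2 - eta * snd p ^ 2 = d}) = CARD('q) - spike d"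
      using hyp by linarith
    then show ?thesis using False by (simp add: elliptic_plane_def)
  qed
  then show ?thesis by (simp add: deviation_def card_cartesian_product)
qed

text \<open>The polar form of the plane is nondegenerate, so a translation of the variables absorbs
  the linear part and leaves a shift of the values by a constant.\<close>

lemma deviation_elliptic_plane_affine:
  fixes lam eta a b :: "'q::{field,finite}"
  assumes lam: "even CARD('q) \<Longrightarrow> \<nexists>t. t ^ 2 + t = lam"
    and eta: "odd CARD('q) \<Longrightarrow> nonsquare eta"
  shows "\<exists>k. (a = 0 \<longrightarrow> b = 0 \<longrightarrow> k = 0) \<and> (\<forall>d.
    deviation (UNIV \<times> UNIV) (\<lambda>p. elliptic_plane lam eta (fst p) (snd p) + a * fst p + b * snd p) d
      = - spike (d - k))"
proof -
  have "\<exists>u w k. (a = 0 \<longrightarrow> b = 0 \<longrightarrow> k = 0) \<and> (\<forall>y z.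
    elliptic_plane lam eta y z + a * y + b * z = elliptic_plane lam eta (y + u) (z + w) + k)"
  proof (cases "even CARD('q)")
    case True
    then have two: "(2::'q) = 0" by (simp add: even_card_iff_two_eq_0)
    \<comment> \<open>In characteristic two the polar form is \<open>y * z' + z * y'\<close>, so the
      translation vector has \<open>a\<close> and \<open>b\<close> interchanged; what remains
      carries a factor 2.\<close>
    have "elliptic_plane lam eta y z + a * y + b * z
        = elliptic_plane lam eta (y + b) (z + a) + elliptic_plane lam eta b a" for y z
    proof -
      have "elliptic_plane lam eta (y + b) (z + a) + elliptic_plane lam eta b a
        = elliptic_plane lam eta y z + a * y + b * z + 2 * elliptic_plane lam eta b a
          + 2 * (y * b + lam * z * a)"
        using True by (simp add: elliptic_plane_def power2_eq_square algebra_simps)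
      then show ?thesis using two by simp
    qed
    then show ?thesis
      by (intro exI[of _ b] exI[of _ a] exI[of _ "elliptic_plane lam eta b a"])
        (simp add: elliptic_plane_def)
  next
    case False
    then have two: "(2::'q) \<noteq> 0" by (simp add: even_card_iff_two_eq_0)
    have eta0: "eta \<noteq> 0" using eta[OF False] by (simp add: nonsquare_def)
    \<comment> \<open>Completing both squares.\<close>
    define u w where "u = a / 2" and "w = - b / (2 * eta)"
    have uw: "a = 2 * u" "b = - 2 * eta * w" using two eta0 by (simp_all add: u_def w_def)
    have "elliptic_plane lam eta y z + a * y + b * z
        = elliptic_plane lam eta (y + u) (z + w) + - elliptic_plane lam eta u w" for y z
      using False by (simp add: elliptic_plane_def power2_eq_square uw algebra_simps)
    moreover have "a = 0 \<longrightarrow> b = 0 \<longrightarrow> - elliptic_plane lam eta u w = 0"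
      by (simp add: u_def w_def elliptic_plane_def)
    ultimately show ?thesis by blast
  qed
  then obtain u w k where k: "a = 0 \<longrightarrow> b = 0 \<longrightarrow> k = 0"
    and eq: "\<And>y z. elliptic_plane lam eta y z + a * y + b * z
      = elliptic_plane lam eta (y + u) (z + w) + k" by blast
  have "deviation (UNIV \<times> UNIV)
      (\<lambda>p. elliptic_plane lam eta (fst p) (snd p) + a * fst p + b * snd p) d
    = deviation (UNIV \<times> UNIV) (\<lambda>p. elliptic_plane lam eta (fst p) (snd p)) (d - k)" for d
  proof -
    have "deviation (UNIV \<times> UNIV)
        (\<lambda>p. elliptic_plane lam eta (fst p) (snd p) + a * fst p + b * snd p) d
      = deviation (UNIV \<times> UNIV) (\<lambda>p. elliptic_plane lam eta (fst p) (snd p) + k) d"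
      by (rule deviation_bij[of "\<lambda>p. (fst p + u, snd p + w)"],
          rule bij_betw_byWitness[where f' = "\<lambda>p. (fst p - u, snd p - w)"]) (auto simp: eq)
    then show ?thesis by (simp add: deviation_def eq_diff_eq)
  qed
  then show ?thesis using k deviation_elliptic_plane[OF lam eta] by auto
qed

text \<open>A variable with nonzero coefficient is equidistributed and makes the bias 0. The zero
  function on \<open>q^n\<close> points has bias \<open>q^(n-1)\<close>, written as a quotient
  because \<open>n\<close> may be 0.\<close>

lemma biased_linear:
  fixes b :: "'i \<Rightarrow> 'q::{field,finite}"
  assumes "finite I"
  shows "biased I (\<lambda>x. \<Sum>i\<in>I. b i * x i)
    (if \<forall>i\<in>I. b i = 0 then real CARD('q) ^ card I / real CARD('q) else 0) 0"
  using assms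
proof (induction I)
  case empty
  show ?case using biased_empty by simp
next
  case (insert j I)
  have "biased {j} (\<lambda>x. b j * x j) (if b j = 0 then 1 else 0) 0"
    by (auto simp: biased_def deviation_single[of j "\<lambda>t. b j * t"] deviation_linear)
  from biased_Un[OF _ insert(1) _ _ _ this insert(3)] insert(2)
  have "biased ({j} \<union> I) (\<lambda>x. b j * x j + (\<Sum>i\<in>I. b i * x i))
    (real CARD('q) * (if b j = 0 then 1 else 0) *
      (if \<forall>i\<in>I. b i = 0 then real CARD('q) ^ card I / real CARD('q) else 0)) (0 + 0)"
    by simp
  moreover have "{j} \<union> I = insert j I"
    "real CARD('q) * (if b j = 0 then 1 else 0) *
      (if \<forall>i\<in>I. b i = 0 then real CARD('q) ^ card I / real CARD('q) else 0)
    = (if \<forall>i\<in>insert j I. b i = 0 then real CARD('q) ^ card (insert j I) / real CARD('q) else 0)"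
    using insert(1,2) by auto
  ultimately show ?case using insert(1,2) by simp
qed

text \<open>Starting from \<open>1 / q\<close>, each plane contributes a factor \<open>q\<close>. A
  linear part in the variables of the planes moves only the exceptional value, never the
  bias.\<close>

lemma biased_planes:
  fixes b :: "nat \<Rightarrow> 'q::{field,finite}"
  shows "\<exists>k. ((\<forall>j. b j = 0) \<longrightarrow> k = 0) \<and>
    biased {1..2*s} (\<lambda>x. (\<Sum>i=1..s. x (2*i-1) * x (2*i)) + (\<Sum>j=1..2*s. b j * x j))
      (real CARD('q) ^ s / real CARD('q)) k"
proof (induction s)
  case 0
  show ?case using biased_empty by (intro exI[of _ 0]) simp
next
  case (Suc s)
  then obtain k where k: "(\<forall>j. b j = 0) \<longrightarrow> k = 0"
    and bias: "biased {1..2*s} (\<lambda>x. (\<Sum>i=1..s. x (2*i-1) * x (2*i)) + (\<Sum>j=1..2*s. b j * x j))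
      (real CARD('q) ^ s / real CARD('q)) k" by blast
  let ?J = "{2*s+1, 2*s+2}"
  let ?h = "\<lambda>x. x (2*s+1) * x (2*s+2) + b (2*s+1) * x (2*s+1) + b (2*s+2) * x (2*s+2)"
  have h: "biased ?J ?h 1 (- (b (2*s+1) * b (2*s+2)))"
    unfolding biased_def
    by (intro allI, subst deviation_pair[of _ _ "\<lambda>y z. y * z + b (2*s+1) * y + b (2*s+2) * z"],
        simp, subst deviation_plane, simp)
  have ev: "{1..2 * Suc s} = {1..2*s} \<union> ?J" by auto
  have "biased ({1..2*s} \<union> ?J)
     (\<lambda>x. (\<Sum>i=1..s. x (2*i-1) * x (2*i)) + (\<Sum>j=1..2*s. b j * x j) + ?h x)
     (real CARD('q) * (real CARD('q) ^ s / real CARD('q)) * 1) (k + - (b (2*s+1) * b (2*s+2)))"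
    by (rule biased_Un[OF _ _ _ _ _ bias h]) (auto intro!: arg_cong2[where f = "(+)"] sum.cong)
  moreover have "(\<lambda>x. (\<Sum>i=1..s. x (2*i-1) * x (2*i)) + (\<Sum>j=1..2*s. b j * x j) + ?h x)
     = (\<lambda>x. (\<Sum>i=1..Suc s. x (2*i-1) * x (2*i)) + (\<Sum>j=1..2*Suc s. b j * x j))"
    by (rule ext) (simp add: algebra_simps)
  moreover have "real CARD('q) * (real CARD('q) ^ s / real CARD('q)) * 1
     = real CARD('q) ^ Suc s / real CARD('q)" by simp
  ultimately have "biased {1..2 * Suc s}
     (\<lambda>x. (\<Sum>i=1..Suc s. x (2*i-1) * x (2*i)) + (\<Sum>j=1..2*Suc s. b j * x j))
     (real CARD('q) ^ Suc s / real CARD('q)) (k + - (b (2*s+1) * b (2*s+2)))"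
    unfolding ev by metis
  then show ?case using k by (intro exI[of _ "k + - (b (2*s+1) * b (2*s+2))"]) auto
qed


text \<open>Variables beyond \<open>2 * s\<close> occur only linearly. If the linear part involves
  one of them, the values are equidistributed; otherwise they multiply the bias by
  \<open>q^(m - 2 * s)\<close>, which gives \<open>q^(m - s - 1)\<close>.\<close>

lemma biased_hyperbolic:
  fixes b :: "nat \<Rightarrow> 'q::{field,finite}"
  assumes "2 * s \<le> m"
  shows "\<exists>\<beta> k. \<beta> \<in> {0, real CARD('q) ^ (m - s) / real CARD('q)} \<and>
    ((\<forall>j. b j = 0) \<longrightarrow> \<beta> = real CARD('q) ^ (m - s) / real CARD('q) \<and> k = 0) \<and>
    biased {1..m} (\<lambda>x. (\<Sum>i=1..s. x (2*i-1) * x (2*i)) + (\<Sum>j=1..m. b j * x j)) \<beta> k"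
proof -
  obtain k where k: "(\<forall>j. b j = 0) \<longrightarrow> k = 0"
    and bias: "biased {1..2*s} (\<lambda>x. (\<Sum>i=1..s. x (2*i-1) * x (2*i)) + (\<Sum>j=1..2*s. b j * x j))
      (real CARD('q) ^ s / real CARD('q)) k" using biased_planes[of b s] by blast
  let ?J = "{2*s+1..m}"
  let ?\<gamma> = "if \<forall>i\<in>?J. b i = 0 then real CARD('q) ^ card ?J / real CARD('q) else 0"
  have Un: "{1..2*s} \<union> ?J = {1..m}" using assms by auto
  have "biased ({1..2*s} \<union> ?J)
     (\<lambda>x. ((\<Sum>i=1..s. x (2*i-1) * x (2*i)) + (\<Sum>j=1..2*s. b j * x j)) + (\<Sum>j\<in>?J. b j * x j))
     (real CARD('q) * (real CARD('q) ^ s / real CARD('q)) * ?\<gamma>) (k + 0)"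
    by (rule biased_Un[OF _ _ _ _ _ bias biased_linear])
      (auto intro!: arg_cong2[where f = "(+)"] sum.cong)
  moreover have "(\<Sum>j=1..m. b j * x j) = (\<Sum>j=1..2*s. b j * x j) + (\<Sum>j\<in>?J. b j * x j)" for x
    unfolding Un[symmetric] by (rule sum.union_disjoint) auto
  ultimately have "biased {1..m} (\<lambda>x. (\<Sum>i=1..s. x (2*i-1) * x (2*i)) + (\<Sum>j=1..m. b j * x j))
     (real CARD('q) * (real CARD('q) ^ s / real CARD('q)) * ?\<gamma>) k"
    unfolding Un by (simp add: add.assoc)
  moreover have "real CARD('q) ^ s * real CARD('q) ^ (m - 2 * s) = real CARD('q) ^ (m - s)"
    using assms by (simp flip: power_add)
  ultimately show ?thesis using k
    by (intro exI[of _ "real CARD('q) * (real CARD('q) ^ s / real CARD('q)) * ?\<gamma>"] exI[of _ k]) auto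
qed

text \<open>One of the \<open>s\<close> planes is now the elliptic one. Its bias is
  \<open>- 1\<close> where a hyperbolic plane has 1, so only the sign changes.\<close>

lemma biased_elliptic:
  fixes lam eta :: "'q::{field,finite}"
  assumes s: "s \<ge> 1" "2 * s \<le> m"
    and lam: "even CARD('q) \<Longrightarrow> \<nexists>t. t ^ 2 + t = lam"
    and eta: "odd CARD('q) \<Longrightarrow> nonsquare eta"
  shows "\<exists>\<beta> k. \<beta> \<in> {0, - (real CARD('q) ^ (m - s) / real CARD('q))} \<and>
    ((\<forall>j. b j = 0) \<longrightarrow> \<beta> = - (real CARD('q) ^ (m - s) / real CARD('q)) \<and> k = 0) \<and>
    biased {1..m} (\<lambda>x. (\<Sum>i=1..s-1. x (2*i-1) * x (2*i))
      + elliptic_plane lam eta (x (2*s-1)) (x (2*s)) + (\<Sum>j=1..m. b j * x j)) \<beta> k"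
proof -
  let ?I = "{1..2*(s-1)}" and ?E = "{2*s-1, 2*s}" and ?J = "{2*s+1..m}"
  obtain k where k: "(\<forall>j. b j = 0) \<longrightarrow> k = 0"
    and bias: "biased ?I (\<lambda>x. (\<Sum>i=1..s-1. x (2*i-1) * x (2*i)) + (\<Sum>j\<in>?I. b j * x j))
      (real CARD('q) ^ (s-1) / real CARD('q)) k" using biased_planes[of b "s-1"] by blast
  obtain l where l: "b (2*s-1) = 0 \<longrightarrow> b (2*s) = 0 \<longrightarrow> l = 0"
    and dev: "\<And>d. deviation (UNIV \<times> UNIV) (\<lambda>p. elliptic_plane lam eta (fst p) (snd p)
      + b (2*s-1) * fst p + b (2*s) * snd p) d = - spike (d - l)"
    using deviation_elliptic_plane_affine[OF lam eta] by blast
  let ?e = "\<lambda>x. elliptic_plane lam eta (x (2*s-1)) (x (2*s))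
      + b (2*s-1) * x (2*s-1) + b (2*s) * x (2*s)"
  have e: "biased ?E ?e (-1) l"
    unfolding biased_def
    by (intro allI, subst deviation_pair[of _ _ "\<lambda>y z. elliptic_plane lam eta y z
          + b (2*s-1) * y + b (2*s) * z"]) (use s in simp, subst dev, simp)
  let ?\<gamma> = "if \<forall>i\<in>?J. b i = 0 then real CARD('q) ^ card ?J / real CARD('q) else 0"
  let ?c = "real CARD('q) * (real CARD('q) ^ (s-1) / real CARD('q)) * (-1)"
  have IE: "biased (?I \<union> ?E)
     (\<lambda>x. ((\<Sum>i=1..s-1. x (2*i-1) * x (2*i)) + (\<Sum>j\<in>?I. b j * x j)) + ?e x) ?c (k + l)"
    by (rule biased_Un[OF _ _ _ _ _ bias e]) (auto intro!: arg_cong2[where f = "(+)"] sum.cong)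
  have "biased (?I \<union> ?E \<union> ?J)
     (\<lambda>x. (((\<Sum>i=1..s-1. x (2*i-1) * x (2*i)) + (\<Sum>j\<in>?I. b j * x j)) + ?e x)
       + (\<Sum>j\<in>?J. b j * x j))
     (real CARD('q) * ?c * ?\<gamma>) (k + l + 0)"
    by (rule biased_Un[OF _ _ _ _ _ IE biased_linear])
      (use s in \<open>auto intro!: arg_cong2[where f = "(+)"] sum.cong\<close>)
  moreover have Un: "?I \<union> ?E \<union> ?J = {1..m}" using s by auto
  moreover have "(\<Sum>j=1..m. b j * x j) = (\<Sum>j\<in>?I. b j * x j)
      + (b (2*s-1) * x (2*s-1) + b (2*s) * x (2*s)) + (\<Sum>j\<in>?J. b j * x j)" for x
  proof -
    have "(\<Sum>j\<in>?E. b j * x j) = b (2*s-1) * x (2*s-1) + b (2*s) * x (2*s)" using s by simp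
    moreover have "(\<Sum>j\<in>?I \<union> ?E \<union> ?J. b j * x j)
        = (\<Sum>j\<in>?I. b j * x j) + (\<Sum>j\<in>?E. b j * x j) + (\<Sum>j\<in>?J. b j * x j)"
      by (subst sum.union_disjoint, simp, simp, use s in force, subst sum.union_disjoint)
        (use s in auto)
    ultimately show ?thesis unfolding Un by simp
  qed
  ultimately have "biased {1..m} (\<lambda>x. (\<Sum>i=1..s-1. x (2*i-1) * x (2*i))
      + elliptic_plane lam eta (x (2*s-1)) (x (2*s)) + (\<Sum>j=1..m. b j * x j))
     (real CARD('q) * ?c * ?\<gamma>) (k + l)"
    by (simp add: ac_simps)
  moreover have "real CARD('q) ^ (s-1) * real CARD('q) ^ (m - 2 * s)
      = real CARD('q) ^ (m - s) / real CARD('q)"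
  proof -
    have "Suc (s - 1 + (m - 2 * s)) = m - s" using s by simp
    then have "real CARD('q) * (real CARD('q) ^ (s-1) * real CARD('q) ^ (m - 2 * s))
        = real CARD('q) ^ (m - s)" by (metis power_add power_Suc)
    then show ?thesis by (simp add: nonzero_eq_divide_eq mult.commute)
  qed
  ultimately show ?thesis using k l
    by (intro exI[of _ "real CARD('q) * ?c * ?\<gamma>"] exI[of _ "k + l"]) auto
qed

text \<open>A quadratic equation has zero, one or two roots, against a mean of 1. Unlike for the
  planes, the deviation need not be a multiple of a shifted \<open>spike\<close>.\<close>

lemma deviation_quadratic:
  fixes a :: "'q::{field,finite}"
  assumes "a \<noteq> 0"
  shows "deviation UNIV (\<lambda>t. a * t ^ 2 + b * t) d \<in> {-1, 0, 1}"
    and "deviation UNIV (\<lambda>t. a * t ^ 2) 0 = 0"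
proof -
  have "card {t. a * t ^ 2 + b * t = d} \<le> 2"
  proof (cases "{t. a * t ^ 2 + b * t = d} = {}")
    case False
    then obtain r where r: "a * r ^ 2 + b * r = d" by auto
    \<comment> \<open>By Vieta the second root is \<open>- b / a - r\<close>.\<close>
    have "{t. a * t ^ 2 + b * t = d} \<subseteq> {r, - b / a - r}"
    proof
      fix t assume "t \<in> {t. a * t ^ 2 + b * t = d}"
      then have "(t - r) * (a * (t + r) + b) = 0"
        using r by (simp add: power2_eq_square algebra_simps)
      then have "t = r \<or> a * (t + r) = - b" by (auto simp: add_eq_0_iff2)
      moreover have "t = - b / a - r" if "a * (t + r) = - b"
      proof -
        have "t + r = - b / a" using that assms by (metis nonzero_eq_divide_eq mult.commute)
        then show ?thesis by (metis add_diff_cancel_right')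
      qed
      ultimately show "t \<in> {r, - b / a - r}" by auto
    qed
    then have "card {t. a * t ^ 2 + b * t = d} \<le> card {r, - b / a - r}" by (rule card_mono[rotated]) simp
    also have "\<dots> \<le> 2" by (simp add: card_insert_if)
    finally show ?thesis .
  qed simp
  then have "card {t. a * t ^ 2 + b * t = d} = 0 \<or> card {t. a * t ^ 2 + b * t = d} = 1
      \<or> card {t. a * t ^ 2 + b * t = d} = 2" by linarith
  then show "deviation UNIV (\<lambda>t. a * t ^ 2 + b * t) d \<in> {-1, 0, 1}"
    by (auto simp: deviation_def)
  show "deviation UNIV (\<lambda>t. a * t ^ 2) 0 = 0" using assms by (simp add: deviation_def)
qed

text \<open>The variable of the square need not be \<open>biased\<close>, so it plays the arbitrary
  part \<open>g\<close> in \<open>deviation_tuples_Un\<close>, while planes and radical variables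
  together form the concentrated part.\<close>

lemma deviation_parabolic:
  fixes a :: "'q::{field,finite}"
  assumes s: "2 * s + 1 \<le> m" and a: "a \<noteq> 0"
  defines "B \<equiv> real CARD('q) ^ (m - s) / real CARD('q)"
  shows "deviation (tuples {1..m}) (\<lambda>x. (\<Sum>i=1..s. x (2*i-1) * x (2*i)) + a * x (2*s+1) ^ 2
      + (\<Sum>j=1..m. b j * x j)) d \<in> {- B, 0, B}"
    and "(\<forall>j. b j = 0) \<Longrightarrow> deviation (tuples {1..m}) (\<lambda>x. (\<Sum>i=1..s. x (2*i-1) * x (2*i))
      + a * x (2*s+1) ^ 2 + (\<Sum>j=1..m. b j * x j)) 0 = 0"
proof -
  obtain k where k: "(\<forall>j. b j = 0) \<longrightarrow> k = 0"
    and bias: "biased {1..2*s} (\<lambda>x. (\<Sum>i=1..s. x (2*i-1) * x (2*i)) + (\<Sum>j=1..2*s. b j * x j))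
      (real CARD('q) ^ s / real CARD('q)) k" using biased_planes[of b s] by blast
  let ?J = "{2*s+2..m}" and ?P = "{2*s+1}"
  let ?\<gamma> = "if \<forall>i\<in>?J. b i = 0 then real CARD('q) ^ card ?J / real CARD('q) else 0"
  let ?h = "\<lambda>t. a * t ^ 2 + b (2*s+1) * t"
  let ?g = "\<lambda>x. (\<Sum>i=1..s. x (2*i-1) * x (2*i)) + (\<Sum>j=1..2*s. b j * x j) + (\<Sum>j\<in>?J. b j * x j)"
  let ?c = "real CARD('q) * (real CARD('q) ^ s / real CARD('q)) * ?\<gamma>"
  have IJ: "biased ({1..2*s} \<union> ?J) ?g ?c (k + 0)"
    by (rule biased_Un[OF _ _ _ _ _ bias biased_linear])
      (auto intro!: arg_cong2[where f = "(+)"] sum.cong)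
  have Un: "?P \<union> ({1..2*s} \<union> ?J) = {1..m}" using s by auto
  have "deviation (tuples (?P \<union> ({1..2*s} \<union> ?J))) (\<lambda>x. ?h (x (2*s+1)) + ?g x) d
      = real CARD('q) * ?c * deviation (tuples ?P) (\<lambda>x. ?h (x (2*s+1))) (d - (k + 0))" for d
    by (rule deviation_tuples_Un)
      (use IJ in \<open>auto simp: biased_def intro!: arg_cong2[where f = "(+)"] sum.cong\<close>)
  moreover have "(\<lambda>x. (\<Sum>i=1..s. x (2*i-1) * x (2*i)) + a * x (2*s+1) ^ 2 + (\<Sum>j=1..m. b j * x j))
      = (\<lambda>x. ?h (x (2*s+1)) + ?g x)"
  proof
    fix x
    have "(\<Sum>j\<in>?P \<union> ({1..2*s} \<union> ?J). b j * x j)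
        = b (2*s+1) * x (2*s+1) + ((\<Sum>j=1..2*s. b j * x j) + (\<Sum>j\<in>?J. b j * x j))"
      by (subst sum.union_disjoint, simp, simp, force, subst sum.union_disjoint) auto
    then show "(\<Sum>i=1..s. x (2*i-1) * x (2*i)) + a * x (2*s+1) ^ 2 + (\<Sum>j=1..m. b j * x j)
      = ?h (x (2*s+1)) + ?g x" unfolding Un by simp
  qed
  ultimately have dev: "deviation (tuples {1..m}) (\<lambda>x. (\<Sum>i=1..s. x (2*i-1) * x (2*i))
      + a * x (2*s+1) ^ 2 + (\<Sum>j=1..m. b j * x j)) d
      = real CARD('q) * ?c * deviation UNIV ?h (d - k)" for d
    unfolding Un add_0_right by (metis deviation_single[of "2*s+1" ?h])
  have "real CARD('q) * (real CARD('q) ^ s * real CARD('q) ^ (m - Suc (2 * s)))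
      = real CARD('q) ^ (m - s)"
  proof -
    have "Suc (s + (m - Suc (2 * s))) = m - s" using s by simp
    then show ?thesis by (metis power_add power_Suc)
  qed
  then have c: "real CARD('q) * ?c \<in> {0, B}" by (auto simp: B_def)
  show "deviation (tuples {1..m}) (\<lambda>x. (\<Sum>i=1..s. x (2*i-1) * x (2*i)) + a * x (2*s+1) ^ 2
      + (\<Sum>j=1..m. b j * x j)) d \<in> {- B, 0, B}"
    unfolding dev using c deviation_quadratic(1)[OF a, of "b (2*s+1)" "d - k"] by auto
  show "deviation (tuples {1..m}) (\<lambda>x. (\<Sum>i=1..s. x (2*i-1) * x (2*i))
      + a * x (2*s+1) ^ 2 + (\<Sum>j=1..m. b j * x j)) 0 = 0" if "\<forall>j. b j = 0"
    unfolding dev using that k deviation_quadratic(2)[OF a] by simp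
qed

section \<open>Bases and quadratic forms\<close>

text \<open>The finite basis gives access to finite-dimensional linear algebra. The dimension is
  kept as \<open>dim UNIV\<close>, hence the simplification to \<open>card Basis\<close> is switched
  off.\<close>

locale quadratic_space =
  finite_field_space scale + finite_dimensional_vector_space scale Basis
  for scale :: "'a::{field,finite} \<Rightarrow> 'b::ab_group_add \<Rightarrow> 'b" (infixr \<open>*s\<close> 75)
    and Basis :: "'b set"
begin

declare dim_UNIV [simp del]

lemma linear_functional_iff:
  "Vector_Spaces.linear scale (*) l \<longleftrightarrow> (\<forall>x y. l (x + y) = l x + l y) \<and> (\<forall>c x. l (c *s x) = c * l x)"
proof -
  have "module ((*) :: 'a \<Rightarrow> 'a \<Rightarrow> 'a)" by unfold_locales (simp_all add: algebra_simps)
  moreover have "module scale" by unfold_locales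
  ultimately show ?thesis by (simp add: linear_iff_module_hom module_hom_iff)
qed

lemma functional_sum:
  assumes "Vector_Spaces.linear scale (*) l"
  shows "l (\<Sum>i\<in>I. c i *s v i) = (\<Sum>i\<in>I. c i * l (v i))"
proof -
  have "l 0 = 0" using assms[unfolded linear_functional_iff] by (metis mult_zero_left scale_zero_left)
  then show ?thesis using assms[unfolded linear_functional_iff]
    by (induction I rule: infinite_finite_induct) auto
qed

lemma family_independent:
  assumes ind: "\<And>c. (\<Sum>i\<in>{1..n}. c i *s v i) = 0 \<Longrightarrow> \<forall>i\<in>{1..n}. c i = 0"
  shows "inj_on v {1..n::nat}" "independent (v ` {1..n})"
proof -
  show inj: "inj_on v {1..n}"
  proof (rule inj_onI, rule ccontr)
    fix i j assume ij: "i \<in> {1..n}" "j \<in> {1..n}" "v i = v j" "i \<noteq> j"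
    let ?c = "\<lambda>k. if k = i then 1 else if k = j then - 1 else (0::'a)"
    have "(\<Sum>k\<in>{1..n}. ?c k *s v k) = (\<Sum>k\<in>{1..n}. (if k = i then v i else 0) + (if k = j then - v j else 0))"
      by (rule sum.cong) (use ij in auto)
    also have "\<dots> = 0" using ij by (simp add: sum.distrib)
    finally have "?c i = 0" using bspec[OF ind[of ?c] ij(1)] by blast
    then show False by simp
  qed
  show "independent (v ` {1..n})"
    unfolding independent_explicit
  proof (intro conjI allI impI)
    fix c assume "(\<Sum>x\<in>v ` {1..n}. c x *s x) = 0"
    then have "(\<Sum>i\<in>{1..n}. c (v i) *s v i) = 0"
      unfolding sum.reindex[OF inj] by simp
    from ind[OF this] show "\<forall>x\<in>v ` {1..n}. c x = 0" by auto
  qed simp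
qed

lemma family_ordered_basis:
  assumes ind: "\<And>c. (\<Sum>i\<in>{1..n}. c i *s v i) = 0 \<Longrightarrow> \<forall>i\<in>{1..n}. c i = 0"
    and span: "\<And>x. \<exists>c. x = (\<Sum>i\<in>{1..n}. c i *s v i)"
  shows "n = dim UNIV" "ordered_basis v"
proof -
  have span': "span (v ` {1..n}) = UNIV"
  proof (rule UNIV_eq_I[symmetric])
    fix x
    obtain c where "x = (\<Sum>i\<in>{1..n}. c i *s v i)" using span by blast
    moreover have "(\<Sum>i\<in>{1..n}. c i *s v i) \<in> span (v ` {1..n})"
      by (rule span_sum, rule span_scale, rule span_base) simp
    ultimately show "x \<in> span (v ` {1..n})" by simp
  qed
  have inj: "inj_on v {1..n}" and indep: "independent (v ` {1..n})"
    by (rule family_independent[OF ind], assumption)+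
  show n: "n = dim UNIV"
    using dim_span_eq_card_independent[OF indep] card_image[OF inj] unfolding span' by simp
  show "ordered_basis v"
    using inj indep span' unfolding ordered_basis_def n[symmetric] by simp
qed

lemma coordinate_expansion:
  assumes "ordered_basis v"
  shows "(\<Sum>i=1..dim UNIV. coordinate v x i *s v i) = x"
proof -
  from assms have inj: "inj_on v {1..dim UNIV}" and ind: "independent (v ` {1..dim UNIV})"
    and span: "span (v ` {1..dim UNIV}) = UNIV" by (auto simp: ordered_basis_def)
  have "(\<Sum>b\<in>v ` {1..dim UNIV}. representation (v ` {1..dim UNIV}) x b *s b) = x"
    by (rule sum_representation_eq[OF ind]) (simp_all add: span[simplified])
  then show ?thesis unfolding sum.reindex[OF inj] by (simp add: coordinate_def)
qed

lemma coordinate_add: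
  "ordered_basis v \<Longrightarrow> coordinate v (x + y) i = coordinate v x i + coordinate v y i"
  by (simp add: ordered_basis_def coordinate_def representation_add)

lemma coordinate_scale: "ordered_basis v \<Longrightarrow> coordinate v (c *s x) i = c * coordinate v x i"
  by (simp add: ordered_basis_def coordinate_def representation_scale)

lemma coordinate_basis:
  assumes "ordered_basis v" "i \<in> {1..dim UNIV}" "j \<in> {1..dim UNIV}"
  shows "coordinate v (v i) j = (if i = j then 1 else 0)"
  using assms by (auto simp: ordered_basis_def coordinate_def representation_basis inj_on_eq_iff)

lemma coordinate_linear: "ordered_basis v \<Longrightarrow> Vector_Spaces.linear scale (*) (\<lambda>x. coordinate v x i)"
  by (simp add: linear_functional_iff coordinate_add coordinate_scale)

lemma coordinate_sum:
  assumes "ordered_basis v" "j \<in> {1..dim UNIV}"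
  shows "coordinate v (\<Sum>i=1..dim UNIV. c i *s v i) j = c j"
proof -
  have "coordinate v (\<Sum>i=1..dim UNIV. c i *s v i) j = (\<Sum>i=1..dim UNIV. c i * coordinate v (v i) j)"
    by (rule functional_sum[OF coordinate_linear[OF assms(1)]])
  also have "\<dots> = (\<Sum>i=1..dim UNIV. if i = j then c i else 0)"
    by (rule sum.cong) (use assms in \<open>auto simp: coordinate_basis\<close>)
  finally show ?thesis using assms by simp
qed

lemma bij_coordinates:
  assumes "ordered_basis v"
  shows "bij_betw (\<lambda>x. restrict (coordinate v x) {1..dim UNIV}) UNIV (tuples {1..dim UNIV})"
proof (rule bij_betw_byWitness[where f' = "\<lambda>c. \<Sum>i=1..dim UNIV. c i *s v i"])
  show "\<forall>x\<in>UNIV. (\<Sum>i=1..dim UNIV. restrict (coordinate v x) {1..dim UNIV} i *s v i) = x"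
    using coordinate_expansion[OF assms] by simp
  show "\<forall>c\<in>tuples {1..dim UNIV}. restrict (coordinate v (\<Sum>i=1..dim UNIV. c i *s v i)) {1..dim UNIV} = c"
    using coordinate_sum[OF assms] by (auto simp: fun_eq_iff PiE_def extensional_def restrict_def)
qed auto

lemma exists_ordered_basis: "\<exists>v. ordered_basis v"
proof -
  have "finite Basis" by (rule finite_Basis)
  then obtain v where v: "bij_betw v {1..card Basis} Basis" using ex_bij_betw_nat_finite_1 by blast
  then have "ordered_basis v"
    using independent_Basis span_Basis by (simp add: ordered_basis_def dim_UNIV bij_betw_def)
  then show ?thesis by blast
qed

text \<open>A family that is a basis modulo \<open>R\<close> is continued by a basis of
  \<open>R\<close>. With the radical as \<open>R\<close>, the form depends only on the first
  \<open>n\<close> coordinates, and \<open>n\<close> is its rank.\<close>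

lemma adapted_basis:
  assumes R: "subspace R"
    and ind: "\<And>c. (\<Sum>i\<in>{1..n}. c i *s w i) \<in> R \<Longrightarrow> \<forall>i\<in>{1..n}. c i = 0"
    and span: "\<And>x. \<exists>c. x - (\<Sum>i\<in>{1..n}. c i *s w i) \<in> R"
  obtains v where "ordered_basis v" "n + dim R = dim UNIV" "\<And>i. i \<in> {1..n} \<Longrightarrow> v i = w i"
    "\<And>i. i \<in> {n+1..dim UNIV} \<Longrightarrow> v i \<in> R"
proof -
  obtain B where B: "B \<subseteq> R" "independent B" "R \<subseteq> span B" "card B = dim R" using basis_exists by blast
  have finB: "finite B" by (rule finiteI_independent[OF B(2)])
  obtain h where h: "bij_betw h {1..dim R} B" using ex_bij_betw_nat_finite_1[OF finB] B(4) by auto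
  define v where "v i = (if i \<le> n then w i else h (i - n))" for i
  \<comment> \<open>The second block is rewritten as a sum over the set \<open>B\<close>, because
    independence and \<open>representation\<close> are about sets of vectors.\<close>
  have split: "(\<Sum>i\<in>{1..n + dim R}. c i *s v i)
      = (\<Sum>i\<in>{1..n}. c i *s w i) + (\<Sum>b\<in>B. c (n + inv_into {1..dim R} h b) *s b)" for c
  proof -
    have "(\<Sum>i\<in>{1..n + dim R}. c i *s v i)
        = (\<Sum>i\<in>{1..n}. c i *s v i) + (\<Sum>i\<in>{n+1..n + dim R}. c i *s v i)"
      by (rule sum.ub_add_nat) simp
    also have "(\<Sum>i\<in>{1..n}. c i *s v i) = (\<Sum>i\<in>{1..n}. c i *s w i)"
      by (rule sum.cong) (auto simp: v_def)
    also have "(\<Sum>i\<in>{n+1..n + dim R}. c i *s v i) = (\<Sum>i\<in>{1..dim R}. c (n + i) *s h i)"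
      using sum.shift_bounds_cl_nat_ivl[of "\<lambda>i. c i *s v i" 1 n "dim R"]
      by (simp add: v_def add.commute)
    also have "\<dots> = (\<Sum>i\<in>{1..dim R}. c (n + inv_into {1..dim R} h (h i)) *s h i)"
      by (rule sum.cong) (use h in \<open>auto simp: bij_betw_def inv_into_f_f\<close>)
    also have "\<dots> = (\<Sum>b\<in>B. c (n + inv_into {1..dim R} h b) *s b)"
      by (rule sum.reindex_bij_betw[OF h])
    finally show ?thesis .
  qed
  have sumB: "(\<Sum>b\<in>B. c b *s b) \<in> R" for c
    using B(1) by (auto intro!: subspace_sum[OF R] subspace_scale[OF R])
  have 1: "\<forall>i\<in>{1..n + dim R}. c i = 0" if 0: "(\<Sum>i\<in>{1..n + dim R}. c i *s v i) = 0" for c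
  proof -
    let ?d = "\<lambda>b. c (n + inv_into {1..dim R} h b)"
    have "(\<Sum>i\<in>{1..n}. c i *s w i) = - (\<Sum>b\<in>B. ?d b *s b)"
      using 0 unfolding split by (simp add: add_eq_0_iff2)
    then have "(\<Sum>i\<in>{1..n}. c i *s w i) \<in> R" using sumB subspace_neg[OF R] by metis
    then have z: "\<forall>i\<in>{1..n}. c i = 0" by (rule ind)
    then have "(\<Sum>i\<in>{1..n}. c i *s w i) = 0" by (intro sum.neutral) auto
    then have "(\<Sum>b\<in>B. ?d b *s b) = 0" using 0 unfolding split by simp
    then have d: "\<forall>b\<in>B. ?d b = 0" 
      using B(2)[unfolded independent_explicit, THEN conjunct2, THEN spec[of _ ?d]] by blast
    show ?thesis
    proof
      fix i assume i: "i \<in> {1..n + dim R}"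
      show "c i = 0"
      proof (cases "i \<le> n")
        case False
        then have j: "i - n \<in> {1..dim R}" using i by auto
        then have "h (i - n) \<in> B" using h by (auto simp: bij_betw_def)
        then have "?d (h (i - n)) = 0" using d by blast
        then show ?thesis using j h False by (simp add: bij_betw_def inv_into_f_f)
      qed (use z i in auto)
    qed
  qed
  have 2: "\<exists>c. x = (\<Sum>i\<in>{1..n + dim R}. c i *s v i)" for x
  proof -
    obtain c where c: "x - (\<Sum>i\<in>{1..n}. c i *s w i) \<in> R" using span by blast
    define r where "r = x - (\<Sum>i\<in>{1..n}. c i *s w i)"
    have "r \<in> span B" using c B(3) by (auto simp: r_def)
    then have r: "(\<Sum>b\<in>B. representation B r b *s b) = r"
      by (intro sum_representation_eq) (use B finB in auto)
    let ?c = "\<lambda>i. if i \<le> n then c i else representation B r (h (i - n))"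
    have "(\<Sum>i\<in>{1..n + dim R}. ?c i *s v i) = (\<Sum>i\<in>{1..n}. c i *s w i) + r"
    proof -
      have "(\<Sum>b\<in>B. ?c (n + inv_into {1..dim R} h b) *s b) = (\<Sum>b\<in>B. representation B r b *s b)"
      proof (rule sum.cong)
        fix b assume "b \<in> B"
        then have "b \<in> h ` {1..dim R}" using h by (simp add: bij_betw_def)
        then have "inv_into {1..dim R} h b \<in> {1..dim R}" "h (inv_into {1..dim R} h b) = b"
          by (rule inv_into_into, rule f_inv_into_f)
        then show "?c (n + inv_into {1..dim R} h b) *s b = representation B r b *s b" by auto
      qed simp
      then show ?thesis unfolding split using r by simp
    qed
    then show ?thesis by (intro exI[of _ ?c]) (simp add: r_def)
  qed
  have n: "n + dim R = dim UNIV" "ordered_basis v" using family_ordered_basis[OF 1 2] by auto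
  show ?thesis
  proof (rule that[OF n(2,1)])
    show "v i = w i" if "i \<in> {1..n}" for i using that by (simp add: v_def)
    show "v i \<in> R" if "i \<in> {n+1..dim UNIV}" for i
    proof -
      have "i - n \<in> {1..dim R}" using that n(1) by auto
      then have "h (i - n) \<in> B" using h by (auto simp: bij_betw_def)
      then show ?thesis using that B(1) by (auto simp: v_def)
    qed
  qed
qed

section \<open>Calculus of the polar form\<close>

lemma polar_expand: "Q (x + y) = Q x + Q y + polar Q x y"
  by (simp add: polar_def)

lemma polar_commute: "polar Q x y = polar Q y x"
  by (simp add: polar_def add.commute)

context
  fixes Q :: "'b \<Rightarrow> 'a"
  assumes Q: "quadratic_form Q"
begin

lemma form_scale: "Q (c *s x) = c ^ 2 * Q x"
  using Q by (simp add: quadratic_form_def)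

lemma polar_add_right: "polar Q x (y + z) = polar Q x y + polar Q x z"
  using Q by (simp add: quadratic_form_def linear_functional_iff)

lemma polar_scale_right: "polar Q x (c *s y) = c * polar Q x y"
  using Q by (simp add: quadratic_form_def linear_functional_iff)

lemma polar_add_left: "polar Q (x + y) z = polar Q x z + polar Q y z"
  using Q by (simp add: quadratic_form_def linear_functional_iff)

lemma polar_scale_left: "polar Q (c *s x) y = c * polar Q x y"
  using Q by (simp add: quadratic_form_def linear_functional_iff)

lemma form_zero: "Q 0 = 0"
  using form_scale[of 0 0] by simp

lemma polar_zero_left: "polar Q 0 y = 0"
  using polar_scale_left[of 0 0 y] by simp

lemma polar_self: "polar Q x x = 2 * Q x"
proof -
  have "Q (x + x) = 4 * Q x" using form_scale[of 2 x] by (simp add: scale_left_distrib[of 1 1 x, simplified])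
  then show ?thesis using polar_expand[of Q x x] by simp
qed

lemma form_add: "Q (x + y) = Q x + Q y + polar Q x y"
  by (rule polar_expand)

lemma polar_diff_left: "polar Q (x - y) z = polar Q x z - polar Q y z"
  using polar_add_left[of "x - y" y z] by simp

lemma polar_diff_right: "polar Q x (y - z) = polar Q x y - polar Q x z"
  using polar_add_right[of x "y - z" z] by simp

lemma form_diff: "Q (x - y) = Q x + Q y - polar Q x y"
  using form_add[of "x - y" y] by (simp add: polar_diff_left polar_self)

lemma polar_sum_left: "polar Q (\<Sum>i\<in>I. f i) y = (\<Sum>i\<in>I. polar Q (f i) y)"
  by (induction I rule: infinite_finite_induct) (auto simp: polar_zero_left polar_add_left)

lemmas form_simps = form_add form_scale polar_add_right polar_scale_right polar_add_left
  polar_scale_left polar_self form_diff polar_diff_left polar_diff_right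

lemma subspace_radical: "subspace (form_radical Q)"
  by (rule subspaceI) (auto simp: form_radical_def polar_zero_left form_zero form_simps)

lemma form_add_radical: "r \<in> form_radical Q \<Longrightarrow> Q (x + r) = Q x"
  using polar_commute[of Q x r] by (simp add: form_radical_def polar_expand)

end

end

section \<open>Canonical forms\<close>

lemma sum_pairs: "(\<Sum>j=1..2 * s. g j) = (\<Sum>i=1..s. g (2*i-1) + g (2*i::nat))"
  by (induction s) (simp_all add: add.assoc)

context quadratic_space
begin

definition hyperbolic_system :: "('b \<Rightarrow> 'a) \<Rightarrow> nat \<Rightarrow> (nat \<Rightarrow> 'b) \<Rightarrow> (nat \<Rightarrow> 'b) \<Rightarrow> bool" where
  "hyperbolic_system Q s e f \<longleftrightarrow> (\<forall>i\<in>{1..s}. Q (e i) = 0 \<and> Q (f i) = 0 \<and>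
     (\<forall>j\<in>{1..s}. polar Q (e i) (e j) = 0 \<and> polar Q (f i) (f j) = 0 \<and>
       polar Q (e i) (f j) = (if i = j then 1 else 0)))"

definition system_perp :: "('b \<Rightarrow> 'a) \<Rightarrow> nat \<Rightarrow> (nat \<Rightarrow> 'b) \<Rightarrow> (nat \<Rightarrow> 'b) \<Rightarrow> 'b set" where
  "system_perp Q s e f = {x. \<forall>i\<in>{1..s}. polar Q x (e i) = 0 \<and> polar Q x (f i) = 0}"

definition system_comb ::
  "nat \<Rightarrow> (nat \<Rightarrow> 'b) \<Rightarrow> (nat \<Rightarrow> 'b) \<Rightarrow> (nat \<Rightarrow> 'a) \<Rightarrow> (nat \<Rightarrow> 'a) \<Rightarrow> 'b" where
  "system_comb s e f a b = (\<Sum>i=1..s. a i *s e i + b i *s f i)"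

context
  fixes Q :: "'b \<Rightarrow> 'a"
  assumes Q: "quadratic_form Q"
begin

text \<open>Pairing with \<open>e j\<close> reads off the coefficient of \<open>f j\<close>, and
  conversely. The cut-off \<open>t\<close> serves the induction that evaluates \<open>Q\<close> on a
  combination.\<close>

lemma polar_system_comb:
  assumes sys: "hyperbolic_system Q s e f" and t: "t \<le> s" and j: "j \<in> {1..s}"
  shows "polar Q (system_comb t e f a b) (e j) = (if j \<le> t then b j else 0)"
    and "polar Q (system_comb t e f a b) (f j) = (if j \<le> t then a j else 0)"
proof -
  have "polar Q (system_comb t e f a b) (e j) = (\<Sum>i=1..t. if i = j then b i else 0)"
    unfolding system_comb_def polar_sum_left[OF Q]
    by (rule sum.cong) (use sys t j polar_commute[of Q _ "e j"] in
        \<open>auto simp: hyperbolic_system_def form_simps[OF Q]\<close>)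
  then show "polar Q (system_comb t e f a b) (e j) = (if j \<le> t then b j else 0)" using j by simp
  have "polar Q (system_comb t e f a b) (f j) = (\<Sum>i=1..t. if i = j then a i else 0)"
    unfolding system_comb_def polar_sum_left[OF Q]
    by (rule sum.cong) (use sys t j in \<open>auto simp: hyperbolic_system_def form_simps[OF Q]\<close>)
  then show "polar Q (system_comb t e f a b) (f j) = (if j \<le> t then a j else 0)" using j by simp
qed

lemma system_comb_perp:
  assumes w: "w \<in> system_perp Q s e f"
  shows "polar Q (system_comb s e f a b) w = 0"
  unfolding system_comb_def polar_sum_left[OF Q]
  by (rule sum.neutral) (use w polar_commute[of Q _ w] in \<open>auto simp: system_perp_def form_simps[OF Q]\<close>)

lemma form_system_comb:
  assumes sys: "hyperbolic_system Q s e f" and t: "t \<le> s"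
  shows "Q (system_comb t e f a b) = (\<Sum>i=1..t. a i * b i)"
  using t
proof (induction t)
  case 0
  show ?case by (simp add: system_comb_def form_zero[OF Q])
next
  case (Suc t)
  have s: "system_comb (Suc t) e f a b = system_comb t e f a b + (a (Suc t) *s e (Suc t) + b (Suc t) *s f (Suc t))"
    by (simp add: system_comb_def)
  have "Q (e (Suc t)) = 0" "Q (f (Suc t)) = 0" "polar Q (e (Suc t)) (f (Suc t)) = 1"
    using sys Suc.prems by (auto simp: hyperbolic_system_def)
  then show ?case unfolding s using Suc polar_system_comb[OF sys, of t "Suc t" a b]
    by (simp add: form_simps[OF Q])
qed

lemma form_system_comb_perp:
  assumes sys: "hyperbolic_system Q s e f" and w: "w \<in> system_perp Q s e f"
  shows "Q (system_comb s e f a b + w) = (\<Sum>i=1..s. a i * b i) + Q w"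
  using form_system_comb[OF sys order_refl] system_comb_perp[OF w] by (simp add: polar_expand)

lemma subspace_perp: "subspace (system_perp Q s e f)"
  by (rule subspaceI) (auto simp: system_perp_def polar_zero_left[OF Q] form_simps[OF Q])

text \<open>By the pairing rule, subtracting the combination with these coefficients cancels every
  product with \<open>e i\<close> and \<open>f i\<close>; this is the orthogonal projection.\<close>

lemma system_projection:
  assumes sys: "hyperbolic_system Q s e f"
  shows "x - system_comb s e f (\<lambda>i. polar Q x (f i)) (\<lambda>i. polar Q x (e i)) \<in> system_perp Q s e f"
  using polar_system_comb[OF sys order_refl] by (auto simp: system_perp_def polar_diff_left[OF Q])

text \<open>Pairing with the vectors \<open>f i\<close> recovers coefficients, so the vectors
  \<open>e i\<close> are linearly independent. The bound is what makes a maximal system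
  exist.\<close>

lemma system_bound:
  assumes sys: "hyperbolic_system Q s e f"
  shows "s \<le> dim UNIV"
proof -
  have ind: "\<forall>i\<in>{1..s}. c i = 0" if "(\<Sum>i\<in>{1..s}. c i *s e i) = 0" for c
  proof
    fix i assume i: "i \<in> {1..s}"
    have "system_comb s e f c (\<lambda>_. 0) = 0" using that by (simp add: system_comb_def)
    then show "c i = 0"
      using polar_system_comb(2)[OF sys order_refl i, of c "\<lambda>_. 0"] i polar_zero_left[OF Q] by simp
  qed
  have inj: "inj_on e {1..s}" and indep: "independent (e ` {1..s})"
    by (rule family_independent[OF ind], assumption)+
  show ?thesis using independent_card_le_dim[OF subset_UNIV indep] card_image[OF inj] by simp
qed

text \<open>An isotropic \<open>x\<close> outside the radical pairs nontrivially with some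
  \<open>y\<close>. Projecting \<open>y\<close> onto the complement keeps that pairing since
  \<open>x\<close> lies in the complement, and a multiple of \<open>x\<close> then corrects
  \<open>y\<close> to an isotropic partner.\<close>

lemma system_extend:
  assumes sys: "hyperbolic_system Q s e f" and x: "x \<in> system_perp Q s e f" "Q x = 0"
    and notin: "x \<notin> form_radical Q"
  shows "\<exists>e f. hyperbolic_system Q (Suc s) e f"
proof -
  obtain y where y: "polar Q x y \<noteq> 0" using x(2) notin by (auto simp: form_radical_def)
  define z where "z = y - system_comb s e f (\<lambda>i. polar Q y (f i)) (\<lambda>i. polar Q y (e i))"
  have z: "z \<in> system_perp Q s e f" unfolding z_def by (rule system_projection[OF sys])
  have "polar Q z x = polar Q y x"
    unfolding z_def by (simp add: polar_diff_left[OF Q] system_comb_perp[OF x(1)])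
  then have p: "polar Q x z \<noteq> 0" using y polar_commute by metis
  \<comment> \<open>As \<open>Q x = 0\<close>, adding \<open>c *s x\<close> to \<open>z\<close>
    changes \<open>Q z\<close> by \<open>c * polar Q x z\<close>; this \<open>c\<close> makes the
    sum isotropic, and the outer factor normalises the pairing with \<open>x\<close> to 1.\<close>
  define g where "g = (1 / polar Q x z) *s (z + (- Q z / polar Q x z) *s x)"
  have g: "g \<in> system_perp Q s e f"
    unfolding g_def using z x(1) by (intro subspace_scale subspace_add subspace_perp)
  have xg: "polar Q x g = 1" using p x(2) by (simp add: g_def form_simps[OF Q])
  have Qg: "Q g = 0" using p x(2) polar_commute[of Q z x] by (simp add: g_def form_simps[OF Q])
  have perp: "polar Q y (e j) = 0" "polar Q y (f j) = 0" "polar Q (e j) y = 0" "polar Q (f j) y = 0"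
    if "y \<in> system_perp Q s e f" "j \<in> {1..s}" for y j
    using that polar_commute[of Q "e j" y] polar_commute[of Q "f j" y] by (auto simp: system_perp_def)
  have self: "polar Q x x = 0" "polar Q g g = 0" using x(2) Qg by (simp_all add: polar_self[OF Q])
  have old: "Q (e i) = 0" "Q (f i) = 0" "polar Q (e i) (e j) = 0" "polar Q (f i) (f j) = 0"
    "polar Q (e i) (f j) = (if i = j then 1 else 0)" if "i \<in> {1..s}" "j \<in> {1..s}" for i j
    using sys that unfolding hyperbolic_system_def by blast+
  have cases: "i = Suc s \<or> i \<in> {1..s} \<and> i \<noteq> Suc s" if "i \<in> {1..Suc s}" for i
    using that by auto
  have "hyperbolic_system Q (Suc s) (e(Suc s := x)) (f(Suc s := g))"
    unfolding hyperbolic_system_def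
  proof (intro ballI conjI)
    fix i j assume "i \<in> {1..Suc s}" "j \<in> {1..Suc s}"
    note ij = cases[OF this(1)] cases[OF this(2)]
    show "polar Q ((e(Suc s := x)) i) ((e(Suc s := x)) j) = 0"
      using ij perp[OF x(1)] self old by (elim disjE conjE) simp_all
    show "polar Q ((f(Suc s := g)) i) ((f(Suc s := g)) j) = 0"
      using ij perp[OF g] self old by (elim disjE conjE) simp_all
    show "polar Q ((e(Suc s := x)) i) ((f(Suc s := g)) j) = (if i = j then 1 else 0)"
      using ij perp[OF x(1)] perp[OF g] xg old by (elim disjE conjE) simp_all
  qed (use cases x(2) Qg old in \<open>fastforce+\<close>)
  then show ?thesis by blast
qed

lemma maximal_system:
  shows "\<exists>s e f. hyperbolic_system Q s e f
    \<and> (\<forall>x\<in>system_perp Q s e f. Q x = 0 \<longrightarrow> x \<in> form_radical Q)"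
proof -
  let ?P = "\<lambda>s. \<exists>e f. hyperbolic_system Q s e f"
  have "?P 0" by (simp add: hyperbolic_system_def)
  moreover have "\<forall>s. ?P s \<longrightarrow> s \<le> dim UNIV" using system_bound by blast
  ultimately obtain s where s: "?P s" "\<forall>t. ?P t \<longrightarrow> t \<le> s"
    using Nat.ex_has_greatest_nat[of ?P 0 "dim UNIV"] by blast
  then obtain e f where sys: "hyperbolic_system Q s e f" by blast
  show ?thesis
  proof (intro exI conjI ballI impI, rule sys, rule ccontr)
    fix x assume "x \<in> system_perp Q s e f" "Q x = 0" "x \<notin> form_radical Q"
    then have "?P (Suc s)" by (rule system_extend[OF sys])
    then show False using s(2) by fastforce
  qed
qed

text \<open>The vectors \<open>u i\<close> form a basis of the complement modulo the radical, so
  hyperbolic pairs, the \<open>u i\<close> and a basis of the radical together form a basis. The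
  classification is thereby reduced to \<open>k\<close> and the values of \<open>Q\<close> on the
  span of the \<open>u i\<close>.\<close>

lemma canonical_basis:
  assumes sys: "hyperbolic_system Q s e f"
    and u: "\<And>i. i \<in> {1..k} \<Longrightarrow> u i \<in> system_perp Q s e f"
    and ind: "\<And>c. (\<Sum>i\<in>{1..k}. c i *s u i) \<in> form_radical Q \<Longrightarrow> \<forall>i\<in>{1..k}. c i = 0"
    and span: "\<And>x. x \<in> system_perp Q s e f \<Longrightarrow> \<exists>c. x - (\<Sum>i\<in>{1..k}. c i *s u i) \<in> form_radical Q"
  shows "\<exists>v. ordered_basis v \<and> form_rank Q = 2 * s + k \<and> 2 * s + k \<le> dim UNIV \<and>
    (\<forall>x. Q x = (\<Sum>i=1..s. coordinate v x (2*i-1) * coordinate v x (2*i))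
       + Q (\<Sum>i=1..k. coordinate v x (2 * s+i) *s u i))"
proof -
  let ?R = "form_radical Q" and ?W = "system_perp Q s e f"
  \<comment> \<open>Pairs are interleaved: \<open>e i\<close> sits at \<open>2*i-1\<close> and
    \<open>f i\<close> at \<open>2*i\<close>, as \<open>hyperbolic_form\<close> expects.\<close>
  define w where "w j = (if j \<le> 2 * s then if even j then f (j div 2) else e ((j + 1) div 2)
    else u (j - 2 * s))" for j
  have split: "(\<Sum>j\<in>{1..2 * s+k}. c j *s w j) = system_comb s e f (\<lambda>i. c (2*i-1)) (\<lambda>i. c (2*i))
      + (\<Sum>i=1..k. c (2 * s+i) *s u i)" for c
  proof -
    have "(\<Sum>j\<in>{1..2 * s+k}. c j *s w j)
        = (\<Sum>j=1..2 * s. c j *s w j) + (\<Sum>j\<in>{2 * s+1..2 * s+k}. c j *s w j)"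
      by (rule sum.ub_add_nat) simp
    also have "(\<Sum>j\<in>{2 * s+1..2 * s+k}. c j *s w j) = (\<Sum>i=1..k. c (2 * s+i) *s u i)"
      using sum.shift_bounds_cl_nat_ivl[of "\<lambda>j. c j *s w j" 1 "2 * s" k]
      by (simp add: w_def add.commute)
    also have "(\<Sum>j=1..2 * s. c j *s w j) = system_comb s e f (\<lambda>i. c (2*i-1)) (\<lambda>i. c (2*i))"
      unfolding sum_pairs system_comb_def by (rule sum.cong) (auto simp: w_def)
    finally show ?thesis .
  qed
  have uW: "(\<Sum>i=1..k. c i *s u i) \<in> ?W" for c
    by (rule subspace_sum[OF subspace_perp], rule subspace_scale[OF subspace_perp], rule u)
  obtain v where v: "ordered_basis v" "2 * s + k + dim ?R = dim UNIV"
    "\<And>j. j \<in> {1..2 * s+k} \<Longrightarrow> v j = w j" "\<And>j. j \<in> {2 * s+k+1..dim UNIV} \<Longrightarrow> v j \<in> ?R"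
  proof (rule adapted_basis[where R = ?R and n = "2 * s+k" and w = w])
    show "subspace ?R" by (rule subspace_radical[OF Q])
    show "\<forall>j\<in>{1..2 * s+k}. c j = 0" if c: "(\<Sum>j\<in>{1..2 * s+k}. c j *s w j) \<in> ?R" for c
    proof -
      let ?h = "system_comb s e f (\<lambda>i. c (2*i-1)) (\<lambda>i. c (2*i))"
      let ?u = "\<Sum>i=1..k. c (2 * s+i) *s u i"
      have "?h + ?u \<in> ?R" using c unfolding split .
      then have p: "polar Q (?h + ?u) y = 0" for y by (simp add: form_radical_def)
      have uW': "?u \<in> ?W" by (rule uW)
      \<comment> \<open>A radical vector pairs to zero with everything, and pairing with
        \<open>e i\<close> and \<open>f i\<close> returns these two coefficients.\<close>
      have z: "c (2*i-1) = 0 \<and> c (2*i) = 0" if i: "i \<in> {1..s}" for i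
      proof -
        have "polar Q ?u (e i) = 0" "polar Q ?u (f i) = 0" using uW' i by (auto simp: system_perp_def)
        then show ?thesis using p[of "e i"] p[of "f i"] i
            polar_system_comb[OF sys order_refl i, of "\<lambda>i. c (2*i-1)" "\<lambda>i. c (2*i)"]
          by (simp add: polar_add_left[OF Q])
      qed
      then have "?h = 0" unfolding system_comb_def by (intro sum.neutral) auto
      then have "?u \<in> ?R" using \<open>?h + ?u \<in> ?R\<close> by simp
      then have y: "\<forall>i\<in>{1..k}. c (2 * s+i) = 0" by (rule ind)
      show ?thesis
      proof
        fix j assume j: "j \<in> {1..2 * s+k}"
        consider "j > 2 * s" | i where "i \<in> {1..s}" "j = 2*i-1 \<or> j = 2*i"
        proof (cases "j > 2 * s")
          case False
          then have "(j + 1) div 2 \<in> {1..s}" "j = 2*((j + 1) div 2)-1 \<or> j = 2*((j + 1) div 2)"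
            using j by auto
          then show ?thesis using that(2) by blast
        qed
        then show "c j = 0"
        proof cases
          case 1
          then have "j - 2 * s \<in> {1..k}" using j by auto
          then have "c (2 * s + (j - 2 * s)) = 0" using y by blast
          then show ?thesis using 1 by simp
        qed (use z in blast)
      qed
    qed
    show "\<exists>c. x - (\<Sum>j\<in>{1..2 * s+k}. c j *s w j) \<in> ?R" for x
    proof -
      let ?a = "\<lambda>i. polar Q x (f i)" and ?b = "\<lambda>i. polar Q x (e i)"
      obtain d where d: "x - system_comb s e f ?a ?b - (\<Sum>i\<in>{1..k}. d i *s u i) \<in> ?R"
        using span[OF system_projection[OF sys]] by blast
      define c where "c j = (if j \<le> 2 * s then if even j then ?b (j div 2) else ?a ((j + 1) div 2)
        else d (j - 2 * s))" for j
      have "system_comb s e f (\<lambda>i. c (2*i-1)) (\<lambda>i. c (2*i)) = system_comb s e f ?a ?b"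
        unfolding system_comb_def by (rule sum.cong) (auto simp: c_def)
      moreover have "(\<Sum>i=1..k. c (2 * s+i) *s u i) = (\<Sum>i\<in>{1..k}. d i *s u i)"
        by (rule sum.cong) (auto simp: c_def)
      ultimately have "(\<Sum>j\<in>{1..2 * s+k}. c j *s w j)
          = system_comb s e f ?a ?b + (\<Sum>i\<in>{1..k}. d i *s u i)" unfolding split by simp
      then show ?thesis using d by (intro exI[of _ c]) (simp add: diff_diff_eq)
    qed
  qed (use that in blast)
  show ?thesis
  proof (intro exI[of _ v] conjI allI v(1))
    show "form_rank Q = 2 * s + k" "2 * s + k \<le> dim UNIV" using v(2) by (simp_all add: form_rank_def)
    fix x
    let ?c = "coordinate v x"
    have le: "2 * s + k \<le> dim UNIV" using v(2) by simp
    have "x = (\<Sum>j=1..dim UNIV. ?c j *s v j)" using coordinate_expansion[OF v(1)] by simp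
    also have "{1..dim UNIV} = {1..2 * s+k} \<union> {2 * s+k+1..dim UNIV}" using le by auto
    also have "(\<Sum>j\<in>\<dots>. ?c j *s v j) = (\<Sum>j\<in>{1..2 * s+k}. ?c j *s v j)
        + (\<Sum>j\<in>{2 * s+k+1..dim UNIV}. ?c j *s v j)"
      by (rule sum.union_disjoint) auto
    also have "(\<Sum>j\<in>{1..2 * s+k}. ?c j *s v j) = (\<Sum>j\<in>{1..2 * s+k}. ?c j *s w j)"
      by (rule sum.cong) (use v(3) in auto)
    finally have "x = (\<Sum>j\<in>{1..2 * s+k}. ?c j *s w j) + (\<Sum>j\<in>{2 * s+k+1..dim UNIV}. ?c j *s v j)" .
    moreover have "(\<Sum>j\<in>{2 * s+k+1..dim UNIV}. ?c j *s v j) \<in> ?R"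
      by (rule subspace_sum[OF subspace_radical[OF Q]], rule subspace_scale[OF subspace_radical[OF Q]], rule v(4))
    ultimately have "Q x = Q (\<Sum>j\<in>{1..2 * s+k}. ?c j *s w j)" using form_add_radical[OF Q] by metis
    then show "Q x = (\<Sum>i=1..s. ?c (2*i-1) * ?c (2*i)) + Q (\<Sum>i=1..k. ?c (2 * s+i) *s u i)"
      unfolding split form_system_comb_perp[OF sys uW] .
  qed
qed

text \<open>A form in three independent variables over a finite field has a nontrivial zero. In
  characteristic two one orthogonality condition and a square root suffice; otherwise the form is
  diagonalised and pigeonhole applies.\<close>

lemma anisotropic_ternary:
  assumes W: "subspace W" and aniso: "\<And>x. x \<in> W \<Longrightarrow> Q x = 0 \<Longrightarrow> x \<in> form_radical Q"
    and x: "x1 \<in> W" "x2 \<in> W" "x3 \<in> W"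
    and ind: "\<And>a b c. a *s x1 + b *s x2 + c *s x3 \<in> form_radical Q \<Longrightarrow> a = 0 \<and> b = 0 \<and> c = 0"
  shows False
proof -
  have zero: "a = 0 \<and> b = 0 \<and> c = 0" if "Q (a *s x1 + b *s x2 + c *s x3) = 0" for a b c
    using that x by (intro ind aniso subspace_add[OF W] subspace_scale[OF W])
  have Q1: "Q x1 \<noteq> 0" using zero[of 1 0 0] by auto
  show False
  proof (cases "(2::'a) = 0")
    case True
    \<comment> \<open>One linear condition on two unknowns.\<close>
    have "\<exists>b c. (b, c) \<noteq> (0, 0) \<and> polar Q x1 (b *s x2 + c *s x3) = 0"
    proof (cases "polar Q x1 x2 = 0")
      case True
      then show ?thesis by (intro exI[of _ 1] exI[of _ 0]) simp
    next
      case False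
      then show ?thesis
        by (intro exI[of _ "polar Q x1 x3"] exI[of _ "- polar Q x1 x2"]) (simp add: form_simps[OF Q])
    qed
    then obtain b c where bc: "(b, c) \<noteq> (0, 0)" "polar Q x1 (b *s x2 + c *s x3) = 0" by blast
    \<comment> \<open>Orthogonal to \<open>x1\<close>, the sum has value \<open>t^2 * Q x1\<close>
      plus that of the second vector, and every element is a square.\<close>
    obtain t where t: "t ^ 2 = - Q (b *s x2 + c *s x3) / Q x1"
      using char2_bij_square[OF True] by (metis bij_pointE)
    have "Q (t *s x1 + (b *s x2 + c *s x3)) = t ^ 2 * Q x1 + Q (b *s x2 + c *s x3)"
      unfolding form_add[OF Q, of "t *s x1"] using bc(2)
      by (simp only: form_scale[OF Q] polar_scale_left[OF Q]) simp
    also have "\<dots> = 0" using Q1 by (simp add: t)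
    finally show False using zero[of t b c] bc(1) by (simp add: add.assoc)
  next
    case False
    \<comment> \<open>Gram-Schmidt; the denominators are nonzero because the vectors involved are
      anisotropic and \<open>2\<close> is invertible.\<close>
    define \<alpha> where "\<alpha> = polar Q x1 x2 / (2 * Q x1)"
    define y2 where "y2 = x2 + (- \<alpha>) *s x1"
    have p12: "polar Q x1 y2 = 0" using False Q1 by (simp add: y2_def \<alpha>_def form_simps[OF Q])
    have Q2: "Q y2 \<noteq> 0"
    proof
      assume "Q y2 = 0"
      then have "Q ((- \<alpha>) *s x1 + 1 *s x2 + 0 *s x3) = 0" by (simp add: y2_def add.commute)
      from zero[OF this] show False by simp
    qed
    define \<beta> where "\<beta> = polar Q x1 x3 / (2 * Q x1)"
    define \<gamma> where "\<gamma> = polar Q y2 x3 / (2 * Q y2)"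
    define y3 where "y3 = x3 + (- \<beta>) *s x1 + (- \<gamma>) *s y2"
    have p13: "polar Q x1 y3 = 0"
      using False Q1 p12 by (simp add: y3_def \<beta>_def form_simps[OF Q])
    have p23: "polar Q y2 y3 = 0" using False Q2 p12 polar_commute[of Q y2 x1]
      by (simp add: y3_def \<gamma>_def form_simps[OF Q])
    obtain a b where ab: "a ^ 2 * Q x1 + b ^ 2 * Q y2 + Q y3 = 0"
      using ternary_diagonal_isotropic[OF Q1 Q2] by blast
    have "Q (a *s x1 + b *s y2 + y3) = 0"
      using ab p12 p13 p23 by (simp add: form_simps[OF Q])
    moreover have "a *s x1 + b *s y2 + y3
        = (a - \<beta> - (b - \<gamma>) * \<alpha>) *s x1 + (b - \<gamma>) *s x2 + 1 *s x3"
      by (simp add: y2_def y3_def scale_right_distrib scale_left_distrib scale_left_diff_distrib algebra_simps)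
    ultimately have "Q ((a - \<beta> - (b - \<gamma>) * \<alpha>) *s x1 + (b - \<gamma>) *s x2 + 1 *s x3) = 0" by simp
    from zero[OF this] show False by simp
  qed
qed

text \<open>Any two anisotropic planes are isometric, so the fixed parameters can be reached
  exactly, without a scalar factor. In characteristic two the obstruction is a class modulo
  \<open>t^2 + t\<close>, in odd characteristic a class modulo squares; anisotropy picks the
  nontrivial one.\<close>

lemma anisotropic_binary:
  assumes lam: "even CARD('a) \<Longrightarrow> \<nexists>t. t ^ 2 + t = lam"
    and eta: "odd CARD('a) \<Longrightarrow> nonsquare eta"
    and W: "subspace W" and aniso: "\<And>x. x \<in> W \<Longrightarrow> Q x = 0 \<Longrightarrow> x \<in> form_radical Q"
    and x: "x1 \<in> W" "x2 \<in> W"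
    and ind: "\<And>a b. a *s x1 + b *s x2 \<in> form_radical Q \<Longrightarrow> a = 0 \<and> b = 0"
  obtains y1 y2 where "y1 \<in> W" "y2 \<in> W" "\<And>a b. Q (a *s y1 + b *s y2) = elliptic_plane lam eta a b"
proof -
  have zero: "a = 0 \<and> b = 0" if "Q (a *s x1 + b *s x2) = 0" for a b
    using that x by (intro ind aniso subspace_add[OF W] subspace_scale[OF W])
  have Q1: "Q x1 \<noteq> 0" using zero[of 1 0] by auto
  show ?thesis
  proof (cases "even CARD('a)")
    case True
    then have two: "(2::'a) = 0" by (simp add: even_card_iff_two_eq_0)
    have root: "\<exists>t. t ^ 2 = (a::'a)" for a using char2_bij_square[OF two] by (metis bij_pointE)
    obtain t where t: "t ^ 2 = 1 / Q x1" using root by blast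
    define y1 where "y1 = t *s x1"
    have Qy1: "Q y1 = 1" using Q1 t by (simp add: y1_def form_scale[OF Q])
    \<comment> \<open>If \<open>x2\<close> were orthogonal to \<open>y1\<close>, a square root of
      \<open>- Q x2\<close> would produce an isotropic vector.\<close>
    have p: "polar Q y1 x2 \<noteq> 0"
    proof
      assume p: "polar Q y1 x2 = 0"
      obtain r where "r ^ 2 = - Q x2" using root by blast
      then have "Q (r *s y1 + x2) = 0" using p Qy1 by (simp add: form_simps[OF Q])
      then have "Q ((r * t) *s x1 + 1 *s x2) = 0" by (simp add: y1_def)
      from zero[OF this] show False by simp
    qed
    define z where "z = (1 / polar Q y1 x2) *s x2"
    have pz: "polar Q y1 z = 1" using p by (simp add: z_def form_simps[OF Q])
    have "\<nexists>r. r ^ 2 + r = Q z"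
    proof
      assume "\<exists>r. r ^ 2 + r = Q z"
      then obtain r where "r ^ 2 + r = Q z" by blast
      then have "Q (r *s y1 + z) = 2 * Q z" using Qy1 pz by (simp add: form_simps[OF Q])
      then have "Q ((r * t) *s x1 + (1 / polar Q y1 x2) *s x2) = 0" using two by (simp add: y1_def z_def)
      from zero[OF this] show False using p by simp
    qed
    \<comment> \<open>Neither \<open>Q z\<close> nor \<open>lam\<close> lies in the image of
      \<open>t^2 + t\<close>, so their sum does. Adding \<open>r *s y1\<close> to \<open>z\<close>
      changes its value by \<open>r^2 + r\<close>, exactly what is needed to reach
      \<open>lam\<close>.\<close>
    then obtain r where r: "r ^ 2 + r = Q z + lam" using artin_schreier_coset[OF two _ lam[OF True]] by blast
    define y2 where "y2 = z + r *s y1"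
    have "Q y2 = Q z + (r ^ 2 + r)" using Qy1 pz polar_commute[of Q z y1]
      by (simp add: y2_def form_simps[OF Q])
    also have "\<dots> = 2 * Q z + lam" by (simp add: r)
    finally have Qy2: "Q y2 = lam" using two by simp
    have p12: "polar Q y1 y2 = 1" using pz two by (simp add: y2_def form_simps[OF Q])
    show ?thesis
    proof (rule that)
      show "y1 \<in> W" "y2 \<in> W" unfolding y1_def y2_def z_def
        using x by (intro subspace_add[OF W] subspace_scale[OF W]; simp)+
      show "Q (a *s y1 + b *s y2) = elliptic_plane lam eta a b" for a b
        using True Qy1 Qy2 p12 by (simp add: form_simps[OF Q] elliptic_plane_def)
    qed
  next
    case False
    then have two: "(2::'a) \<noteq> 0" by (simp add: even_card_iff_two_eq_0)
    define \<alpha> where "\<alpha> = polar Q x1 x2 / (2 * Q x1)"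
    define z where "z = x2 + (- \<alpha>) *s x1"
    have p: "polar Q x1 z = 0" using two Q1 by (simp add: z_def \<alpha>_def form_simps[OF Q])
    have Qz: "Q z \<noteq> 0"
    proof
      assume "Q z = 0"
      then have "Q ((- \<alpha>) *s x1 + 1 *s x2) = 0" by (simp add: z_def add.commute)
      from zero[OF this] show False by simp
    qed
    \<comment> \<open>The plane represents 1: pigeonhole with constant term
      \<open>- 1\<close>.\<close>
    obtain a b where ab: "a ^ 2 * Q x1 + b ^ 2 * Q z + (- 1) = 0"
      using ternary_diagonal_isotropic[OF Q1 Qz] by blast
    define y1 where "y1 = a *s x1 + b *s z"
    \<comment> \<open>The orthogonal direction to \<open>y1\<close> in the plane; since
      \<open>Q y1 = 1\<close>, its value is the discriminant \<open>Q x1 * Q z\<close>.\<close>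
    define y3 where "y3 = (b * Q z) *s x1 + (- (a * Q x1)) *s z"
    have Qy1: "Q y1 = 1" using ab p by (simp add: y1_def form_simps[OF Q])
    have p13: "polar Q y1 y3 = 0"
      using p polar_commute[of Q z x1] by (simp add: y1_def y3_def form_simps[OF Q])
    have "Q y3 = Q x1 * Q z * (a ^ 2 * Q x1 + b ^ 2 * Q z)"
      using p by (simp add: y3_def form_simps[OF Q] power2_eq_square algebra_simps)
    then have Qy3: "Q y3 = Q x1 * Q z" using ab by simp
    have W3: "y1 \<in> W" "y3 \<in> W" unfolding y1_def y3_def z_def
      using x by (intro subspace_add[OF W] subspace_scale[OF W]; simp)+
    \<comment> \<open>A root \<open>r\<close> of \<open>- Q y3\<close> would make
      \<open>r *s y1 + y3\<close> isotropic, hence radical, although it pairs with \<open>y3\<close>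
      to \<open>2 * Q y3\<close>, which is nonzero.\<close>
    have "nonsquare (- Q y3)"
      unfolding nonsquare_def
    proof (intro conjI notI)
      show "- Q y3 = 0 \<Longrightarrow> False" using Qy3 Q1 Qz by simp
      assume "\<exists>r. - Q y3 = r ^ 2"
      then obtain r where r: "- Q y3 = r ^ 2" by blast
      have "Q (r *s y1 + y3) = 0" using r Qy1 p13 by (simp add: form_simps[OF Q] flip: r)
      then have "r *s y1 + y3 \<in> form_radical Q"
        using W3 by (intro aniso subspace_add[OF W] subspace_scale[OF W])
      then have "polar Q (r *s y1 + y3) y3 = 0" by (simp add: form_radical_def)
      then show False using p13 two Qy3 Q1 Qz by (simp add: form_simps[OF Q])
    qed
    then obtain t where t: "t \<noteq> 0" "- Q y3 = eta * t ^ 2" using nonsquare_ratio eta[OF False] by blast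
    define y2 where "y2 = (1 / t) *s y3"
    have "Q y2 = - (- Q y3 / t ^ 2)" by (simp add: y2_def form_scale[OF Q] power_divide)
    then have Qy2: "Q y2 = - eta" unfolding t(2) using t(1) by simp
    have p12: "polar Q y1 y2 = 0" using p13 by (simp add: y2_def form_simps[OF Q])
    show ?thesis
    proof (rule that[OF W3(1)])
      show "y2 \<in> W" unfolding y2_def using W3 by (intro subspace_scale[OF W])
      show "Q (a *s y1 + b *s y2) = elliptic_plane lam eta a b" for a b
        using False Qy1 Qy2 p12 by (simp add: form_simps[OF Q] elliptic_plane_def)
    qed
  qed
qed

end

text \<open>A zero with nonzero \<open>z\<close> would give, through \<open>y / z\<close>, a
  solution of \<open>t^2 + t = lam\<close> or a root of \<open>eta\<close>.\<close>

lemma elliptic_plane_zero_iff: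
  assumes lam: "even CARD('a) \<Longrightarrow> \<nexists>t. t ^ 2 + t = lam"
    and eta: "odd CARD('a) \<Longrightarrow> nonsquare eta"
  shows "elliptic_plane lam (eta::'a) y z = 0 \<longleftrightarrow> y = 0 \<and> z = 0"
proof
  assume eq: "elliptic_plane lam eta y z = 0"
  show "y = 0 \<and> z = 0"
  proof (cases "z = 0")
    case True
    then show ?thesis using eq by (simp add: elliptic_plane_def split: if_splits)
  next
    case z: False
    show ?thesis
    proof (cases "even CARD('a)")
      case True
      then have two: "(2::'a) = 0" by (simp add: even_card_iff_two_eq_0)
      have "((y / z) ^ 2 + y / z + lam) * z ^ 2 = 0"
        using eq True z by (simp add: elliptic_plane_def power2_eq_square field_simps)
      then have "(y / z) ^ 2 + y / z = - lam" using z by (simp add: add_eq_0_iff2)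
      then show ?thesis using lam[OF True] char2_uminus[OF two] by metis
    next
      case False
      then have "eta = (y / z) ^ 2" using eq z by (simp add: elliptic_plane_def power_divide field_simps)
      then show ?thesis using eta[OF False] by (auto simp: nonsquare_def)
    qed
  qed
qed (simp add: elliptic_plane_def)

lemma elliptic_form_alt:
  "elliptic_form lam eta v s x = (\<Sum>i=1..s-1. coordinate v x (2*i-1) * coordinate v x (2*i))
    + elliptic_plane lam eta (coordinate v x (2 * s-1)) (coordinate v x (2 * s))"
  by (simp add: elliptic_form_def hyperbolic_form_def elliptic_plane_def Let_def)

text \<open>Witt decomposition: what is left of \<open>Q\<close> on the complement of a maximal hyperbolic system is
  anisotropic modulo the radical, hence of dimension at most two.\<close>

lemma canonical_form:
  assumes Q: "quadratic_form Q"
    and lam: "even CARD('a) \<Longrightarrow> \<nexists>t. t ^ 2 + t = lam"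
    and eta: "odd CARD('a) \<Longrightarrow> nonsquare eta"
  obtains (hyperbolic) v s where "ordered_basis v" "form_rank Q = 2 * s" "2 * s \<le> dim UNIV"
      "Q = hyperbolic_form v s"
    | (elliptic) v s where "ordered_basis v" "s \<ge> 1" "form_rank Q = 2 * s" "2 * s \<le> dim UNIV"
      "Q = elliptic_form lam eta v s"
    | (parabolic) v s a where "ordered_basis v" "form_rank Q = 2 * s + 1" "2 * s + 1 \<le> dim UNIV"
      "a \<noteq> 0" "Q = (\<lambda>x. hyperbolic_form v s x + a * coordinate v x (2 * s+1) ^ 2)"
proof -
  obtain s e f where sys: "hyperbolic_system Q s e f"
    and aniso: "\<And>x. x \<in> system_perp Q s e f \<Longrightarrow> Q x = 0 \<Longrightarrow> x \<in> form_radical Q"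
    using maximal_system[OF Q] by blast
  let ?W = "system_perp Q s e f" and ?R = "form_radical Q"
  have W: "subspace ?W" by (rule subspace_perp[OF Q])
  have R: "subspace ?R" by (rule subspace_radical[OF Q])
  show thesis
  proof (cases "?W \<subseteq> ?R")
    case True
    have "\<exists>v. ordered_basis v \<and> form_rank Q = 2 * s + 0 \<and> 2 * s + 0 \<le> dim UNIV \<and>
      (\<forall>x. Q x = (\<Sum>i=1..s. coordinate v x (2*i-1) * coordinate v x (2*i))
       + Q (\<Sum>i=1..0. coordinate v x (2 * s+i) *s 0))"
      by (rule canonical_basis[OF Q sys, where k = 0 and u = "\<lambda>_. 0"]) (use True in auto)
    then obtain v where v: "ordered_basis v" "form_rank Q = 2 * s" "2 * s \<le> dim UNIV"
      "\<And>x. Q x = (\<Sum>i=1..s. coordinate v x (2*i-1) * coordinate v x (2*i))"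
      by (auto simp: form_zero[OF Q])
    have "Q = hyperbolic_form v s" by (rule ext) (simp only: v(4) hyperbolic_form_def)
    with v(1-3) show thesis by (rule hyperbolic)
  next
    case False
    then obtain x1 where x1: "x1 \<in> ?W" "x1 \<notin> ?R" by blast
    have ind1: "a = 0" if "a *s x1 \<in> ?R" for a
      using subspace_scale[OF R that, of "1 / a"] x1(2) by (cases "a = 0") auto
    show thesis
    proof (cases "\<forall>x\<in>?W. \<exists>a. x - a *s x1 \<in> ?R")
      case True
      have "\<exists>v. ordered_basis v \<and> form_rank Q = 2 * s + 1 \<and> 2 * s + 1 \<le> dim UNIV \<and>
        (\<forall>x. Q x = (\<Sum>i=1..s. coordinate v x (2*i-1) * coordinate v x (2*i))
         + Q (\<Sum>i=1..1. coordinate v x (2 * s+i) *s x1))"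
      proof (rule canonical_basis[OF Q sys, where k = 1 and u = "\<lambda>_. x1"])
        show "\<exists>c. x - (\<Sum>i\<in>{1..1::nat}. c i *s x1) \<in> ?R" if x: "x \<in> ?W" for x
        proof -
          obtain a where "x - a *s x1 \<in> ?R" using True x by blast
          then show ?thesis by (intro exI[of _ "\<lambda>_. a"]) simp
        qed
        show "\<forall>i\<in>{1..1}. c i = 0" if "(\<Sum>i\<in>{1..1::nat}. c i *s x1) \<in> ?R" for c
          using that ind1[of "c 1"] by simp
      qed (rule x1(1))
      then obtain v where v: "ordered_basis v" "form_rank Q = 2 * s + 1" "2 * s + 1 \<le> dim UNIV"
        "\<And>x. Q x = (\<Sum>i=1..s. coordinate v x (2*i-1) * coordinate v x (2*i))
         + Q x1 * coordinate v x (2 * s+1) ^ 2"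
        by (auto simp: form_scale[OF Q] mult.commute)
      have "Q x1 \<noteq> 0" using aniso x1 by blast
      moreover have "Q = (\<lambda>x. hyperbolic_form v s x + Q x1 * coordinate v x (2 * s+1) ^ 2)"
        by (rule ext, subst v(4)) (simp only: hyperbolic_form_def)
      ultimately show thesis by (rule parabolic[OF v(1-3)])
    next
      case False
      then obtain x2 where x2: "x2 \<in> ?W" "\<And>a. x2 - a *s x1 \<notin> ?R" by blast
      have ind2: "a = 0 \<and> b = 0" if ab: "a *s x1 + b *s x2 \<in> ?R" for a b
      proof -
        have "b = 0"
        proof (rule ccontr)
          assume "b \<noteq> 0"
          then have "x2 - (- a / b) *s x1 = (1 / b) *s (a *s x1 + b *s x2)"
            by (simp add: scale_right_distrib)
          then show False using subspace_scale[OF R ab, of "1 / b"] x2(2) by metis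
        qed
        then show ?thesis using ab ind1 by auto
      qed
      obtain y1 y2 where y: "y1 \<in> ?W" "y2 \<in> ?W"
        "\<And>a b. Q (a *s y1 + b *s y2) = elliptic_plane lam eta a b"
        by (rule anisotropic_binary[OF Q lam eta W aniso x1(1) x2(1) ind2]; blast)
      have indy: "a = 0 \<and> b = 0" if "a *s y1 + b *s y2 \<in> ?R" for a b
      proof -
        have "Q (a *s y1 + b *s y2) = 0" using that by (simp add: form_radical_def)
        then show ?thesis unfolding y(3) using elliptic_plane_zero_iff[OF lam eta] by blast
      qed
      \<comment> \<open>A vector of the complement outside this span modulo the radical would be a
        third independent anisotropic direction.\<close>
      have spany: "\<exists>a b. x - (a *s y1 + b *s y2) \<in> ?R" if x: "x \<in> ?W" for x
      proof (rule ccontr)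
        assume no: "\<nexists>a b. x - (a *s y1 + b *s y2) \<in> ?R"
        show False
        proof (rule anisotropic_ternary[OF Q W aniso y(1,2) x])
          fix a b c assume abc: "a *s y1 + b *s y2 + c *s x \<in> ?R"
          have "c = 0"
          proof (rule ccontr)
            assume "c \<noteq> 0"
            then have "x - ((- a / c) *s y1 + (- b / c) *s y2)
                = (1 / c) *s (a *s y1 + b *s y2 + c *s x)"
              by (simp add: scale_right_distrib)
            then show False using subspace_scale[OF R abc, of "1 / c"] no by metis
          qed
          then show "a = 0 \<and> b = 0 \<and> c = 0" using abc indy by auto
        qed
      qed
      let ?u = "\<lambda>i::nat. if i = 1 then y1 else y2"
      have two: "{1..2::nat} = {1, 2}" by auto
      have ex: "\<exists>v. ordered_basis v \<and> form_rank Q = 2 * s + 2 \<and> 2 * s + 2 \<le> dim UNIV \<and>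
        (\<forall>x. Q x = (\<Sum>i=1..s. coordinate v x (2*i-1) * coordinate v x (2*i))
         + Q (\<Sum>i=1..2. coordinate v x (2 * s+i) *s ?u i))"
      proof (rule canonical_basis[OF Q sys, where k = 2 and u = ?u])
        show "?u i \<in> ?W" if "i \<in> {1..2}" for i using y by simp
        show "\<forall>i\<in>{1..2}. c i = 0" if "(\<Sum>i\<in>{1..2}. c i *s ?u i) \<in> ?R" for c
          using that indy unfolding two by simp
        show "\<exists>c. x - (\<Sum>i\<in>{1..2}. c i *s ?u i) \<in> ?R" if x: "x \<in> ?W" for x
        proof -
          obtain a b where "x - (a *s y1 + b *s y2) \<in> ?R" using spany[OF x] by blast
          then show ?thesis unfolding two by (intro exI[of _ "\<lambda>i. if i = 1 then a else b"]) simp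
        qed
      qed
      have eu: "Q (\<Sum>i=1..2. c (2 * s+i) *s ?u i)
          = elliptic_plane lam eta (c (2 * s+1)) (c (2 * s+2))" for c
        using y(3)[of "c (2 * s+1)" "c (2 * s+2)"] unfolding two by simp
      obtain v where v: "ordered_basis v" "form_rank Q = 2 * s + 2" "2 * s + 2 \<le> dim UNIV"
        "\<And>x. Q x = (\<Sum>i=1..s. coordinate v x (2*i-1) * coordinate v x (2*i))
         + elliptic_plane lam eta (coordinate v x (2 * s+1)) (coordinate v x (2 * s+2))"
        using ex[unfolded eu] by blast
      \<comment> \<open>\<open>elliptic_form\<close> counts the anisotropic plane among its planes,
        hence \<open>s + 1\<close>.\<close>
      have "Q = elliptic_form lam eta v (s + 1)"
        by (rule ext) (subst v(4), simp add: elliptic_form_alt)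
      then show thesis using v(2,3) by (intro elliptic[OF v(1), of "s + 1"]) simp_all
    qed
  qed
qed

end

section \<open>Moments of the zero counts\<close>

context quadratic_space
begin

abbreviation m :: nat where "m \<equiv> dim UNIV"

definition functionals :: "('b \<Rightarrow> 'a) set" where
  "functionals = {l. Vector_Spaces.linear scale (*) l}"

lemma card_tuples: "finite I \<Longrightarrow> card (tuples I :: ('i \<Rightarrow> 'a) set) = CARD('a) ^ card I"
  by (simp add: card_PiE)

lemma finite_space: "finite (UNIV :: 'b set)"
proof -
  obtain v where "ordered_basis v" using exists_ordered_basis by blast
  from bij_betw_finite[OF bij_coordinates[OF this]] show ?thesis by (simp add: finite_tuples)
qed

lemma card_space: "CARD('b) = CARD('a) ^ m"
proof -
  obtain v where "ordered_basis v" using exists_ordered_basis by blast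
  from bij_betw_same_card[OF bij_coordinates[OF this]] show ?thesis by (simp add: card_tuples)
qed

lemma functional_coordinates:
  assumes "ordered_basis v" "l \<in> functionals"
  shows "l x = (\<Sum>i=1..m. l (v i) * coordinate v x i)"
  using functional_sum[of l "coordinate v x" v "{1..m}"] assms(2)
  unfolding coordinate_expansion[OF assms(1)] by (simp add: functionals_def mult.commute)

lemma bij_functionals:
  assumes v: "ordered_basis v"
  shows "bij_betw (\<lambda>l. restrict (\<lambda>i. l (v i)) {1..m}) functionals (tuples {1..m})"
proof (rule bij_betw_byWitness[where f' = "\<lambda>b x. \<Sum>i=1..m. b i * coordinate v x i"])
  show "\<forall>l\<in>functionals. (\<lambda>x. \<Sum>i=1..m. restrict (\<lambda>i. l (v i)) {1..m} i * coordinate v x i) = l"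
    using functional_coordinates[OF v] by (simp add: fun_eq_iff)
  show "\<forall>b\<in>tuples {1..m}. restrict (\<lambda>j. \<Sum>i=1..m. b i * coordinate v (v j) i) {1..m} = b"
  proof
    fix b :: "nat \<Rightarrow> 'a" assume b: "b \<in> tuples {1..m}"
    have "(\<Sum>i=1..m. b i * coordinate v (v j) i) = b j" if "j \<in> {1..m}" for j
    proof -
      have "(\<Sum>i=1..m. b i * coordinate v (v j) i) = (\<Sum>i=1..m. if i = j then b i else 0)"
        by (rule sum.cong) (use that coordinate_basis[OF v] in auto)
      then show ?thesis using that by simp
    qed
    then show "restrict (\<lambda>j. \<Sum>i=1..m. b i * coordinate v (v j) i) {1..m} = b"
      using b by (auto simp: fun_eq_iff PiE_def extensional_def restrict_def)
  qed
  show "(\<lambda>b x. \<Sum>i=1..m. b i * coordinate v x i) ` tuples {1..m} \<subseteq> functionals"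
    using coordinate_linear[OF v]
    by (auto simp: functionals_def linear_functional_iff sum.distrib sum_distrib_left algebra_simps)
qed auto

lemma finite_functionals: "finite functionals"
proof -
  obtain v where "ordered_basis v" using exists_ordered_basis by blast
  from bij_betw_finite[OF bij_functionals[OF this]] show ?thesis by (simp add: finite_tuples)
qed

lemma card_functionals: "card functionals = CARD('a) ^ m"
proof -
  obtain v where "ordered_basis v" using exists_ordered_basis by blast
  from bij_betw_same_card[OF bij_functionals[OF this]] show ?thesis by (simp add: card_tuples)
qed

lemma functional_zero:
  assumes "l \<in> functionals"
  shows "l 0 = 0"
proof -
  have "l (0 *s 0) = 0 * l 0" using assms unfolding functionals_def linear_functional_iff by blast
  then show ?thesis by simp
qed

lemma functionals_closed:
  "(\<lambda>_. 0) \<in> functionals"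
  "l \<in> functionals \<Longrightarrow> k \<in> functionals \<Longrightarrow> (\<lambda>x. l x + k x) \<in> functionals"
  "l \<in> functionals \<Longrightarrow> k \<in> functionals \<Longrightarrow> (\<lambda>x. l x - k x) \<in> functionals"
  "l \<in> functionals \<Longrightarrow> (\<lambda>x. c * l x) \<in> functionals"
  by (auto simp: functionals_def linear_functional_iff algebra_simps)

lemma functional_scale: "l \<in> functionals \<Longrightarrow> l (c *s x) = c * l x"
  by (simp add: functionals_def linear_functional_iff)

lemma functional_diff:
  assumes "l \<in> functionals"
  shows "l (x - y) = l x - l y"
proof -
  have "l (x - y + y) = l (x - y) + l y"
    using assms unfolding functionals_def linear_functional_iff by blast
  then show ?thesis by simp
qed

lemma exists_dual_functional:
  assumes "independent B" "x \<in> B"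
  shows "\<exists>l\<in>functionals. l x = 1 \<and> (\<forall>y\<in>B. y \<noteq> x \<longrightarrow> l y = 0)"
proof (intro bexI conjI ballI impI)
  let ?E = "extend_basis B"
  have E: "B \<subseteq> ?E" "independent ?E" "span ?E = UNIV"
    using extend_basis_superset[OF assms(1)] independent_extend_basis[OF assms(1)]
      span_extend_basis[OF assms(1)] by auto
  let ?l = "\<lambda>z. representation ?E z x"
  show "?l \<in> functionals"
    by (simp add: functionals_def linear_functional_iff representation_add representation_scale E)
  show "?l x = 1" using E assms by (subst representation_basis) auto
  show "?l y = 0" if "y \<in> B" "y \<noteq> x" for y using E assms that by (subst representation_basis) auto
qed

text \<open>\<open>E\<close> stands for evaluation at one or two vectors; the assumption is the part
  of linearity that is needed. All nonempty fibres are cosets of one kernel and so have equal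
  size.\<close>

lemma card_functionals_fibre:
  assumes E: "\<And>l k. l \<in> functionals \<Longrightarrow> k \<in> functionals \<Longrightarrow> E l = E k \<longleftrightarrow> E (\<lambda>x. l x - k x) = E (\<lambda>_. 0)"
    and k: "k \<in> functionals"
  shows "card (E ` functionals) * card {l \<in> functionals. E l = E k} = CARD('a) ^ m"
proof -
  have fib: "card {l \<in> functionals. E l = E k} = card {l \<in> functionals. E l = E (\<lambda>_. 0)}"
    if k: "k \<in> functionals" for k
  proof -
    have add: "E (\<lambda>x. l x + k x) = E k \<longleftrightarrow> E l = E (\<lambda>_. 0)" if "l \<in> functionals" for l
      using E[OF functionals_closed(2)[OF that k] k] by simp
    have diff: "E (\<lambda>x. l x - k x) = E (\<lambda>_. 0)" if "l \<in> functionals" "E l = E k" for l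
      using E[OF that(1) k] that(2) by blast
    have "bij_betw (\<lambda>l x. l x - k x) {l \<in> functionals. E l = E k} {l \<in> functionals. E l = E (\<lambda>_. 0)}"
      by (intro bij_betw_byWitness[where f' = "\<lambda>l x. l x + k x"])
        (auto simp: add diff functionals_closed k)
    then show ?thesis by (rule bij_betw_same_card)
  qed
  have "CARD('a) ^ m = card (\<Union>c\<in>E ` functionals. {l \<in> functionals. E l = c})"
    unfolding card_functionals[symmetric] by (rule arg_cong[where f = card]) auto
  also have "\<dots> = (\<Sum>c\<in>E ` functionals. card {l \<in> functionals. E l = c})"
    by (rule card_UN_disjoint) (auto simp: finite_functionals)
  also have "\<dots> = (\<Sum>c\<in>E ` functionals. card {l \<in> functionals. E l = E k})"
    by (rule sum.cong) (use fib[OF k] fib in auto)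
  finally show ?thesis by simp
qed

lemma card_functionals_value:
  assumes "x \<noteq> 0"
  shows "real (card {l \<in> functionals. l x = a}) = real CARD('a) ^ m / real CARD('a)"
proof -
  have "independent {x}" using assms by (simp add: dependent_single)
  then obtain l0 where l0: "l0 \<in> functionals" "l0 x = 1" using exists_dual_functional by blast
  have im: "(\<lambda>y. y * l0 x) ` UNIV \<subseteq> (\<lambda>l. l x) ` functionals"
    using functionals_closed(4)[OF l0(1)] by (auto intro: rev_image_eqI)
  then have "(\<lambda>l. l x) ` functionals = UNIV" using l0(2) by auto
  moreover from this obtain k where "k \<in> functionals" "k x = a" by (metis UNIV_I imageE)
  ultimately have "CARD('a) * card {l \<in> functionals. l x = a} = CARD('a) ^ m"
    using card_functionals_fibre[of "\<lambda>l. l x" k] by simp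
  then have "real CARD('a) * real (card {l \<in> functionals. l x = a}) = real CARD('a) ^ m"
    by (simp only: of_nat_mult[symmetric] of_nat_power[symmetric] of_nat_eq_iff)
  then show ?thesis by (simp add: nonzero_eq_divide_eq mult.commute)
qed

lemma card_functionals_values:
  assumes "x \<noteq> 0" "y \<notin> range (\<lambda>t. t *s x)"
  shows "real (card {l \<in> functionals. l x = a \<and> l y = b}) = real CARD('a) ^ m / real CARD('a) ^ 2"
proof -
  have "y \<notin> span {x}" using assms(2) by (simp add: span_singleton)
  then have ne: "x \<noteq> y" and "independent {y, x}"
    using assms(1) independent_insert[of y "{x}"] by (auto simp: dependent_single span_base)
  then have ind: "independent {x, y}" by (simp add: insert_commute)
  obtain l1 where l1: "l1 \<in> functionals" "l1 x = 1" "l1 y = 0"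
    using exists_dual_functional[OF ind, of x] ne by auto
  obtain l2 where l2: "l2 \<in> functionals" "l2 y = 1" "l2 x = 0"
    using exists_dual_functional[OF ind, of y] ne by auto
  have ex: "\<exists>l\<in>functionals. l x = c \<and> l y = d" for c d
    by (rule bexI[of _ "\<lambda>z. c * l1 z + d * l2 z"]) (use l1 l2 functionals_closed in auto)
  then have im: "(\<lambda>l. (l x, l y)) ` functionals = UNIV"
    by (intro UNIV_eq_I[symmetric]) (auto simp: image_iff Bex_def split_paired_all, metis)
  obtain k where "k \<in> functionals" "k x = a" "k y = b" using ex by blast
  then have "(CARD('a) * CARD('a)) * card {l \<in> functionals. l x = a \<and> l y = b} = CARD('a) ^ m"
    using card_functionals_fibre[of "\<lambda>l. (l x, l y)" k] im by (simp add: card_prod)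
  then have "real CARD('a) ^ 2 * real (card {l \<in> functionals. l x = a \<and> l y = b}) = real CARD('a) ^ m"
    by (simp only: power2_eq_square of_nat_mult[symmetric] of_nat_power[symmetric] of_nat_eq_iff)
  then show ?thesis by (simp add: nonzero_eq_divide_eq mult.commute)
qed

section \<open>Double counting\<close>

lemma real_card_eq_sum: "finite A \<Longrightarrow> real (card {x \<in> A. P x}) = (\<Sum>x\<in>A. of_bool (P x))"
  by (simp add: of_bool_def sum.If_cases Int_def)

lemma sum_card_swap:
  assumes "finite A" "finite B"
  shows "(\<Sum>x\<in>A. real (card {y \<in> B. P x y})) = (\<Sum>y\<in>B. real (card {x \<in> A. P x y}))"
  unfolding real_card_eq_sum[OF assms(1)] real_card_eq_sum[OF assms(2)] by (rule sum.swap)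

text \<open>The square of a count is a count of ordered pairs, so second moments reduce to joint
  conditions on two points.\<close>

lemma sum_card_square_swap:
  assumes "finite A" "finite B"
  shows "(\<Sum>x\<in>A. real (card {y \<in> B. P x y}) ^ 2)
    = (\<Sum>y\<in>B. \<Sum>z\<in>B. real (card {x \<in> A. P x y \<and> P x z}))"
proof -
  have "(\<Sum>x\<in>A. real (card {y \<in> B. P x y}) ^ 2)
      = (\<Sum>x\<in>A. \<Sum>y\<in>B. \<Sum>z\<in>B. of_bool (P x y \<and> P x z))"
    unfolding real_card_eq_sum[OF assms(2)] by (simp only: power2_eq_square sum_product of_bool_conj)
  also have "\<dots> = (\<Sum>y\<in>B. \<Sum>x\<in>A. \<Sum>z\<in>B. of_bool (P x y \<and> P x z))" by (rule sum.swap)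
  also have "\<dots> = (\<Sum>y\<in>B. \<Sum>z\<in>B. \<Sum>x\<in>A. of_bool (P x y \<and> P x z))"
    by (intro sum.cong refl sum.swap)
  finally show ?thesis unfolding real_card_eq_sum[OF assms(1)] .
qed

text \<open>The zero vector is included in the count, although it is not a coordinate of the code;
  \<open>hamming_weight_coset\<close> makes up for it.\<close>

definition coset_deviation :: "('b \<Rightarrow> 'a) \<Rightarrow> ('b \<Rightarrow> 'a) \<Rightarrow> 'a \<Rightarrow> real" where
  "coset_deviation Q l c = real (card {x. Q x + l x + c = 0}) - real CARD('a) ^ m / real CARD('a)"

lemma sum_space_split:
  "(\<Sum>x\<in>UNIV. if x = (x0::'b) then a else b) = a + (real CARD('a) ^ m - 1) * (b::real)"
proof -
  have "(\<Sum>x\<in>UNIV. if x = x0 then a else b) = a + (\<Sum>x\<in>UNIV - {x0}. b)"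
    by (subst sum.remove[of _ x0]) (auto simp: finite_space)
  also have "(\<Sum>x\<in>UNIV - {x0}. b) = (real CARD('a) ^ m - 1) * b"
    using card_space finite_space by (simp add: card_Diff_singleton of_nat_diff)
  finally show ?thesis .
qed

context
  fixes Q :: "'b \<Rightarrow> 'a"
  assumes Q: "quadratic_form Q"
begin

text \<open>The point 0 is a zero for every \<open>l\<close>, any other point for a fraction
  \<open>1 / q\<close> of them, whatever \<open>Q\<close> is.\<close>

lemma first_moment_linear:
  "(\<Sum>l\<in>functionals. coset_deviation Q l 0) = real CARD('a) ^ m - real CARD('a) ^ m / real CARD('a)"
proof -
  have "(\<Sum>l\<in>functionals. real (card {x \<in> UNIV. Q x + l x = 0}))
      = (\<Sum>x\<in>UNIV. real (card {l \<in> functionals. Q x + l x = 0}))"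
    by (rule sum_card_swap[OF finite_functionals finite_space])
  also have "\<dots> = (\<Sum>x\<in>(UNIV :: 'b set). if x = 0 then real CARD('a) ^ m else real CARD('a) ^ m / real CARD('a))"
  proof (rule sum.cong)
    fix x :: 'b
    have "{l \<in> functionals. Q x + l x = 0} = {l \<in> functionals. l x = - Q x}"
      by (auto simp: add_eq_0_iff)
    moreover have "{l \<in> functionals. l 0 = - Q 0} = functionals"
      by (auto simp: functional_zero form_zero[OF Q])
    ultimately show "real (card {l \<in> functionals. Q x + l x = 0})
        = (if x = 0 then real CARD('a) ^ m else real CARD('a) ^ m / real CARD('a))"
      by (auto simp: card_functionals card_functionals_value)
  qed simp
  also have "\<dots> = real CARD('a) ^ m + (real CARD('a) ^ m - 1) * (real CARD('a) ^ m / real CARD('a))" by (rule sum_space_split)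
  finally have "(\<Sum>l\<in>functionals. real (card {x \<in> UNIV. Q x + l x = 0}))
    = real CARD('a) ^ m + (real CARD('a) ^ m - 1) * (real CARD('a) ^ m / real CARD('a))" .
  moreover have "(\<Sum>l\<in>functionals. coset_deviation Q l 0)
    = (\<Sum>l\<in>functionals. real (card {x \<in> UNIV. Q x + l x = 0}))
      - real CARD('a) ^ m * (real CARD('a) ^ m / real CARD('a))"
    by (simp add: coset_deviation_def sum_subtractf card_functionals)
  ultimately show ?thesis by (simp add: left_diff_distrib diff_divide_distrib)
qed

text \<open>For \<open>y\<close> off the line through a nonzero \<open>x\<close> the two conditions
  on \<open>l\<close> are independent. On the line they are compatible for every multiple if
  \<open>Q x = 0\<close>, but only for \<open>y = 0\<close> and \<open>y = x\<close> otherwise.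
  Hence the number of zeros of \<open>Q\<close> is all that enters.\<close>

lemma second_moment_linear:
  "(\<Sum>l\<in>functionals. coset_deviation Q l 0 ^ 2)
    = (real CARD('a) ^ m / real CARD('a)) ^ 2 + real CARD('a) ^ m / real CARD('a) * (real CARD('a) - 2) * real (card {x. Q x = 0})"
proof -
  let ?n = "real CARD('a) ^ m" and ?N = "\<lambda>l. real (card {x \<in> UNIV. Q x + l x = 0})"
  let ?K = "\<lambda>x y. real (card {l \<in> functionals. Q x + l x = 0 \<and> Q y + l y = 0})"
  have eq: "{l \<in> functionals. Q x + l x = 0 \<and> Q y + l y = 0} = {l \<in> functionals. l x = - Q x \<and> l y = - Q y}"
    for x y by (auto simp: add_eq_0_iff)
  have row0: "(\<Sum>y\<in>UNIV. ?K 0 y) = ?n + (?n - 1) * (?n / real CARD('a))"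
  proof -
    have "?K 0 y = (if y = 0 then ?n else ?n / real CARD('a))" for y
    proof -
      have "{l \<in> functionals. l 0 = - Q 0 \<and> l y = - Q y} = {l \<in> functionals. l y = - Q y}"
        by (auto simp: functional_zero form_zero[OF Q])
      moreover have "{l \<in> functionals. l 0 = - Q 0} = functionals"
        by (auto simp: functional_zero form_zero[OF Q])
      ultimately show ?thesis unfolding eq
        by (auto simp: card_functionals card_functionals_value)
    qed
    then show ?thesis using sum_space_split[of 0] by simp
  qed
  have row: "(\<Sum>y\<in>UNIV. ?K x y) = (?n - real CARD('a)) * (?n / real CARD('a) ^ 2) + (if Q x = 0 then ?n else 2 * (?n / real CARD('a)))"
    if x: "x \<noteq> 0" for x
  proof -
    let ?L = "range (\<lambda>t. t *s x)"
    have inj: "inj (\<lambda>t. t *s x)" using x by (auto intro: injI)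
    have cardL: "card ?L = CARD('a)" using card_image[OF inj] by simp
    have "(\<Sum>y\<in>UNIV. ?K x y) = (\<Sum>y\<in>UNIV - ?L. ?K x y) + (\<Sum>y\<in>?L. ?K x y)"
      by (rule sum.subset_diff) (auto simp: finite_space)
    also have "(\<Sum>y\<in>UNIV - ?L. ?K x y) = (\<Sum>y\<in>UNIV - ?L. ?n / real CARD('a) ^ 2)"
      by (rule sum.cong) (use x card_functionals_values in \<open>simp_all add: eq\<close>)
    also have "\<dots> = (?n - real CARD('a)) * (?n / real CARD('a) ^ 2)"
    proof -
      have "card ?L \<le> CARD('b)" by (rule card_mono) (auto simp: finite_space)
      then have "real (card (UNIV - ?L)) = ?n - real CARD('a)"
        using cardL card_space by (subst card_Diff_subset) (auto simp: of_nat_diff)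
      then show ?thesis by simp
    qed
    also have "(\<Sum>y\<in>?L. ?K x y) = (\<Sum>t\<in>UNIV. ?K x (t *s x))" by (rule sum.reindex[OF inj, unfolded o_def])
    also have "\<dots> = (\<Sum>t\<in>(UNIV :: 'a set). if Q x = 0 \<or> t \<in> {0, 1} then ?n / real CARD('a) else 0)"
    proof (rule sum.cong)
      fix t :: 'a
      \<comment> \<open>At \<open>y = t *s x\<close> the left side scales by \<open>t\<close> and
        the right side by \<open>t^2\<close>, so compatibility means
        \<open>t * (t - 1) * Q x = 0\<close>.\<close>
      have "{l \<in> functionals. l x = - Q x \<and> l (t *s x) = - Q (t *s x)}
          = {l \<in> functionals. l x = - Q x \<and> t * (t - 1) * Q x = 0}"
        by (auto simp: functional_scale functional_zero form_scale[OF Q] power2_eq_square algebra_simps)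
      then show "?K x (t *s x) = (if Q x = 0 \<or> t \<in> {0, 1} then ?n / real CARD('a) else 0)"
        unfolding eq using x by (auto simp: card_functionals_value)
    qed simp
    also have "\<dots> = (if Q x = 0 then ?n else 2 * (?n / real CARD('a)))"
    proof (cases "Q x = 0")
      case False
      have "{t. t = 0 \<or> t = (1::'a)} = {0, 1}" by auto
      then have "card {t. t = 0 \<or> t = (1::'a)} = 2" by simp
      then show ?thesis using False by (simp add: sum.If_cases)
    qed simp
    finally show ?thesis .
  qed
  have N0: "real (card {x. x \<noteq> 0 \<and> Q x = 0}) = real (card {x. Q x = 0}) - 1"
  proof -
    have "{x. Q x = 0} = insert 0 {x. x \<noteq> 0 \<and> Q x = 0}" by (auto simp: form_zero[OF Q])
    moreover have "finite {x. x \<noteq> 0 \<and> Q x = 0}" by (rule finite_subset[OF subset_UNIV finite_space])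
    ultimately show ?thesis by simp
  qed
  have "(\<Sum>l\<in>functionals. ?N l ^ 2) = (\<Sum>x\<in>UNIV. \<Sum>y\<in>UNIV. ?K x y)"
    by (rule sum_card_square_swap[OF finite_functionals finite_space])
  also have "\<dots> = (\<Sum>y\<in>UNIV. ?K 0 y) + (\<Sum>x\<in>UNIV - {0}. \<Sum>y\<in>UNIV. ?K x y)"
    by (rule sum.remove[OF finite_space]) simp
  \<comment> \<open>The generic row sum plus a correction on the zeros of \<open>Q\<close>, so that
    the correction is counted by \<open>of_bool\<close>.\<close>
  also have "(\<Sum>x\<in>UNIV - {0}. \<Sum>y\<in>UNIV. ?K x y)
      = (\<Sum>x\<in>UNIV - {0}. (?n - real CARD('a)) * (?n / real CARD('a) ^ 2) + 2 * (?n / real CARD('a))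
          + (?n - 2 * (?n / real CARD('a))) * of_bool (Q x = 0))"
    by (rule sum.cong) (auto simp: row)
  also have "\<dots> = (?n - 1) * ((?n - real CARD('a)) * (?n / real CARD('a) ^ 2) + 2 * (?n / real CARD('a)))
      + (?n - 2 * (?n / real CARD('a))) * (real (card {x. Q x = 0}) - 1)"
  proof -
    have "(\<Sum>x\<in>UNIV - {0::'b}. of_bool (Q x = 0)) = real (card {x \<in> UNIV - {0}. Q x = 0})"
      by (rule real_card_eq_sum[symmetric]) (simp add: finite_space)
    also have "{x \<in> UNIV - {0}. Q x = 0} = {x. x \<noteq> 0 \<and> Q x = 0}" by auto
    finally have "(\<Sum>x\<in>UNIV - {0::'b}. of_bool (Q x = 0)) = real (card {x. Q x = 0}) - 1" unfolding N0 .
    moreover have "real (card (UNIV - {0::'b})) = ?n - 1"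
      using card_space finite_space by (simp add: card_Diff_singleton of_nat_diff)
    ultimately show ?thesis by (simp add: sum.distrib flip: sum_distrib_left)
  qed
  finally have sq: "(\<Sum>l\<in>functionals. ?N l ^ 2) = ?n + (?n - 1) * (?n / real CARD('a))
      + ((?n - 1) * ((?n - real CARD('a)) * (?n / real CARD('a) ^ 2) + 2 * (?n / real CARD('a)))
      + (?n - 2 * (?n / real CARD('a))) * (real (card {x. Q x = 0}) - 1))" unfolding row0 .
  have "(\<Sum>l\<in>functionals. ?N l - ?n / real CARD('a)) = ?n - ?n / real CARD('a)"
    using first_moment_linear by (simp add: coset_deviation_def)
  then have lin: "(\<Sum>l\<in>functionals. ?N l) = ?n - ?n / real CARD('a) + ?n * (?n / real CARD('a))"
    by (simp add: sum_subtractf card_functionals)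
  have "(\<Sum>l\<in>functionals. coset_deviation Q l 0 ^ 2)
      = (\<Sum>l\<in>functionals. ?N l ^ 2 - 2 * (?n / real CARD('a)) * ?N l + (?n / real CARD('a)) ^ 2)"
    by (rule sum.cong) (simp_all add: coset_deviation_def power2_eq_square algebra_simps)
  also have "\<dots> = (\<Sum>l\<in>functionals. ?N l ^ 2) - 2 * (?n / real CARD('a)) * (\<Sum>l\<in>functionals. ?N l)
      + ?n * (?n / real CARD('a)) ^ 2"
    by (simp add: sum.distrib sum_subtractf sum_distrib_left card_functionals)
  also have "\<dots> = (?n / real CARD('a)) ^ 2 + ?n / real CARD('a) * (real CARD('a) - 2) * real (card {x. Q x = 0})"
    unfolding sq lin by (simp add: field_simps power2_eq_square)
  finally show ?thesis .
qed

text \<open>For fixed \<open>l\<close> every point is a zero for exactly one constant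
  \<open>c\<close>.\<close>

lemma first_moment_affine:
  "(\<Sum>l\<in>functionals. \<Sum>c\<in>UNIV. coset_deviation Q l c) = 0"
proof -
  have "(\<Sum>c\<in>UNIV. real (card {x \<in> UNIV. Q x + l x + c = 0})) = real CARD('a) ^ m" for l
  proof -
    have "(\<Sum>c\<in>UNIV. real (card {x \<in> UNIV. Q x + l x + c = 0}))
        = (\<Sum>x\<in>UNIV. real (card {c \<in> UNIV. Q x + l x + c = 0}))"
      by (rule sum_card_swap[OF _ finite_space]) simp
    also have "\<dots> = (\<Sum>x\<in>(UNIV :: 'b set). 1)"
      by (rule sum.cong) (simp_all add: add_eq_0_iff)
    finally show ?thesis by (simp add: card_space)
  qed
  then show ?thesis by (simp add: coset_deviation_def sum_subtractf)
qed

text \<open>Two distinct points determine \<open>c\<close> and leave one condition on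
  \<open>l (x - y)\<close>, with \<open>x - y\<close> nonzero; so \<open>Q\<close> drops out
  entirely.\<close>

lemma second_moment_affine:
  "(\<Sum>l\<in>functionals. \<Sum>c\<in>UNIV. coset_deviation Q l c ^ 2) = (real CARD('a) ^ m) ^ 2 * (real CARD('a) - 1) / real CARD('a)"
proof -
  let ?n = "real CARD('a) ^ m" and ?N = "\<lambda>p. real (card {x \<in> UNIV. Q x + fst p x + snd p = 0})"
  let ?A = "functionals \<times> (UNIV :: 'a set)"
  have fin: "finite ?A" by (simp add: finite_functionals)
  have cardA: "real (card ?A) = ?n * real CARD('a)" by (simp add: card_cartesian_product card_functionals)
  have "(\<Sum>p\<in>?A. ?N p ^ 2)
      = (\<Sum>x\<in>UNIV. \<Sum>y\<in>UNIV. real (card {p \<in> ?A. Q x + fst p x + snd p = 0 \<and> Q y + fst p y + snd p = 0}))"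
    by (rule sum_card_square_swap[OF fin finite_space])
  also have "\<dots> = (\<Sum>x\<in>(UNIV :: 'b set). \<Sum>y\<in>UNIV. if y = x then ?n else ?n / real CARD('a))"
  proof (intro sum.cong refl)
    fix x y :: 'b
    have "bij_betw fst {p \<in> ?A. Q x + fst p x + snd p = 0 \<and> Q y + fst p y + snd p = 0}
        {l \<in> functionals. l (x - y) = Q y - Q x}"
      by (rule bij_betw_byWitness[where f' = "\<lambda>l. (l, - (Q x + l x))"])
        (auto simp: functional_diff add_eq_0_iff algebra_simps)
    then have "card {p \<in> ?A. Q x + fst p x + snd p = 0 \<and> Q y + fst p y + snd p = 0}
        = card {l \<in> functionals. l (x - y) = Q y - Q x}" by (rule bij_betw_same_card)
    moreover have "{l \<in> functionals. l (x - x) = Q x - Q x} = functionals" by (auto simp: functional_zero)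
    ultimately show "real (card {p \<in> ?A. Q x + fst p x + snd p = 0 \<and> Q y + fst p y + snd p = 0})
        = (if y = x then ?n else ?n / real CARD('a))"
      using card_functionals_value[of "x - y"] by (auto simp: card_functionals)
  qed
  also have "\<dots> = ?n * (?n + (?n - 1) * (?n / real CARD('a)))" unfolding sum_space_split by (simp add: card_space)
  finally have sq: "(\<Sum>p\<in>?A. ?N p ^ 2) = ?n * (?n + (?n - 1) * (?n / real CARD('a)))" .
  have "(\<Sum>p\<in>?A. ?N p - ?n / real CARD('a)) = 0"
    using first_moment_affine by (simp add: coset_deviation_def sum.cartesian_product split_def)
  then have lin: "(\<Sum>p\<in>?A. ?N p) = ?n * ?n" using cardA by (simp add: sum_subtractf)
  have "(\<Sum>l\<in>functionals. \<Sum>c\<in>UNIV. coset_deviation Q l c ^ 2)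
      = (\<Sum>p\<in>?A. ?N p ^ 2 - 2 * (?n / real CARD('a)) * ?N p + (?n / real CARD('a)) ^ 2)"
    unfolding sum.cartesian_product
    by (rule sum.cong) (auto simp: coset_deviation_def power2_eq_square algebra_simps)
  also have "\<dots> = (\<Sum>p\<in>?A. ?N p ^ 2) - 2 * (?n / real CARD('a)) * (\<Sum>p\<in>?A. ?N p)
      + ?n * real CARD('a) * (?n / real CARD('a)) ^ 2"
    unfolding sum.distrib sum_subtractf sum_distrib_left[symmetric] using cardA by simp
  also have "\<dots> = ?n ^ 2 * (real CARD('a) - 1) / real CARD('a)"
    unfolding sq lin by (simp add: field_simps power2_eq_square)
  finally show ?thesis .
qed

end

end

section \<open>Weight enumerators of cosets\<close>

text \<open>The first two moments give a Vandermonde system for the frequencies of \<open>p\<close>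
  and \<open>r\<close>; the total size then settles the value 0. The function \<open>h\<close> turns
  a value into an exponent.\<close>

lemma three_value_cards:
  fixes f :: "'x \<Rightarrow> real"
  assumes fin: "finite X" and vals: "\<And>x. x \<in> X \<Longrightarrow> f x \<in> {0, p, r}"
    and pr: "p \<noteq> 0" "r \<noteq> 0" "p \<noteq> r"
  shows "real (card {x \<in> X. f x = p}) = ((\<Sum>x\<in>X. f x ^ 2) - r * (\<Sum>x\<in>X. f x)) / (p * (p - r))"
    and "real (card {x \<in> X. f x = r}) = ((\<Sum>x\<in>X. f x ^ 2) - p * (\<Sum>x\<in>X. f x)) / (r * (r - p))"
    and "real (card {x \<in> X. f x = 0}) = real (card X) - real (card {x \<in> X. f x = p})
      - real (card {x \<in> X. f x = r})"
    and "(\<Sum>x\<in>X. monom 1 (h (f x))) = monom (real (card {x \<in> X. f x = p})) (h p)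
      + monom (real (card {x \<in> X. f x = r})) (h r) + monom (real (card {x \<in> X. f x = 0})) (h 0)"
proof -
  \<comment> \<open>Over an arbitrary commutative ring, since it is applied to real moments and to
    polynomials.\<close>
  have split: "(\<Sum>x\<in>X. g (f x)) = of_nat (card {x \<in> X. f x = p}) * g p
      + of_nat (card {x \<in> X. f x = r}) * g r + of_nat (card {x \<in> X. f x = 0}) * g 0"
    for g :: "real \<Rightarrow> 'c::comm_ring_1"
  proof -
    have "X = {x \<in> X. f x = p} \<union> {x \<in> X. f x = r} \<union> {x \<in> X. f x = 0}" using vals by auto
    then have "(\<Sum>x\<in>X. g (f x)) = (\<Sum>x\<in>{x \<in> X. f x = p} \<union> {x \<in> X. f x = r} \<union> {x \<in> X. f x = 0}. g (f x))"
      by simp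
    also have "\<dots> = (\<Sum>x\<in>{x \<in> X. f x = p}. g (f x)) + (\<Sum>x\<in>{x \<in> X. f x = r}. g (f x))
        + (\<Sum>x\<in>{x \<in> X. f x = 0}. g (f x))"
      using fin pr by (subst sum.union_disjoint, simp, simp, force, subst sum.union_disjoint) auto
    also have "\<dots> = (\<Sum>x\<in>{x \<in> X. f x = p}. g p) + (\<Sum>x\<in>{x \<in> X. f x = r}. g r)
        + (\<Sum>x\<in>{x \<in> X. f x = 0}. g 0)"
      by (intro arg_cong2[where f = "(+)"] sum.cong) auto
    finally show ?thesis by simp
  qed
  let ?P = "real (card {x \<in> X. f x = p})" and ?R = "real (card {x \<in> X. f x = r})"
  have m1: "(\<Sum>x\<in>X. f x) = ?P * p + ?R * r" using split[of "\<lambda>x. x"] by simp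
  have m2: "(\<Sum>x\<in>X. f x ^ 2) = ?P * p ^ 2 + ?R * r ^ 2" using split[of "\<lambda>x. x ^ 2"] by simp
  have "(\<Sum>x\<in>X. f x ^ 2) - r * (\<Sum>x\<in>X. f x) = ?P * (p * (p - r))"
    unfolding m1 m2 by (simp add: power2_eq_square algebra_simps)
  then show "?P = ((\<Sum>x\<in>X. f x ^ 2) - r * (\<Sum>x\<in>X. f x)) / (p * (p - r))" using pr by simp
  have "(\<Sum>x\<in>X. f x ^ 2) - p * (\<Sum>x\<in>X. f x) = ?R * (r * (r - p))"
    unfolding m1 m2 by (simp add: power2_eq_square algebra_simps)
  then show "?R = ((\<Sum>x\<in>X. f x ^ 2) - p * (\<Sum>x\<in>X. f x)) / (r * (r - p))" using pr by simp
  show "real (card {x \<in> X. f x = 0}) = real (card X) - ?P - ?R" using split[of "\<lambda>_. 1::real"] by simp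
  have "of_nat k * monom 1 w = monom (real k) w" for k w
    by (simp add: of_nat_poly smult_monom)
  then show "(\<Sum>x\<in>X. monom 1 (h (f x))) = monom ?P (h p) + monom ?R (h r)
      + monom (real (card {x \<in> X. f x = 0})) (h 0)"
    using split[of "\<lambda>x. monom 1 (h x) :: real poly"] by simp
qed

context quadratic_space
begin

lemma coset_deviation_eq:
  "coset_deviation Q l c = deviation UNIV (\<lambda>x. Q x + l x) (- c)"
  by (simp add: coset_deviation_def deviation_def card_space eq_neg_iff_add_eq_0)

lemma coordinate_form_deviation:
  assumes v: "ordered_basis v" and l: "l \<in> functionals"
    and P: "\<And>x. P (restrict (coordinate v x) {1..m}) = Q x"
  shows "deviation UNIV (\<lambda>x. Q x + l x) d
    = deviation (tuples {1..m}) (\<lambda>c. P c + (\<Sum>j=1..m. l (v j) * c j)) d"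
proof (rule deviation_bij[OF bij_coordinates[OF v]])
  fix x
  show "Q x + l x = P (restrict (coordinate v x) {1..m})
      + (\<Sum>j=1..m. l (v j) * restrict (coordinate v x) {1..m} j)"
    using functional_coordinates[OF v l, of x] unfolding P by simp
qed

text \<open>A bias of 0 or \<open>B\<close> is multiplied by a value of \<open>spike\<close>, which
  is \<open>q - 1\<close> or \<open>- 1\<close>. Without linear part and constant the exceptional
  value is 0 itself, which yields \<open>(q - 1) * B\<close>.\<close>

lemma even_coset_deviation:
  assumes v: "ordered_basis v" and s: "2 * s \<le> m"
    and lam: "even CARD('a) \<Longrightarrow> \<nexists>t. t ^ 2 + t = lam"
    and eta: "odd CARD('a) \<Longrightarrow> nonsquare eta"
    and Q: "Q = hyperbolic_form v s \<and> \<tau> = 1 \<or> Q = elliptic_form lam eta v s \<and> s \<ge> 1 \<and> \<tau> = - 1"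
  defines "B \<equiv> \<tau> * (real CARD('a) ^ (m - s) / real CARD('a))"
  shows "l \<in> functionals \<Longrightarrow> coset_deviation Q l c \<in> {0, (real CARD('a) - 1) * B, - B}"
    and "coset_deviation Q (\<lambda>_. 0) 0 = (real CARD('a) - 1) * B"
proof -
  have main: "\<exists>\<beta> k. \<beta> \<in> {0, B} \<and> ((\<forall>x. l x = 0) \<longrightarrow> \<beta> = B \<and> k = 0) \<and>
      (\<forall>d. deviation UNIV (\<lambda>x. Q x + l x) d = \<beta> * spike (d - k))" if l: "l \<in> functionals" for l
    using Q
  proof (elim disjE conjE)
    assume hyp: "Q = hyperbolic_form v s" and \<tau>: "\<tau> = 1"
    have "deviation UNIV (\<lambda>x. Q x + l x) d
      = deviation (tuples {1..m}) (\<lambda>c. (\<Sum>i=1..s. c (2*i-1) * c (2*i)) + (\<Sum>j=1..m. l (v j) * c j)) d" for d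
      by (rule coordinate_form_deviation[OF v l])
        (use s in \<open>auto simp: hyp hyperbolic_form_def intro!: sum.cong\<close>)
    moreover have "B = real CARD('a) ^ (m - s) / real CARD('a)" by (simp add: B_def \<tau>)
    moreover obtain \<beta> k where "\<beta> \<in> {0, real CARD('a) ^ (m - s) / real CARD('a)}"
      "(\<forall>j. l (v j) = 0) \<longrightarrow> \<beta> = real CARD('a) ^ (m - s) / real CARD('a) \<and> k = 0"
      "\<And>d. deviation (tuples {1..m}) (\<lambda>c. (\<Sum>i=1..s. c (2*i-1) * c (2*i))
          + (\<Sum>j=1..m. l (v j) * c j)) d = \<beta> * spike (d - k)"
      using biased_hyperbolic[OF s, of "\<lambda>j. l (v j)"] unfolding biased_def by blast
    ultimately show ?thesis by (intro exI[of _ \<beta>] exI[of _ k]) simp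
  next
    assume ell: "Q = elliptic_form lam eta v s" and s1: "s \<ge> 1" and \<tau>: "\<tau> = - 1"
    have "deviation UNIV (\<lambda>x. Q x + l x) d
      = deviation (tuples {1..m}) (\<lambda>c. (\<Sum>i=1..s-1. c (2*i-1) * c (2*i))
          + elliptic_plane lam eta (c (2 * s-1)) (c (2 * s)) + (\<Sum>j=1..m. l (v j) * c j)) d" for d
      by (rule coordinate_form_deviation[OF v l])
        (use s s1 in \<open>auto simp: ell elliptic_form_alt intro!: sum.cong\<close>)
    moreover have "B = - (real CARD('a) ^ (m - s) / real CARD('a))" by (simp add: B_def \<tau>)
    moreover obtain \<beta> k where "\<beta> \<in> {0, - (real CARD('a) ^ (m - s) / real CARD('a))}"
      "(\<forall>j. l (v j) = 0) \<longrightarrow> \<beta> = - (real CARD('a) ^ (m - s) / real CARD('a)) \<and> k = 0"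
      "\<And>d. deviation (tuples {1..m}) (\<lambda>c. (\<Sum>i=1..s-1. c (2*i-1) * c (2*i))
          + elliptic_plane lam eta (c (2 * s-1)) (c (2 * s)) + (\<Sum>j=1..m. l (v j) * c j)) d
        = \<beta> * spike (d - k)"
      using biased_elliptic[OF s1 s lam eta, of "\<lambda>j. l (v j)"] unfolding biased_def by blast
    ultimately show ?thesis by (intro exI[of _ \<beta>] exI[of _ k]) simp
  qed
  show "coset_deviation Q l c \<in> {0, (real CARD('a) - 1) * B, - B}" if l: "l \<in> functionals"
  proof -
    obtain \<beta> k where "\<beta> \<in> {0, B}" "\<forall>d. deviation UNIV (\<lambda>x. Q x + l x) d = \<beta> * spike (d - k)"
      using main[OF l] by blast
    then show ?thesis unfolding coset_deviation_eq by (auto simp: spike_def)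
  qed
  obtain \<beta> k where "\<beta> = B \<and> k = 0" "\<forall>d. deviation UNIV (\<lambda>x. Q x + 0) d = \<beta> * spike (d - k)"
    using main[OF functionals_closed(1)] by blast
  then show "coset_deviation Q (\<lambda>_. 0) 0 = (real CARD('a) - 1) * B"
    unfolding coset_deviation_eq by (simp add: spike_def)
qed

lemma parabolic_coset_deviation:
  assumes v: "ordered_basis v" and s: "2 * s + 1 \<le> m" and a: "a \<noteq> 0"
    and Q: "Q = (\<lambda>x. hyperbolic_form v s x + a * coordinate v x (2 * s+1) ^ 2)"
  defines "B \<equiv> real CARD('a) ^ (m - s) / real CARD('a)"
  shows "l \<in> functionals \<Longrightarrow> coset_deviation Q l c \<in> {0, B, - B}"
    and "coset_deviation Q (\<lambda>_. 0) 0 = 0"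
proof -
  let ?P = "\<lambda>c. (\<Sum>i=1..s. c (2*i-1) * c (2*i)) + a * c (2 * s+1) ^ 2"
  have dev: "deviation UNIV (\<lambda>x. Q x + l x) d
    = deviation (tuples {1..m}) (\<lambda>c. ?P c + (\<Sum>j=1..m. l (v j) * c j)) d" if l: "l \<in> functionals" for l d
    by (rule coordinate_form_deviation[OF v l])
      (use s in \<open>auto simp: Q hyperbolic_form_def intro!: sum.cong\<close>)
  show "coset_deviation Q l c \<in> {0, B, - B}" if l: "l \<in> functionals"
    using deviation_parabolic(1)[OF s a, of "\<lambda>j. l (v j)" "- c"]
    unfolding coset_deviation_eq dev[OF l] B_def by auto
  show "coset_deviation Q (\<lambda>_. 0) 0 = 0"
    using deviation_parabolic(2)[OF s a, of "\<lambda>_. 0"]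
    unfolding coset_deviation_eq dev[OF functionals_closed(1)] by simp
qed

text \<open>The function has value \<open>c\<close> at 0, which is not a coordinate, so a nonzero
  \<open>c\<close> costs one: this is the \<open>- 1\<close> in the exponents of
  \<open>omega\<close>. The expression inside the floor is already an integer.\<close>

lemma hamming_weight_coset:
  assumes Q: "quadratic_form Q" and l: "l \<in> functionals"
  shows "hamming_weight (\<lambda>x. Q x + l x + c)
    = nat \<lfloor>real CARD('a) ^ m - real CARD('a) ^ m / real CARD('a) - coset_deviation Q l c
        - of_bool (c \<noteq> 0)\<rfloor>"
proof -
  let ?g = "\<lambda>x. Q x + l x + c"
  have fin: "finite A" for A :: "'b set" by (rule finite_subset[OF subset_UNIV finite_space])
  have "{x \<in> nonzero. ?g x \<noteq> 0} = UNIV - {x. ?g x = 0} - (if c \<noteq> 0 then {0} else {})"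
    by (auto simp: form_zero[OF Q] functional_zero[OF l])
  also have "card \<dots> = card (UNIV - {x. ?g x = 0}) - card (if c \<noteq> 0 then {0 :: 'b} else {})"
    by (rule card_Diff_subset) (auto simp: form_zero[OF Q] functional_zero[OF l])
  finally have w: "hamming_weight ?g = card (UNIV - {x. ?g x = 0}) - of_bool (c \<noteq> 0)"
    by (simp add: hamming_weight_def split: if_splits)
  have le: "of_bool (c \<noteq> 0) \<le> card (UNIV - {x. ?g x = 0})"
  proof (cases "c = 0")
    case False
    then have "0 \<in> UNIV - {x. ?g x = 0}" by (simp add: form_zero[OF Q] functional_zero[OF l])
    then have "card (UNIV - {x. ?g x = 0}) > 0" using fin card_gt_0_iff by blast
    then show ?thesis by simp
  qed simp
  have "card {x. ?g x = 0} \<le> CARD('b)" by (rule card_mono) (auto simp: finite_space)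
  then have c: "real (card (UNIV - {x. ?g x = 0})) = real CARD('a) ^ m - real (card {x. ?g x = 0})"
    using fin card_space by (simp add: card_Diff_subset of_nat_diff)
  have "real (hamming_weight ?g) = real CARD('a) ^ m - real CARD('a) ^ m / real CARD('a)
      - coset_deviation Q l c - of_bool (c \<noteq> 0)"
    unfolding w of_nat_diff[OF le] c coset_deviation_def by simp
  then have "\<lfloor>real CARD('a) ^ m - real CARD('a) ^ m / real CARD('a) - coset_deviation Q l c
        - of_bool (c \<noteq> 0)\<rfloor> = \<lfloor>real (hamming_weight ?g)\<rfloor>" by simp
  then show ?thesis by simp
qed

text \<open>Summed over pairs \<open>(l, c)\<close>, not over words, so that it makes sense before
  injectivity is available.\<close>

definition coset_enumerator :: "('b \<Rightarrow> 'a) \<Rightarrow> real poly" where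
  "coset_enumerator Q = (\<Sum>l\<in>functionals. \<Sum>c\<in>UNIV. monom 1 (hamming_weight (\<lambda>x. Q x + l x + c)))"

text \<open>\<open>n0\<close> is the mean and \<open>N\<close> the actual number of zeros of
  \<open>Q\<close>. The counts \<open>kp\<close> and \<open>kr\<close> belong to
  \<open>c = 0\<close>, while \<open>tp\<close> and \<open>tr\<close> belong to all pairs, where the
  first moment is 0; the differences belong to nonzero \<open>c\<close>.\<close>

lemma coset_enumerator_three_values:
  assumes Q: "quadratic_form Q"
    and dev_vals: "\<forall>l\<in>functionals. \<forall>c. coset_deviation Q l c \<in> {0, p, r}"
    and pr: "p \<noteq> 0" "r \<noteq> 0" "p \<noteq> r"
  defines "n \<equiv> real CARD('a) ^ m"
  defines "n0 \<equiv> n / real CARD('a)"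
  defines "N \<equiv> n0 + coset_deviation Q (\<lambda>_. 0) 0"
  defines "kp \<equiv> (n0 ^ 2 + n0 * (real CARD('a) - 2) * N - r * (n - n0)) / (p * (p - r))"
    and "kr \<equiv> (n0 ^ 2 + n0 * (real CARD('a) - 2) * N - p * (n - n0)) / (r * (r - p))"
    and "tp \<equiv> n ^ 2 * (real CARD('a) - 1) / real CARD('a) / (p * (p - r))"
    and "tr \<equiv> n ^ 2 * (real CARD('a) - 1) / real CARD('a) / (r * (r - p))"
    and "w \<equiv> \<lambda>e d. nat \<lfloor>n - n0 - d - e\<rfloor>"
  shows "coset_enumerator Q = monom kp (w 0 p) + monom kr (w 0 r) + monom (n - kp - kr) (w 0 0)
    + (monom (tp - kp) (w 1 p) + monom (tr - kr) (w 1 r)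
      + monom (n * (real CARD('a) - 1) - (tp - kp) - (tr - kr)) (w 1 0))"
proof -
  have vals: "coset_deviation Q l c \<in> {0, p, r}" if "l \<in> functionals" for l c
    using dev_vals that by blast
  let ?A = "functionals \<times> (UNIV - {0 :: 'a})"
  let ?D = "\<lambda>p. coset_deviation Q (fst p) (snd p)"
  have finA: "finite ?A" by (simp add: finite_functionals)
  have wt: "hamming_weight (\<lambda>x. Q x + l x + c) = w (of_bool (c \<noteq> 0)) (coset_deviation Q l c)"
    if "l \<in> functionals" for l c
    using hamming_weight_coset[OF Q that, of c] by (simp add: w_def n_def n0_def)
  have wt0: "hamming_weight (\<lambda>x. Q x + l x) = w 0 (coset_deviation Q l 0)" if "l \<in> functionals" for l
    using wt[OF that, of 0] by simp
  have wt1: "hamming_weight (\<lambda>x. Q x + l x + c) = w 1 (coset_deviation Q l c)"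
    if "l \<in> functionals" "c \<noteq> 0" for l c
    using wt[OF that(1), of c] that(2) by simp
  have splitA: "(\<Sum>l\<in>functionals. \<Sum>c\<in>UNIV. g l c) = (\<Sum>l\<in>functionals. g l 0) + (\<Sum>p\<in>?A. g (fst p) (snd p))"
    for g :: "('b \<Rightarrow> 'a) \<Rightarrow> 'a \<Rightarrow> 'd::comm_monoid_add"
  proof -
    have "(\<Sum>c\<in>UNIV. g l c) = g l 0 + (\<Sum>c\<in>UNIV - {0}. g l c)" for l
      by (rule sum.remove) auto
    then show ?thesis by (simp add: sum.distrib sum.cartesian_product split_def)
  qed
  have N: "N = real (card {x. Q x = 0})"
    by (simp add: N_def n0_def n_def coset_deviation_def)
  have m1: "(\<Sum>l\<in>functionals. coset_deviation Q l 0) = n - n0"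
    using first_moment_linear[OF Q] by (simp add: n_def n0_def)
  have m2: "(\<Sum>l\<in>functionals. coset_deviation Q l 0 ^ 2) = n0 ^ 2 + n0 * (real CARD('a) - 2) * N"
    using second_moment_linear[OF Q] by (simp add: n_def n0_def N)
  have m1A: "(\<Sum>p\<in>?A. ?D p) = - (n - n0)"
    using first_moment_affine[OF Q] unfolding splitA m1 by simp
  have m2A: "(\<Sum>p\<in>?A. ?D p ^ 2) = n ^ 2 * (real CARD('a) - 1) / real CARD('a)
      - (n0 ^ 2 + n0 * (real CARD('a) - 2) * N)"
    using second_moment_affine[OF Q] unfolding splitA m2 by (simp add: n_def)
  have cardF: "real (card functionals) = n" by (simp add: card_functionals n_def)
  have cardA: "real (card ?A) = n * (real CARD('a) - 1)"
    using card_field_ge_2[where 'q = 'a]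
    by (simp add: card_cartesian_product card_functionals n_def card_Diff_singleton of_nat_diff)
  note tl = three_value_cards[where X = functionals and f = "\<lambda>l. coset_deviation Q l 0",
      OF finite_functionals vals pr]
  note ta = three_value_cards[where X = ?A and f = ?D, OF finA _ pr]
  have valA: "?D p' \<in> {0, p, r}" if "p' \<in> ?A" for p' using that vals[of "fst p'" "snd p'"] by auto
  have kp: "real (card {l \<in> functionals. coset_deviation Q l 0 = p}) = kp"
    by (subst tl(1)) (simp_all add: m1 m2 kp_def)
  have kr: "real (card {l \<in> functionals. coset_deviation Q l 0 = r}) = kr"
    by (subst tl(2)) (simp_all add: m1 m2 kr_def)
  have kpA: "real (card {p' \<in> ?A. ?D p' = p}) = tp - kp"
  proof -
    have "real (card {p' \<in> ?A. ?D p' = p})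
        = ((\<Sum>p\<in>?A. ?D p ^ 2) - r * (\<Sum>p\<in>?A. ?D p)) / (p * (p - r))" by (rule ta(1)[OF valA])
    then show ?thesis unfolding m1A m2A kp_def tp_def diff_divide_distrib[symmetric]
      by (simp add: algebra_simps)
  qed
  have krA: "real (card {p' \<in> ?A. ?D p' = r}) = tr - kr"
  proof -
    have "real (card {p' \<in> ?A. ?D p' = r})
        = ((\<Sum>p\<in>?A. ?D p ^ 2) - p * (\<Sum>p\<in>?A. ?D p)) / (r * (r - p))" by (rule ta(2)[OF valA])
    then show ?thesis unfolding m1A m2A kr_def tr_def diff_divide_distrib[symmetric]
      by (simp add: algebra_simps)
  qed
  have "coset_enumerator Q = (\<Sum>l\<in>functionals. monom 1 (w 0 (coset_deviation Q l 0)))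
      + (\<Sum>p'\<in>?A. monom 1 (w 1 (?D p')))"
    unfolding coset_enumerator_def splitA
  proof (intro arg_cong2[where f = "(+)"] sum.cong refl)
    show "monom 1 (hamming_weight (\<lambda>x. Q x + l x + 0)) = monom 1 (w 0 (coset_deviation Q l 0))"
      if "l \<in> functionals" for l using wt0[OF that] by simp
    show "monom 1 (hamming_weight (\<lambda>x. Q x + fst p' x + snd p')) = monom 1 (w 1 (?D p'))"
      if "p' \<in> ?A" for p' using wt1[of "fst p'" "snd p'"] that by (simp add: mem_Times_iff)
  qed
  also have "(\<Sum>l\<in>functionals. monom 1 (w 0 (coset_deviation Q l 0)))
      = monom kp (w 0 p) + monom kr (w 0 r) + monom (n - kp - kr) (w 0 0)"
    by (subst tl(4)) (simp_all add: tl(3) kp kr cardF)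
  also have "(\<Sum>p'\<in>?A. monom 1 (w 1 (?D p'))) = monom (tp - kp) (w 1 p) + monom (tr - kr) (w 1 r)
      + monom (n * (real CARD('a) - 1) - (tp - kp) - (tr - kr)) (w 1 0)"
    by (subst ta(4)[OF valA], assumption, subst ta(3)[OF valA], assumption)
      (simp only: kpA krA cardA)
  finally show ?thesis .
qed

end

section \<open>Matching the coefficients with \<open>omega\<close>\<close>

lemma even_coefficients:
  fixes q S k t b :: real
  assumes "q > 1" "S > 0" "k > 0" "t = 1 \<or> t = - 1" and b: "b = t * (k / S)"
  shows "(k ^ 2 + k * (q - 2) * (k + (q - 1) * b) - - b * (q * k - k)) / ((q - 1) * b * ((q - 1) * b - - b))
      = S ^ 2 / q + t * (S / q) * (q - 1)"
    and "(k ^ 2 + k * (q - 2) * (k + (q - 1) * b) - (q - 1) * b * (q * k - k)) / (- b * (- b - (q - 1) * b))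
      = (S ^ 2 / q - t * (S / q)) * (q - 1)"
    and "(q * k) ^ 2 * (q - 1) / q / ((q - 1) * b * ((q - 1) * b - - b)) = S ^ 2"
    and "(q * k) ^ 2 * (q - 1) / q / (- b * (- b - (q - 1) * b)) = S ^ 2 * (q - 1)"
proof -
  have b0: "b \<noteq> 0" using assms by auto
  have t2: "t * t = 1" using assms(4) by auto
  \<comment> \<open>In the application \<open>S\<close> is \<open>q^s\<close>, \<open>k\<close> is
    \<open>q^(m-1)\<close> and \<open>b\<close> is the signed \<open>q^(m-s-1)\<close>. With
    \<open>k\<close> expressed through \<open>b\<close>, each numerator acquires the factor
    \<open>b * b\<close> of the denominator.\<close>
  have k: "k = t * S * b" using assms t2 by (simp add: b)
  have den: "(q - 1) * b * ((q - 1) * b - - b) = q * (q - 1) * (b * b)" "- b * (- b - (q - 1) * b) = q * (b * b)"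
    by (simp_all add: algebra_simps)
  have "k ^ 2 + k * (q - 2) * (k + (q - 1) * b) - - b * (q * k - k)
      = (t * t * S ^ 2 / q + t * (S / q) * (q - 1)) * (q * (q - 1) * (b * b))"
    using assms(1) unfolding k by (simp add: field_simps power2_eq_square)
  then show "(k ^ 2 + k * (q - 2) * (k + (q - 1) * b) - - b * (q * k - k)) / ((q - 1) * b * ((q - 1) * b - - b))
      = S ^ 2 / q + t * (S / q) * (q - 1)"
    unfolding den using t2 b0 assms(1) by simp
  have "k ^ 2 + k * (q - 2) * (k + (q - 1) * b) - (q - 1) * b * (q * k - k)
      = (t * t * S ^ 2 / q - t * (S / q)) * (q - 1) * (q * (b * b))"
    using assms(1) unfolding k by (simp add: field_simps power2_eq_square)
  then show "(k ^ 2 + k * (q - 2) * (k + (q - 1) * b) - (q - 1) * b * (q * k - k)) / (- b * (- b - (q - 1) * b))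
      = (S ^ 2 / q - t * (S / q)) * (q - 1)"
    unfolding den using t2 b0 assms(1) by simp
  have kk: "k ^ 2 = S ^ 2 * (b * b)" using t2 unfolding k by (simp add: power2_eq_square algebra_simps)
  show "(q * k) ^ 2 * (q - 1) / q / ((q - 1) * b * ((q - 1) * b - - b)) = S ^ 2"
    "(q * k) ^ 2 * (q - 1) / q / (- b * (- b - (q - 1) * b)) = S ^ 2 * (q - 1)"
    unfolding den power_mult_distrib kk using b0 assms(1) by (simp_all add: field_simps power2_eq_square)
qed

text \<open>The same computation with values \<open>b\<close> and \<open>- b\<close>. The form
  itself has deviation 0, so the number of zeros is \<open>k\<close>.\<close>

lemma odd_coefficients:
  fixes q S k b :: real
  assumes "q > 1" "S > 0" "k > 0" and b: "b = k / S"
  shows "(k ^ 2 + k * (q - 2) * k - - b * (q * k - k)) / (b * (b - - b)) = 1/2 * (S ^ 2 + S) * (q - 1)"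
    and "(k ^ 2 + k * (q - 2) * k - b * (q * k - k)) / (- b * (- b - b)) = 1/2 * (S ^ 2 - S) * (q - 1)"
    and "(q * k) ^ 2 * (q - 1) / q / (b * (b - - b)) = 1/2 * q * S ^ 2 * (q - 1)"
    and "(q * k) ^ 2 * (q - 1) / q / (- b * (- b - b)) = 1/2 * q * S ^ 2 * (q - 1)"
proof -
  have b0: "b \<noteq> 0" using assms by auto
  have k: "k = S * b" using assms by simp
  have den: "b * (b - - b) = 2 * (b * b)" "- b * (- b - b) = 2 * (b * b)" by (simp_all add: algebra_simps)
  have "k ^ 2 + k * (q - 2) * k - - b * (q * k - k) = 1/2 * (S ^ 2 + S) * (q - 1) * (2 * (b * b))"
    unfolding k by (simp add: power2_eq_square algebra_simps)
  then show "(k ^ 2 + k * (q - 2) * k - - b * (q * k - k)) / (b * (b - - b)) = 1/2 * (S ^ 2 + S) * (q - 1)"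
    unfolding den using b0 by simp
  have "k ^ 2 + k * (q - 2) * k - b * (q * k - k) = 1/2 * (S ^ 2 - S) * (q - 1) * (2 * (b * b))"
    unfolding k by (simp add: power2_eq_square algebra_simps)
  then show "(k ^ 2 + k * (q - 2) * k - b * (q * k - k)) / (- b * (- b - b)) = 1/2 * (S ^ 2 - S) * (q - 1)"
    unfolding den using b0 by simp
  have "(q * k) ^ 2 * (q - 1) / q = 1/2 * q * S ^ 2 * (q - 1) * (2 * (b * b))"
    using assms(1) unfolding k by (simp add: power2_eq_square)
  then show "(q * k) ^ 2 * (q - 1) / q / (b * (b - - b)) = 1/2 * q * S ^ 2 * (q - 1)"
    "(q * k) ^ 2 * (q - 1) / q / (- b * (- b - b)) = 1/2 * q * S ^ 2 * (q - 1)"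
    unfolding den using b0 by simp_all
qed

text \<open>Bridges the real exponents obtained from deviations and the integer exponents of
  \<open>omega\<close>.\<close>

lemma monom_floor: "x = real_of_int z \<Longrightarrow> a = a' \<Longrightarrow> monom a (nat \<lfloor>x\<rfloor>) = term_poly a' z"
  by (simp add: term_poly_def)

context quadratic_space
begin

lemma even_enumerator:
  assumes Q: "quadratic_form Q" and m: "m \<ge> 1" and s: "2 * s \<le> m" and \<tau>: "\<tau> = 1 \<or> \<tau> = (- 1 :: int)"
  defines "b \<equiv> real_of_int \<tau> * (real CARD('a) ^ (m - s) / real CARD('a))"
  assumes vals: "\<forall>l\<in>functionals. \<forall>c. coset_deviation Q l c \<in> {0, (real CARD('a) - 1) * b, - b}"
    and dev0: "coset_deviation Q (\<lambda>_. 0) 0 = (real CARD('a) - 1) * b"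
  shows "coset_enumerator Q = omega CARD('a) m (EvenRank (int s) \<tau>)"
proof -
  let ?q = "real CARD('a)"
  have q1: "?q > 1" using card_field_ge_2[where 'q = 'a] by linarith
  have sm: "s < m" using s m by linarith
  obtain M where M: "m = Suc M" using m by (cases m) auto
  obtain d where d: "m - s = Suc d" using sm by (metis Suc_diff_Suc)
  define k where "k = ?q ^ M"
  define S where "S = ?q ^ s"
  have n: "?q ^ m = ?q * k" by (simp add: M k_def)
  have n0: "?q * k / ?q = k" using q1 by simp
  have kS: "k = ?q ^ d * S"
  proof -
    have "M = d + s" using M d sm by linarith
    then show ?thesis by (simp add: k_def S_def power_add)
  qed
  have pos: "k > 0" "S > 0" using q1 by (simp_all add: k_def S_def)
  have bd: "b = real_of_int \<tau> * ?q ^ d" using q1 by (simp add: b_def d)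
  have b: "b = real_of_int \<tau> * (k / S)" using pos by (simp add: bd kS)
  have b0: "b \<noteq> 0" using b pos \<tau> by auto
  have t: "real_of_int \<tau> = 1 \<or> real_of_int \<tau> = - 1" using \<tau> by auto
  note co = even_coefficients[OF q1 pos(2,1) t b]
  have ne: "(?q - 1) * b \<noteq> 0" "- b \<noteq> 0" "(?q - 1) * b \<noteq> - b"
    using b0 q1 by (auto simp: algebra_simps)
  have pu2: "?q powi (2 * int s) = S ^ 2"
    using power_int_of_nat[of ?q "2 * s"] by (simp add: S_def power_even_eq)
  have pu1: "?q powi (2 * int s - 1) = S ^ 2 / ?q" "?q powi (int s - 1) = S / ?q"
    using q1 pu2 by (simp_all add: power_int_diff S_def)
  have nt: "nat (int m - int s - 1) = d" using d by simp
  have M1: "m - 1 = M" by (simp add: M)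
  let ?A = "int CARD('a) ^ M" and ?B = "int CARD('a) ^ d" and ?Q = "int CARD('a)"
  let ?t = "real_of_int \<tau>" and ?v = "S / ?q" and ?p = "?q - 1"
  have kA: "k = real_of_int ?A" by (simp add: k_def)
  define u where "u = S ^ 2 / ?q"
  have uq: "S ^ 2 = u * ?q" using q1 by (simp add: u_def)
  \<comment> \<open>Here \<open>u\<close> is \<open>q^(2s-1)\<close> and \<open>?v\<close> is
    \<open>q^(s-1)\<close>. In the order of the terms of \<open>omega\<close> these are the second,
    sixth, fourth, first, fifth and third: the three deviations for \<open>c = 0\<close>, then for
    nonzero \<open>c\<close>.\<close>
  have eqs: "monom (u + ?t * ?v * ?p) (nat \<lfloor>?q * k - k - ?p * b - 0\<rfloor>)
      = term_poly (u + ?t * ?v * ?p) ((?A - \<tau> * ?B) * (?Q - 1))"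
    "monom ((u - ?t * ?v) * ?p) (nat \<lfloor>?q * k - k - - b - 0\<rfloor>)
      = term_poly ((u - ?t * ?v) * ?p) (?A * (?Q - 1) + \<tau> * ?B)"
    "monom (?q * k - (u + ?t * ?v * ?p) - (u - ?t * ?v) * ?p) (nat \<lfloor>?q * k - k - 0 - 0\<rfloor>)
      = term_poly (?q * k - S ^ 2) (?A * (?Q - 1))"
    "monom (S ^ 2 - (u + ?t * ?v * ?p)) (nat \<lfloor>?q * k - k - ?p * b - 1\<rfloor>)
      = term_poly ((u - ?t * ?v) * ?p) ((?A - \<tau> * ?B) * (?Q - 1) - 1)"
    "monom (S ^ 2 * ?p - (u - ?t * ?v) * ?p) (nat \<lfloor>?q * k - k - - b - 1\<rfloor>)
      = term_poly ((u * ?p + ?t * ?v) * ?p) (?A * (?Q - 1) + \<tau> * ?B - 1)"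
    "monom (?q * k * ?p - (S ^ 2 - (u + ?t * ?v * ?p)) - (S ^ 2 * ?p - (u - ?t * ?v) * ?p))
        (nat \<lfloor>?q * k - k - 0 - 1\<rfloor>)
      = term_poly ((?q * k - S ^ 2) * ?p) (?A * (?Q - 1) - 1)"
    by (rule monom_floor; simp only: kA bd uq; simp add: algebra_simps)+
  show ?thesis
    unfolding coset_enumerator_three_values[OF Q vals ne] dev0 n
    unfolding n0 co omega.simps Let_def pu2 pu1 nt M1
    unfolding u_def[symmetric] eqs
    by (simp only: n add_ac)
qed

lemma odd_enumerator:
  assumes Q: "quadratic_form Q" and s: "2 * s + 1 \<le> m"
  defines "b \<equiv> real CARD('a) ^ (m - s) / real CARD('a)"
  assumes vals: "\<forall>l\<in>functionals. \<forall>c. coset_deviation Q l c \<in> {0, b, - b}"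
    and dev0: "coset_deviation Q (\<lambda>_. 0) 0 = 0"
  shows "coset_enumerator Q = omega CARD('a) m (OddRank (int s))"
proof -
  let ?q = "real CARD('a)"
  have q1: "?q > 1" using card_field_ge_2[where 'q = 'a] by linarith
  have m: "m \<ge> 1" using s by linarith
  have sm: "s < m" using s by linarith
  obtain M where M: "m = Suc M" using m by (cases m) auto
  obtain d where d: "m - s = Suc d" using sm by (metis Suc_diff_Suc)
  define k where "k = ?q ^ M"
  define S where "S = ?q ^ s"
  have n: "?q ^ m = ?q * k" by (simp add: M k_def)
  have n0: "?q * k / ?q = k" using q1 by simp
  have kS: "k = ?q ^ d * S"
  proof -
    have "M = d + s" using M d sm by linarith
    then show ?thesis by (simp add: k_def S_def power_add)
  qed
  have pos: "k > 0" "S > 0" using q1 by (simp_all add: k_def S_def)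
  have bd: "b = ?q ^ d" using q1 by (simp add: b_def d)
  have b: "b = k / S" using pos by (simp add: bd kS)
  have ne: "b \<noteq> 0" "- b \<noteq> 0" "b \<noteq> - b" using b pos by auto
  note co = odd_coefficients[OF q1 pos(2,1) b]
  have pu2: "?q powi (2 * int s) = S ^ 2"
    using power_int_of_nat[of ?q "2 * s"] by (simp add: S_def power_even_eq)
  have pu1: "?q powi int s = S" by (simp add: S_def)
  have nt: "nat (int m - int s - 1) = d" using d by simp
  have M1: "m - 1 = M" by (simp add: M)
  let ?A = "int CARD('a) ^ M" and ?B = "int CARD('a) ^ d" and ?Q = "int CARD('a)" and ?p = "?q - 1"
  have kA: "k = real_of_int ?A" by (simp add: k_def)
  have eqs: "monom (1/2 * (S ^ 2 + S) * ?p) (nat \<lfloor>?q * k - k - b - 0\<rfloor>)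
      = term_poly (1/2 * (S ^ 2 + S) * ?p) (?A * (?Q - 1) - ?B)"
    "monom (1/2 * (S ^ 2 - S) * ?p) (nat \<lfloor>?q * k - k - - b - 0\<rfloor>)
      = term_poly (1/2 * (S ^ 2 - S) * ?p) (?A * (?Q - 1) + ?B)"
    "monom (?q * k - 1/2 * (S ^ 2 + S) * ?p - 1/2 * (S ^ 2 - S) * ?p) (nat \<lfloor>?q * k - k - 0 - 0\<rfloor>)
      = term_poly (?q * k - S ^ 2 * ?p) (?A * (?Q - 1))"
    "monom (1/2 * ?q * S ^ 2 * ?p - 1/2 * (S ^ 2 + S) * ?p) (nat \<lfloor>?q * k - k - b - 1\<rfloor>)
      = term_poly (1/2 * (S ^ 2 * ?p - S) * ?p) (?A * (?Q - 1) - ?B - 1)"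
    "monom (1/2 * ?q * S ^ 2 * ?p - 1/2 * (S ^ 2 - S) * ?p) (nat \<lfloor>?q * k - k - - b - 1\<rfloor>)
      = term_poly (1/2 * (S ^ 2 * ?p + S) * ?p) (?A * (?Q - 1) + ?B - 1)"
    "monom (?q * k * ?p - (1/2 * ?q * S ^ 2 * ?p - 1/2 * (S ^ 2 + S) * ?p)
        - (1/2 * ?q * S ^ 2 * ?p - 1/2 * (S ^ 2 - S) * ?p)) (nat \<lfloor>?q * k - k - 0 - 1\<rfloor>)
      = term_poly ((?q * k - S ^ 2 * ?p) * ?p) (?A * (?Q - 1) - 1)"
    by (rule monom_floor; (simp only: kA bd; simp add: algebra_simps; fail)?; simp add: field_simps power2_eq_square; fail)+
  show ?thesis
    unfolding coset_enumerator_three_values[OF Q vals ne] dev0 n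
    unfolding n0 add_0_right co omega.simps Let_def
      pu2 pu1 nt M1 eqs
    by (simp only: n add_ac)
qed

text \<open>Equivalent forms have equally many zeros, so this number can be computed on the model.
  As it depends on \<open>\<tau>\<close>, the type of a form is unique.\<close>

lemma has_type_deviation:
  assumes Q: "quadratic_form Q"
    and lam: "even CARD('a) \<Longrightarrow> \<nexists>t. t ^ 2 + t = lam"
    and eta: "odd CARD('a) \<Longrightarrow> nonsquare eta"
    and ty: "has_type lam eta Q \<tau>" and s: "form_rank Q = 2 * s"
  shows "coset_deviation Q (\<lambda>_. 0) 0
    = (real CARD('a) - 1) * (real_of_int \<tau> * (real CARD('a) ^ (m - s) / real CARD('a)))"
proof -
  have sm: "2 * s \<le> m" using s by (simp add: form_rank_def)
  have equiv: "coset_deviation Q (\<lambda>_. 0) 0 = coset_deviation Q' (\<lambda>_. 0) 0" if eq: "form_equivalent Q Q'" for Q'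
  proof -
    obtain a L where aL: "a \<noteq> 0" "bij L" "\<And>x. Q' x = a * Q (L x)"
      using eq unfolding form_equivalent_def by blast
    have "bij_betw L {x. Q' x = 0} {x. Q x = 0}"
    proof (rule bij_betw_imageI)
      show "inj_on L {x. Q' x = 0}" using aL(2) by (meson bij_def inj_on_subset subset_UNIV)
      show "L ` {x. Q' x = 0} = {x. Q x = 0}"
      proof
        show "{x. Q x = 0} \<subseteq> L ` {x. Q' x = 0}"
        proof
          fix y assume "y \<in> {x. Q x = 0}"
          moreover obtain x where "y = L x" using aL(2) by (meson bij_pointE)
          ultimately show "y \<in> L ` {x. Q' x = 0}" using aL(3) by auto
        qed
      qed (use aL in auto)
    qed
    then show ?thesis by (simp add: coset_deviation_def bij_betw_same_card)
  qed
  show ?thesis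
  proof (cases "s = 0")
    case True
    then have \<tau>: "\<tau> = 1" using ty s by (simp add: has_type_def)
    show ?thesis
    proof (rule canonical_form[OF Q lam eta])
      fix v s' assume v: "ordered_basis v" "form_rank Q = 2 * s'" "2 * s' \<le> m" "Q = hyperbolic_form v s'"
      then show ?thesis
        using even_coset_deviation(2)[OF v(1) sm lam eta, of Q 1] s \<tau> by simp
    qed (use True s in auto)
  next
    case False
    then have "\<tau> = 1 \<and> (\<exists>v. ordered_basis v \<and> form_equivalent Q (hyperbolic_form v s)) \<or>
        \<tau> = -1 \<and> (\<exists>v. ordered_basis v \<and> form_equivalent Q (elliptic_form lam eta v s))"
      using ty s by (simp add: has_type_def)
    then show ?thesis
    proof (elim disjE conjE exE)
      fix v assume v: "\<tau> = 1" "ordered_basis v" "form_equivalent Q (hyperbolic_form v s)"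
      show ?thesis
        using even_coset_deviation(2)[OF v(2) sm lam eta, of "hyperbolic_form v s" 1] v(1) equiv[OF v(3)]
        by simp
    next
      fix v assume v: "\<tau> = -1" "ordered_basis v" "form_equivalent Q (elliptic_form lam eta v s)"
      show ?thesis
        using even_coset_deviation(2)[OF v(2) sm lam eta, of "elliptic_form lam eta v s" "-1"] v(1)
          equiv[OF v(3)] False
        by simp
    qed
  qed
qed

lemma form_equivalent_refl: "form_equivalent Q Q"
  unfolding form_equivalent_def
  by (rule exI[of _ 1], rule exI[of _ "\<lambda>x. x"]) (simp add: linear_ident bij_def)

text \<open>The canonical form supplies an index. It is the only one: the rank fixes parity and
  \<open>s\<close>, the number of zeros fixes the type.\<close>

lemma coset_enumerator_index:
  assumes Q: "quadratic_form Q" and m: "m \<ge> 1"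
    and lam: "even CARD('a) \<Longrightarrow> \<nexists>t. t ^ 2 + t = lam"
    and eta: "odd CARD('a) \<Longrightarrow> nonsquare eta"
  shows "\<exists>i\<in>form_indices. (\<forall>j\<in>form_indices. Q \<in> form_class lam eta j \<longleftrightarrow> j = i)
    \<and> coset_enumerator Q = omega CARD('a) m i"
proof -
  have q1: "real CARD('a) > 1" using card_field_ge_2[where 'q = 'a] by linarith
  have even: ?thesis
    if v: "ordered_basis v" "form_rank Q = 2 * s" "2 * s \<le> m" and \<tau>: "\<tau> = 1 \<or> \<tau> = (-1::int)"
      and form: "Q = hyperbolic_form v s \<and> real_of_int \<tau> = 1
        \<or> Q = elliptic_form lam eta v s \<and> s \<ge> 1 \<and> real_of_int \<tau> = - 1" for v s \<tau>
  proof (intro bexI[of _ "EvenRank (int s) \<tau>"] conjI ballI)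
    show "EvenRank (int s) \<tau> \<in> form_indices" using \<tau> by (auto simp: form_indices_def)
    note ev = even_coset_deviation[OF v(1,3) lam eta form]
    show "coset_enumerator Q = omega CARD('a) m (EvenRank (int s) \<tau>)"
      by (rule even_enumerator[OF Q m v(3) \<tau>]) (use ev in blast)+
    have ty: "has_type lam eta Q \<tau>"
      unfolding has_type_def v(2) using form v(1) form_equivalent_refl[of Q] by auto
    have uniq: "\<sigma> = \<tau>" if "has_type lam eta Q \<sigma>" for \<sigma>
    proof -
      have eq: "(real CARD('a) - 1) * (real_of_int \<sigma> * (real CARD('a) ^ (m - s) / real CARD('a)))
        = (real CARD('a) - 1) * (real_of_int \<tau> * (real CARD('a) ^ (m - s) / real CARD('a)))"
        using has_type_deviation[OF Q lam eta that v(2)]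
          has_type_deviation[OF Q lam eta ty v(2)] by linarith
      have ne: "real CARD('a) - 1 \<noteq> 0" "real CARD('a) ^ (m - s) / real CARD('a) \<noteq> 0"
        using q1 by auto
      have "real_of_int \<sigma> = real_of_int \<tau>"
        by (rule mult_right_cancel[THEN iffD1, OF ne(2) mult_left_cancel[THEN iffD1, OF ne(1) eq]])
      then show ?thesis by simp
    qed
    fix j assume "j \<in> form_indices"
    show "Q \<in> form_class lam eta j \<longleftrightarrow> j = EvenRank (int s) \<tau>"
    proof (cases j)
      case (OddRank r)
      have "2 * int s \<noteq> 2 * r + 1" by presburger
      then show ?thesis using OddRank v(2) by simp
    next
      case (EvenRank r \<sigma>)
      have "has_type lam eta Q \<sigma> \<longleftrightarrow> \<sigma> = \<tau>" using ty uniq by blast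
      then have "Q \<in> form_class lam eta j \<longleftrightarrow> 2 * int s = 2 * r \<and> \<sigma> = \<tau>"
        using EvenRank Q v(2) by simp
      then show ?thesis using EvenRank by auto
    qed
  qed
  show ?thesis
  proof (rule canonical_form[OF Q lam eta])
    fix v s assume "ordered_basis v" "form_rank Q = 2 * s" "2 * s \<le> m" "Q = hyperbolic_form v s"
    then show ?thesis by (intro even[of v s 1]) auto
  next
    fix v s assume "ordered_basis v" "1 \<le> s" "form_rank Q = 2 * s" "2 * s \<le> m" "Q = elliptic_form lam eta v s"
    then show ?thesis by (intro even[of v s "-1"]) auto
  next
    fix v s a assume v: "ordered_basis v" "form_rank Q = 2 * s + 1" "2 * s + 1 \<le> m" "a \<noteq> 0"
      "Q = (\<lambda>x. hyperbolic_form v s x + a * coordinate v x (2 * s + 1) ^ 2)"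
    note od = parabolic_coset_deviation[OF v(1,3,4,5)]
    show ?thesis
    proof (intro bexI[of _ "OddRank (int s)"] conjI ballI)
      show "OddRank (int s) \<in> form_indices" by (simp add: form_indices_def)
      show "coset_enumerator Q = omega CARD('a) m (OddRank (int s))"
        by (rule odd_enumerator[OF Q v(3)]) (use od in blast)+
      fix j assume "j \<in> form_indices"
      show "Q \<in> form_class lam eta j \<longleftrightarrow> j = OddRank (int s)"
      proof (cases j)
        case (OddRank r)
        then show ?thesis using Q v(2) by auto
      next
        case (EvenRank r \<sigma>)
        have "2 * int s + 1 \<noteq> 2 * r" by presburger
        then show ?thesis using EvenRank v(2) by simp
      qed
    qed
  qed
qed

end

section \<open>The distance enumerator\<close>

lemma smult_sum_right: "smult c (\<Sum>i\<in>I. f i) = (\<Sum>i\<in>I. smult c (f i))"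
  by (induction I rule: infinite_finite_induct) (auto simp: smult_add_right)

context quadratic_space
begin

section \<open>Codewords and their parameters\<close>

definition codeword :: "('b \<Rightarrow> 'a) \<times> ('b \<Rightarrow> 'a) \<times> 'a \<Rightarrow> 'b \<Rightarrow> 'a" where
  "codeword = (\<lambda>(Q, l, c). restrict (\<lambda>x. Q x + l x + c) nonzero)"

lemma quadratic_form_diff:
  assumes "quadratic_form Q" "quadratic_form Q'"
  shows "quadratic_form (\<lambda>x. Q x - Q' x)"
proof -
  have diff: "polar (\<lambda>x. Q x - Q' x) = (\<lambda>x y. polar Q x y - polar Q' x y)"
    by (simp add: polar_def fun_eq_iff)
  show ?thesis
    using assms unfolding quadratic_form_def linear_functional_iff diff by (simp add: algebra_simps)
qed

lemma code_of_forms_eq: "code_of_forms Y = codeword ` (Y \<times> functionals \<times> UNIV)"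
proof -
  have "restrict (\<lambda>x. Q x + restrict (\<lambda>x. l x + c) nonzero x) nonzero = codeword (Q, l, c)" for Q l c
    by (auto simp: codeword_def fun_eq_iff)
  then have "{restrict (\<lambda>x. Q x + r x) nonzero | r. r \<in> affine_code}
      = codeword ` ({Q} \<times> functionals \<times> UNIV)" for Q
    unfolding affine_code_def functionals_def by (auto simp: image_iff; metis)
  then show ?thesis unfolding code_of_forms_def by auto
qed

text \<open>For \<open>q > 2\<close> compare a nonzero vector with a multiple by a scalar other than
  0 and 1. For \<open>q = 2\<close> the vectors \<open>v 1\<close>, \<open>v 2\<close> and their sum
  serve instead, which takes dimension 2.\<close>

lemma affine_vanishing:
  assumes k: "k \<in> functionals" and m: "m \<ge> 1" and small: "(CARD('a), m) \<noteq> (2, 1)"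
    and vanish: "\<And>x. x \<noteq> 0 \<Longrightarrow> k x + e = 0"
  shows "k x = 0" "e = 0"
proof -
  have "e = 0"
  proof -
    obtain v where v: "ordered_basis v" using exists_ordered_basis by blast
    have v0: "v i \<noteq> 0" if "i \<in> {1..m}" for i
      using coordinate_basis[OF v that that] coordinate_scale[OF v, of 0 0 i] by auto
    show ?thesis
    proof (cases "CARD('a) = 2")
      case True
      then have m2: "2 \<le> m" using m small by auto
      then have "v 1 + v 2 \<noteq> 0"
        using coordinate_add[OF v, of "v 1" "v 2" 1] coordinate_basis[OF v, of _ 1]
          coordinate_scale[OF v, of 0 0 1] by auto
      then have "k (v 1 + v 2) + e = 0" "k (v 1) + e = 0" "k (v 2) + e = 0"
        using vanish v0 m2 by auto
      moreover have "k (v 1 + v 2) = k (v 1) + k (v 2)"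
        using k by (simp add: functionals_def linear_functional_iff)
      ultimately show ?thesis by (metis add.assoc add.right_neutral add_left_cancel add.commute)
    next
      case False
      have "\<exists>a::'a. a \<notin> {0, 1}"
      proof (rule ccontr)
        assume "\<nexists>a::'a. a \<notin> {0, 1}"
        then have "(UNIV :: 'a set) = {0, 1}" by auto
        then have "CARD('a) = card {0, 1 :: 'a}" by simp
        then show False using False by simp
      qed
      then obtain a :: 'a where a: "a \<noteq> 0" "a \<noteq> 1" by auto
      have "k (v 1) + e = 0" "k (a *s v 1) + e = 0" using vanish v0[of 1] m a by auto
      then have "k (v 1) = - e" "a * k (v 1) = - e"
        using functional_scale[OF k] by (simp_all add: add_eq_0_iff2)
      then have "(a - 1) * e = 0" by (simp add: algebra_simps)
      then show ?thesis using a by simp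
    qed
  qed
  then show "e = 0" "k x = 0" using vanish[of x] functional_zero[OF k] by (cases "x = 0"; simp)+
qed

text \<open>A quadratic form that is affine on the nonzero vectors vanishes: its homogeneity settles
  \<open>q \<ge> 4\<close>, and its polar form, which would be a nonzero constant on independent pairs, the rest.\<close>

lemma affine_quadratic_form:
  assumes D: "quadratic_form D" and k: "k \<in> functionals" and m: "m \<ge> 1"
    and rank: "CARD('a) = 2 \<Longrightarrow> form_rank D \<noteq> 1"
    and small: "(CARD('a), m) \<notin> {(2, 1), (2, 2), (3, 1)}"
    and eq: "\<And>x. x \<noteq> 0 \<Longrightarrow> D x = k x + e"
  shows "D x = 0"
proof -
  obtain v where v: "ordered_basis v" using exists_ordered_basis by blast
  have co0: "coordinate v 0 i = 0" for i using coordinate_scale[OF v, of 0 0 i] by simp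
  have nz: "x \<noteq> 0" if "coordinate v x i \<noteq> 0" for x i using that co0 by auto
  have k_add: "k (x + y) = k x + k y" for x y using k by (simp add: functionals_def linear_functional_iff)
  consider "CARD('a) = 2" "m \<ge> 3" | "CARD('a) = 3" "m \<ge> 2" | "CARD('a) \<ge> 4"
    using small m card_field_ge_2[where 'q = 'a] by (cases "CARD('a) = 2"; cases "CARD('a) = 3") auto
  then show ?thesis
  proof cases
    case 1
    have co: "coordinate v (v i) j = (if i = j then 1 else 0)" if "i \<in> {1..3}" "j \<in> {1..3}" for i j
      using coordinate_basis[OF v, of i j] that 1 by auto
    have ne: "v 1 \<noteq> 0" "v 2 \<noteq> 0" "v 3 \<noteq> 0" "v 1 + v 2 \<noteq> 0" "v 1 + v 3 \<noteq> 0" "v 2 + v 3 \<noteq> 0"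
      "v 1 + (v 2 + v 3) \<noteq> 0"
    proof -
      show "v 1 \<noteq> 0" "v 1 + v 2 \<noteq> 0" "v 1 + v 3 \<noteq> 0" "v 1 + (v 2 + v 3) \<noteq> 0"
        by (rule nz[of _ 1], simp add: coordinate_add[OF v] co)+
      show "v 2 \<noteq> 0" "v 2 + v 3 \<noteq> 0"
        by (rule nz[of _ 2], simp add: coordinate_add[OF v] co)+
      show "v 3 \<noteq> 0" by (rule nz[of _ 3]) (simp add: co)
    qed
    \<comment> \<open>Of the three copies of \<open>e\<close> in the polar form one survives with
      sign minus. Additivity in the second argument then forces \<open>- e = - e - e\<close>; it
      needs the third basis vector.\<close>
    have pol: "polar D (v 1) (v 2) = - e" "polar D (v 1) (v 3) = - e" "polar D (v 1) (v 2 + v 3) = - e"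
      using ne by (simp_all add: polar_def eq k_add)
    have "- e = - e + - e" using polar_add_right[OF D, of "v 1" "v 2" "v 3"] unfolding pol .
    then have e: "e = 0" by (simp only: add_cancel_right_right neg_equal_0_iff_equal)
    have Dk: "D x = k x" for x using eq[of x] e form_zero[OF D] functional_zero[OF k] by (cases "x = 0") auto
    then have "polar D x y = 0" for x y by (simp add: polar_def k_add)
    then have R: "form_radical D = {x. D x = 0}" by (auto simp: form_radical_def)
    show "D x = 0"
    proof (rule ccontr)
      assume x: "D x \<noteq> 0"
      \<comment> \<open>\<open>D\<close> is a nonzero functional with zero polar form, so its
        radical is a hyperplane and its rank 1, which is excluded.\<close>
      have "1 + dim (form_radical D) = m"
      proof (rule adapted_basis[where R = "form_radical D" and n = 1 and w = "\<lambda>_. x"])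
        show "subspace (form_radical D)" by (rule subspace_radical[OF D])
        show "\<forall>i\<in>{1..1}. c i = 0" if "(\<Sum>i\<in>{1..1::nat}. c i *s x) \<in> form_radical D" for c
          using that x by (simp add: R form_scale[OF D])
        show "\<exists>c. y - (\<Sum>i\<in>{1..1::nat}. c i *s x) \<in> form_radical D" for y
          using x by (intro exI[of _ "\<lambda>_. D y / D x"])
            (simp add: R Dk functional_diff[OF k] functional_scale[OF k])
      qed
      then have "form_rank D = 1" by (simp add: form_rank_def)
      then show False using rank 1 by simp
    qed
  next
    case 2
    then have two: "(2::'a) \<noteq> 0" by (metis even_card_iff_two_eq_0 odd_numeral)
    have co: "coordinate v (v i) j = (if i = j then 1 else 0)" if "i \<in> {1..2}" "j \<in> {1..2}" for i j
      using coordinate_basis[OF v, of i j] that 2 by auto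
    \<comment> \<open>\<open>D\<close> is even and \<open>k\<close> is odd.\<close>
    have kz: "k x = 0" for x
    proof (cases "x = 0")
      case False
      have "D ((- 1) *s x) = D x" by (simp only: form_scale[OF D]) simp
      then have "- k x = k x" using eq[of x] eq[of "- x"] False functional_scale[OF k, of "- 1" x] by simp
      then have "2 * k x = 0" by (metis add.right_inverse mult_2)
      then show ?thesis using two by simp
    qed (simp add: functional_zero[OF k])
    have ne: "v 1 \<noteq> 0" "v 2 \<noteq> 0" "v 1 + v 2 \<noteq> 0" "v 1 + (- 1) *s v 2 \<noteq> 0"
    proof -
      show "v 1 \<noteq> 0" by (rule nz[of _ 1]) (simp add: co)
      show "v 2 \<noteq> 0" by (rule nz[of _ 2]) (simp add: co)
      show "v 1 + v 2 \<noteq> 0" by (rule nz[of _ 1]) (simp add: coordinate_add[OF v] co)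
      show "v 1 + (- 1) *s v 2 \<noteq> 0"
        by (rule nz[of _ 1], subst coordinate_add[OF v], subst coordinate_scale[OF v]) (simp add: co)
    qed
    have d: "D (v 1) = e" "D (v 2) = e" "D (v 1 + v 2) = e" "D (v 1 + (- 1) *s v 2) = e"
      using eq ne kz by simp_all
    \<comment> \<open>\<open>D\<close> equals \<open>e\<close> on all nonzero vectors; evaluating it
      at the sum and the difference of two basis vectors gives \<open>e + P = 0\<close> and
      \<open>e - P = 0\<close>.\<close>
    define P where "P = polar D (v 1) (v 2)"
    have "D (v 1 + v 2) = D (v 1) + D (v 2) + P" unfolding P_def by (rule form_add[OF D])
    then have "e + (e + P) = e" unfolding d by (simp only: add.assoc)
    then have "e + P = 0" by (simp only: add_cancel_left_right)
    moreover have "D (v 1 + (- 1) *s v 2) = D (v 1) + D (v 2) - P"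
      unfolding form_add[OF D] form_scale[OF D] polar_scale_right[OF D] P_def by simp
    then have "e + (e - P) = e" unfolding d by (simp only: add_diff_eq)
    then have "e - P = 0" by (simp only: add_cancel_left_right)
    ultimately have "e + e = 0" by simp
    then have "2 * e = 0" by (simp only: mult_2)
    then have "e = 0" using two by simp
    then show ?thesis using eq[of x] kz form_zero[OF D] by (cases "x = 0") auto
  next
    case 3
    show ?thesis
    proof (cases "x = 0")
      case False
      \<comment> \<open>Computing \<open>D (a *s x)\<close> by homogeneity and by the affine
        formula, the difference has the factor \<open>a - 1\<close>. Two such scalars, available
        once \<open>q\<close> is at least 4, force \<open>D x = 0\<close>.\<close>
      have root: "a * D x + e = 0" if a: "a \<notin> {0, 1}" for a
      proof -
        have "a ^ 2 * (k x + e) = a * k x + e"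
          using eq[of "a *s x"] eq[of x] False a by (simp add: form_scale[OF D] functional_scale[OF k])
        then have "(a - 1) * (a * D x + e) = 0"
          unfolding eq[OF False] by (simp add: power2_eq_square algebra_simps)
        then show ?thesis using a by simp
      qed
      have "\<exists>a b::'a. a \<notin> {0, 1} \<and> b \<notin> {0, 1} \<and> a \<noteq> b"
      proof -
        have c2: "card (UNIV - {0, 1::'a}) \<ge> 2" using 3 by (simp add: card_Diff_subset)
        then have "UNIV - {0, 1::'a} \<noteq> {}" by (metis card.empty not_numeral_le_zero)
        then obtain a :: 'a where a: "a \<in> UNIV - {0, 1}" by blast
        have "card (UNIV - {0, 1::'a} - {a}) \<ge> 1" using c2 card_Diff_singleton[OF a] by linarith
        then have "UNIV - {0, 1::'a} - {a} \<noteq> {}" by (metis card.empty not_one_le_zero)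
        then show ?thesis using a by blast
      qed
      then obtain a b :: 'a where ab: "a \<notin> {0, 1}" "b \<notin> {0, 1}" "a \<noteq> b" by blast
      have "(a - b) * D x = (a * D x + e) - (b * D x + e)" by (simp add: algebra_simps)
      also have "\<dots> = 0" unfolding root[OF ab(1)] root[OF ab(2)] by simp
      finally have "(a - b) * D x = 0" .
      then show ?thesis using ab by simp
    qed (simp add: form_zero[OF D])
  qed
qed

lemma inj_codeword:
  assumes m: "m \<ge> 1" and Y: "Y \<subseteq> Collect quadratic_form"
    and rank: "CARD('a) = 2 \<Longrightarrow> \<forall>Q\<in>Y. \<forall>Q'\<in>Y. form_rank (\<lambda>x. Q x - Q' x) \<noteq> 1"
    and small: "(CARD('a), m) \<noteq> (2, 1)" "(CARD('a), m) \<in> {(2, 2), (3, 1)} \<Longrightarrow> card Y = 1"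
  shows "inj_on codeword (Y \<times> functionals \<times> UNIV)"
proof (rule inj_onI)
  fix p p' :: "('b \<Rightarrow> 'a) \<times> ('b \<Rightarrow> 'a) \<times> 'a"
  assume p: "p \<in> Y \<times> functionals \<times> UNIV" "p' \<in> Y \<times> functionals \<times> UNIV"
    and peq: "codeword p = codeword p'"
  obtain Q l c where p1: "p = (Q, l, c)" by (cases p)
  obtain Q' l' c' where p2: "p' = (Q', l', c')" by (cases p')
  have Q: "Q \<in> Y" "Q' \<in> Y" and l: "l \<in> functionals" "l' \<in> functionals"
    and eq: "codeword (Q, l, c) = codeword (Q', l', c')"
    using p peq by (simp_all add: p1 p2)
  define D k e where "D = (\<lambda>x. Q x - Q' x)" and "k = (\<lambda>x. l' x - l x)" and "e = c' - c"
  have eqx: "D x = k x + e" if "x \<noteq> 0" for x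
    using fun_cong[OF eq, of x] that by (simp add: codeword_def D_def k_def e_def algebra_simps)
  have k: "k \<in> functionals" unfolding k_def by (rule functionals_closed(3)[OF l(2,1)])
  have qD: "quadratic_form D" unfolding D_def using Q Y by (intro quadratic_form_diff) auto
  have D0: "D x = 0" for x
  \<comment> \<open>In these two exceptional cases \<open>Y\<close> is a singleton, so the
    difference form is zero for trivial reasons.\<close>
  proof (cases "(CARD('a), m) \<in> {(2, 2), (3, 1)}")
    case True
    then have "Q = Q'" using small(2) Q by (metis card_1_singletonE singletonD)
    then show ?thesis by (simp add: D_def)
  next
    case False
    show ?thesis
      by (rule affine_quadratic_form[OF qD k m _ _ eqx]) (use False small(1) rank Q in \<open>auto simp: D_def\<close>)
  qed
  have van: "k x + e = 0" if "x \<noteq> 0" for x using eqx[OF that] D0 by simp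
  have "k x = 0" "e = 0" for x using affine_vanishing[OF k m small(1) van] by auto
  then show "p = p'" using D0 by (simp add: p1 p2 D_def k_def e_def fun_eq_iff)
qed

section \<open>Summation over pairs of codewords\<close>

lemma coset_enumerator_translate:
  assumes l: "l \<in> functionals"
  shows "(\<Sum>l'\<in>functionals. \<Sum>c'\<in>UNIV. monom 1 (hamming_weight (\<lambda>x. Q x + (l' x - l x) + (c' - c))))
    = coset_enumerator Q"
proof -
  have "coset_enumerator Q = (\<Sum>l'\<in>functionals. \<Sum>c'\<in>UNIV. monom 1 (hamming_weight (\<lambda>x. Q x + l' x + (c' - c))))"
    unfolding coset_enumerator_def
    by (intro sum.cong refl sum.reindex_bij_witness[of _ "\<lambda>c'. c' - c" "\<lambda>c'. c' + c"]) auto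
  also have "\<dots> = (\<Sum>l'\<in>functionals. \<Sum>c'\<in>UNIV. monom 1 (hamming_weight (\<lambda>x. Q x + (l' x - l x) + (c' - c))))"
    by (rule sum.reindex_bij_witness[of _ "\<lambda>l' x. l' x - l x" "\<lambda>l' x. l' x + l x"])
      (use functionals_closed l in auto)
  finally show ?thesis ..
qed

text \<open>Differences of affine functions run through all affine functions, each
  \<open>q^(m+1)\<close> times. Injectivity makes the size of the code \<open>card Y\<close> times
  the same power, which therefore cancels.\<close>

lemma distance_enumerator_code:
  assumes inj: "inj_on codeword (Y \<times> functionals \<times> UNIV)" and fin: "finite Y"
  shows "distance_enumerator (code_of_forms Y)
    = smult (1 / real (card Y)) (\<Sum>Q'\<in>Y. \<Sum>Q\<in>Y. coset_enumerator (\<lambda>x. Q x - Q' x))"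
proof -
  let ?X = "Y \<times> functionals \<times> (UNIV :: 'a set)" and ?n = "real CARD('a) ^ m * real CARD('a)"
  let ?h = "\<lambda>c b. monom 1 (hamming_weight (\<lambda>x. c x - b x)) :: real poly"
  have card: "real (card (codeword ` ?X)) = real (card Y) * ?n"
    by (simp add: card_image[OF inj] card_cartesian_product card_functionals)
  have hw: "?h (codeword (Q', l', c')) (codeword (Q, l, c))
      = monom 1 (hamming_weight (\<lambda>x. (Q' x - Q x) + (l' x - l x) + (c' - c)))" for Q l c Q' l' c'
    unfolding hamming_weight_def
    by (intro arg_cong2[where f = monom] refl arg_cong[where f = card] Collect_cong)
      (auto simp: codeword_def algebra_simps)
  have triple: "(\<Sum>(Q, l, c)\<in>?X. g Q l c) = (\<Sum>Q\<in>Y. \<Sum>l\<in>functionals. \<Sum>c\<in>UNIV. g Q l c)"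
    for g :: "('b \<Rightarrow> 'a) \<Rightarrow> ('b \<Rightarrow> 'a) \<Rightarrow> 'a \<Rightarrow> real poly"
    by (simp add: sum.cartesian_product)
  have "(\<Sum>b\<in>codeword ` ?X. \<Sum>c\<in>codeword ` ?X. ?h c b)
      = (\<Sum>(Q, l, c)\<in>?X. \<Sum>(Q', l', c')\<in>?X. ?h (codeword (Q', l', c')) (codeword (Q, l, c)))"
    by (simp add: sum.reindex[OF inj] split_def)
  also have "\<dots> = (\<Sum>Q\<in>Y. \<Sum>l\<in>functionals. \<Sum>c\<in>UNIV. \<Sum>Q'\<in>Y. \<Sum>l'\<in>functionals. \<Sum>c'\<in>UNIV.
      monom 1 (hamming_weight (\<lambda>x. (Q' x - Q x) + (l' x - l x) + (c' - c))))"
    unfolding hw triple ..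
  also have "\<dots> = (\<Sum>Q\<in>Y. \<Sum>l\<in>functionals. \<Sum>c\<in>(UNIV :: 'a set). \<Sum>Q'\<in>Y. coset_enumerator (\<lambda>x. Q' x - Q x))"
    by (intro sum.cong refl) (rule coset_enumerator_translate)
  also have "\<dots> = smult ?n (\<Sum>Q\<in>Y. \<Sum>Q'\<in>Y. coset_enumerator (\<lambda>x. Q' x - Q x))"
    by (simp add: card_functionals sum_distrib_left of_nat_poly smult_sum_right mult.commute)
  finally show ?thesis
    unfolding distance_enumerator_def code_of_forms_eq card by simp
qed

text \<open>Pairs of forms are grouped by the index of their difference; the group sizes are the
  entries of the inner distribution times \<open>card Y\<close>.\<close>

lemma distance_enumerator_index_sum:
  assumes m: "m \<ge> 1" and Y: "Y \<subseteq> Collect quadratic_form" "Y \<noteq> {}"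
    and lam: "even CARD('a) \<Longrightarrow> \<nexists>t. t ^ 2 + t = lam"
    and eta: "odd CARD('a) \<Longrightarrow> nonsquare eta"
    and rank: "CARD('a) = 2 \<Longrightarrow> \<forall>Q\<in>Y. \<forall>Q'\<in>Y. form_rank (\<lambda>x. Q x - Q' x) \<noteq> 1"
    and small: "(CARD('a), m) \<noteq> (2, 1)" "(CARD('a), m) \<in> {(2, 2), (3, 1)} \<Longrightarrow> card Y = 1"
  shows "distance_enumerator (code_of_forms Y)
    = index_sum (inner_distribution lam eta Y) (omega CARD('a) m)"
proof -
  have "finite (UNIV \<rightarrow>\<^sub>E UNIV :: ('b \<Rightarrow> 'a) set)" by (rule finite_PiE) (auto simp: finite_space)
  then have fin: "finite Y" by (simp add: PiE_UNIV_domain finite_subset[of Y UNIV])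
  have inj: "inj_on codeword (Y \<times> functionals \<times> UNIV)"
    by (rule inj_codeword[OF m Y(1)]) (rule rank small; assumption)+
  obtain idx where idx: "\<And>Q. quadratic_form Q \<Longrightarrow> idx Q \<in> form_indices"
    "\<And>Q j. quadratic_form Q \<Longrightarrow> j \<in> form_indices \<Longrightarrow> Q \<in> form_class lam eta j \<longleftrightarrow> j = idx Q"
    "\<And>Q. quadratic_form Q \<Longrightarrow> coset_enumerator Q = omega CARD('a) m (idx Q)"
    using coset_enumerator_index[OF _ m lam eta] by metis
  let ?d = "\<lambda>p x. fst p x - snd p x"
  let ?g = "\<lambda>p. idx (?d p)"
  let ?a = "inner_distribution lam eta Y"
  have qf: "quadratic_form (?d p)" if "p \<in> Y \<times> Y" for p
    using that Y by (intro quadratic_form_diff) auto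
  have a: "?a i = real (card {p \<in> Y \<times> Y. ?g p = i}) / real (card Y)" if "i \<in> form_indices" for i
  proof -
    have "{(Q, Q') \<in> Y \<times> Y. (\<lambda>x. Q x - Q' x) \<in> form_class lam eta i} = {p \<in> Y \<times> Y. ?g p = i}"
      using idx(2)[OF qf that] by (auto simp: split_def)
    then show ?thesis by (simp add: inner_distribution_def)
  qed
  have cardY: "real (card Y) \<noteq> 0" using fin Y by simp
  \<comment> \<open>\<open>index_sum\<close> ranges over nonzero entries, and these are exactly the
    indices attained by differences.\<close>
  have supp: "{i. i \<in> form_indices \<and> ?a i \<noteq> 0} = ?g ` (Y \<times> Y)"
  proof (intro equalityI subsetI)
    fix i assume i: "i \<in> {i. i \<in> form_indices \<and> ?a i \<noteq> 0}"
    then have "card {p \<in> Y \<times> Y. ?g p = i} \<noteq> 0" using a by auto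
    then have "{p \<in> Y \<times> Y. ?g p = i} \<noteq> {}" by (metis card.empty)
    then show "i \<in> ?g ` (Y \<times> Y)" by blast
  next
    fix i assume "i \<in> ?g ` (Y \<times> Y)"
    then obtain p where p: "p \<in> Y \<times> Y" "i = ?g p" by blast
    then have i: "i \<in> form_indices" using idx(1) qf by blast
    have "{p \<in> Y \<times> Y. ?g p = i} \<noteq> {}" using p by blast
    moreover have "finite {p \<in> Y \<times> Y. ?g p = i}" using fin by simp
    ultimately have "0 < card {p \<in> Y \<times> Y. ?g p = i}" by (simp only: card_gt_0_iff simp_thms)
    then have "?a i \<noteq> 0" unfolding a[OF i] using cardY by simp
    then show "i \<in> {i. i \<in> form_indices \<and> ?a i \<noteq> 0}" using i by blast
  qed
  have "(\<Sum>Q'\<in>Y. \<Sum>Q\<in>Y. coset_enumerator (\<lambda>x. Q x - Q' x))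
      = (\<Sum>p\<in>Y \<times> Y. coset_enumerator (?d p))"
    by (subst sum.swap) (simp add: sum.cartesian_product split_def)
  also have "\<dots> = (\<Sum>p\<in>Y \<times> Y. omega CARD('a) m (?g p))"
    by (rule sum.cong) (use idx(3) qf in auto)
  also have "\<dots> = (\<Sum>i\<in>?g ` (Y \<times> Y). \<Sum>p\<in>{p \<in> Y \<times> Y. ?g p = i}. omega CARD('a) m (?g p))"
    by (rule sum.image_gen) (simp add: fin)
  also have "\<dots> = (\<Sum>i\<in>?g ` (Y \<times> Y). smult (real (card {p \<in> Y \<times> Y. ?g p = i})) (omega CARD('a) m i))"
    by (rule sum.cong) (simp_all add: of_nat_poly)
  finally have "distance_enumerator (code_of_forms Y) = (\<Sum>i\<in>?g ` (Y \<times> Y).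
      smult (real (card {p \<in> Y \<times> Y. ?g p = i}) / real (card Y)) (omega CARD('a) m i))"
    unfolding distance_enumerator_code[OF inj fin] by (simp add: smult_sum_right)
  also have "\<dots> = (\<Sum>i\<in>?g ` (Y \<times> Y). smult (?a i) (omega CARD('a) m i))"
  proof (rule sum.cong)
    fix i assume "i \<in> ?g ` (Y \<times> Y)"
    then have "i \<in> form_indices" using supp by blast
    then show "smult (real (card {p \<in> Y \<times> Y. ?g p = i}) / real (card Y)) (omega CARD('a) m i)
      = smult (?a i) (omega CARD('a) m i)" by (simp add: a)
  qed simp
  finally show ?thesis unfolding index_sum_def supp .
qed

end

theorem theorem6p2:
  fixes scale :: "'q::{field,finite} \<Rightarrow> 'v::ab_group_add \<Rightarrow> 'v"
    and m :: nat and lam eta :: 'q and Y :: "('v \<Rightarrow> 'q) set"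
  assumes V: "vector_space scale" "vector_space.dim scale UNIV = m" "m \<ge> 1"
    and lam: "even CARD('q) \<Longrightarrow> absolute_trace lam = 1"
    and eta: "odd CARD('q) \<Longrightarrow> nonsquare eta"
    and Y: "Y \<subseteq> {Q. finite_field_space.quadratic_form scale Q}" "Y \<noteq> {}"
      "finite_field_space.nondegenerate scale Y"
    and no_rank_one_difference: "CARD('q) = 2 \<Longrightarrow>
      \<forall>Q\<in>Y. \<forall>Q'\<in>Y. finite_field_space.form_rank scale (\<lambda>x. Q x - Q' x) \<noteq> 1"
    and small_cases: "(CARD('q), m) \<noteq> (2, 1)"
      "(CARD('q), m) \<in> {(2, 2), (3, 1)} \<Longrightarrow> card Y = 1"
  shows "finite_field_space.distance_enumerator (finite_field_space.code_of_forms scale Y)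
       = index_sum (finite_field_space.inner_distribution scale lam eta Y) (omega CARD('q) m)"
proof -
  interpret V: vector_space scale by (rule V(1))
  obtain B where B: "V.independent B" "UNIV \<subseteq> V.span B" "card B = V.dim UNIV"
    using V.basis_exists by blast
  \<comment> \<open>An infinite set has \<open>card\<close> 0, which contradicts
    \<open>m \<ge> 1\<close>.\<close>
  have finB: "finite B" using B(3) V(2,3) by (metis card.infinite not_one_le_zero)
  interpret quadratic_space scale B
    by unfold_locales (use B finB in auto)
  have lam': "\<nexists>t. t ^ 2 + t = lam" if "even CARD('q)"
    using lam[OF that] trace_artin_schreier[OF that[unfolded even_card_iff_two_eq_0]] zero_neq_one by metis
  show ?thesis
    using distance_enumerator_index_sum[of Y lam eta] V Y lam' eta no_rank_one_difference small_cases
    by simp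
qed

end
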